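(* The smooth closed $5$-manifold $X$, obtained by resolving the singularities of the orbifold $T^5/\Gamma$ as described in the context, is simply connected.
   Context: Construction of $X$. Points of $T^5=\mathbb{R}^5/\mathbb{Z}^5$ are written $x=(x_1,\dots,x_5)$ modulo $\mathbb{Z}^5$. Consider the commuting isometric involutions $\alpha(x)=(x_1,-x_2,-x_3,\tfrac12-x_4,-x_5)$, $\beta(x)=(-x_1,\tfrac12-x_2,-x_3,x_4,-x_5)$, $\gamma(x)=(-x_1,-x_2,\tfrac12-x_3,-x_4,x_5)$ of $T^5$, generating $\Gamma\cong(\mathbb{Z}_2)^3$. The fixed point set of each of $\alpha,\beta,\gamma$ is a union of $16$ circles; these $48$ circles are pairwise disjoint, and all other nontrivial elements of $\Gamma$ act without fixed points. The singular set of $T^5/\Gamma$ is a disjoint union of $12$ circles, and each has a neighborhood of the form $S^1\times (B_{1/10}/\{\pm1\})$, where $B_{1/10}$ is the ball of radius $\tfrac1{10}$ around $0\in\mathbb{C}^2$. Let $Y$ be a disk bundle of $T^*S^2$, so $\partial Y=\mathbb{RP}^3$ (equivalently, $Y$ is the $\mathbb{Z}_2$-quotient of the blow-up of the $4$-ball at the origin, i.e. the resolution of $B_{1/10}/\{\pm1\}$). $X$ is obtained from $T^5/\Gamma$ by deleting the $12$ neighborhoods $S^1\times(B_{1/10}/\{\pm1\})$ and gluing in a copy of $S^1\times Y$ along each boundary component $S^1\times\mathbb{RP}^3$ (preserving the product structure). *)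

theory Defs
  imports "HOL-Analysis.Analysis" "HOL-Algebra.Bij" "HOL-Algebra.Generated_Groups"
begin

section \<open>Topological preliminaries\<close>

definition quotient_topology :: "'a topology \<Rightarrow> ('a \<Rightarrow> 'b) \<Rightarrow> 'b topology" where
  "quotient_topology X f =
     topology (\<lambda>U. U \<subseteq> f ` topspace X \<and> openin X {x \<in> topspace X. f x \<in> U})"

lemma openin_quotient_topology:
  "openin (quotient_topology X f) U \<longleftrightarrow>
     U \<subseteq> f ` topspace X \<and> openin X {x \<in> topspace X. f x \<in> U}"
proof -
  have "istopology (\<lambda>U. U \<subseteq> f ` topspace X \<and> openin X {x \<in> topspace X. f x \<in> U})"
  proof -
    have 1: "{x \<in> topspace X. f x \<in> S \<inter> T}
        = {x \<in> topspace X. f x \<in> S} \<inter> {x \<in> topspace X. f x \<in> T}" for S T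
      by auto
    have 2: "{x \<in> topspace X. f x \<in> \<Union> \<K>} = (\<Union>K\<in>\<K>. {x \<in> topspace X. f x \<in> K})" for \<K>
      by auto
    show ?thesis
      unfolding istopology_def 1 2 by blast
  qed
  then show ?thesis
    by (simp add: quotient_topology_def)
qed

lemma topspace_quotient_topology [simp]:
  "topspace (quotient_topology X f) = f ` topspace X"
proof
  show "topspace (quotient_topology X f) \<subseteq> f ` topspace X"
    using openin_topspace[of "quotient_topology X f"] unfolding openin_quotient_topology
    by (rule conjunct1)
  have "{x \<in> topspace X. f x \<in> f ` topspace X} = topspace X"
    by auto
  then have "openin (quotient_topology X f) (f ` topspace X)"
    by (simp add: openin_quotient_topology)
  then show "f ` topspace X \<subseteq> topspace (quotient_topology X f)"
    by (rule openin_subset)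
qed

lemma quotient_map_quotient_topology: "quotient_map X (quotient_topology X f) f"
  by (auto simp: quotient_map_def openin_quotient_topology)

text \<open>The disjoint union of two spaces with possibly different underlying types.\<close>

definition disjoint_union_topology :: "'a topology \<Rightarrow> 'b topology \<Rightarrow> ('a + 'b) topology" where
  "disjoint_union_topology X Y =
     topology (\<lambda>U. U \<subseteq> topspace X <+> topspace Y \<and> openin X (Inl -` U) \<and> openin Y (Inr -` U))"

lemma openin_disjoint_union_topology:
  "openin (disjoint_union_topology X Y) U \<longleftrightarrow>
     U \<subseteq> topspace X <+> topspace Y \<and> openin X (Inl -` U) \<and> openin Y (Inr -` U)"
proof -
  have "istopology (\<lambda>U. U \<subseteq> topspace X <+> topspace Y \<and> openin X (Inl -` U) \<and> openin Y (Inr -` U))"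
    unfolding istopology_def vimage_Int vimage_Union
  proof (intro conjI allI impI)
    fix K
    assume "\<forall>U\<in>K. U \<subseteq> topspace X <+> topspace Y \<and> openin X (Inl -` U) \<and> openin Y (Inr -` U)"
    then show "\<Union>K \<subseteq> topspace X <+> topspace Y"
      and "openin X (\<Union>U\<in>K. Inl -` U)" and "openin Y (\<Union>U\<in>K. Inr -` U)"
      by (blast, blast, blast)
  qed (simp_all add: le_infI1 openin_Int)
  then show ?thesis
    by (simp add: disjoint_union_topology_def)
qed

lemma topspace_disjoint_union_topology [simp]:
  "topspace (disjoint_union_topology X Y) = topspace X <+> topspace Y"
proof
  show "topspace (disjoint_union_topology X Y) \<subseteq> topspace X <+> topspace Y"
    using openin_topspace[of "disjoint_union_topology X Y"] unfolding openin_disjoint_union_topology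
    by (rule conjunct1)
  have "Inl -` (topspace X <+> topspace Y) = topspace X" "Inr -` (topspace X <+> topspace Y) = topspace Y"
    by auto
  then have "openin (disjoint_union_topology X Y) (topspace X <+> topspace Y)"
    by (simp add: openin_disjoint_union_topology)
  then show "topspace X <+> topspace Y \<subseteq> topspace (disjoint_union_topology X Y)"
    by (rule openin_subset)
qed

text \<open>
  The library constant \<^const>\<open>simply_connected\<close> only covers subsets of a type with a
  topology.  As there, homotopies between loops are homotopies relative to the end points.
\<close>

definition simply_connected_space :: "'a topology \<Rightarrow> bool" where
  "simply_connected_space X \<longleftrightarrow>
     path_connected_space X \<and>
     (\<forall>p. pathin X p \<and> p 1 = p 0 \<longrightarrow>
        homotopic_with (\<lambda>q. q 0 = p 0 \<and> q 1 = p 0) (top_of_set {0..1}) X p (\<lambda>t. p 0))"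

lemma simply_connected_space_top_of_set:
  fixes S :: "'a::real_normed_vector set"
  shows "simply_connected_space (top_of_set S) \<longleftrightarrow> simply_connected S"
proof -
  have lp: "linepath a a = (\<lambda>t. a)" for a :: 'a
    by (auto simp: linepath_def algebra_simps)
  have pin: "pathin (top_of_set S) p \<longleftrightarrow> path p \<and> path_image p \<subseteq> S" for p :: "real \<Rightarrow> 'a"
    by (auto simp: pathin_def path_def path_image_def)
  have pcs: "path_connected_space (top_of_set S) \<longleftrightarrow> path_connected S"
    using path_connectedin_def[of euclidean S] unfolding path_connectedin_euclidean by simp
  show ?thesis
    unfolding simply_connected_eq_contractible_path simply_connected_space_def
      homotopic_paths_def pathstart_def pathfinish_def pin pcs lp
    by (simp add: conj_assoc)
qed


section \<open>The orbifold\<close>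

type_synonym torus_pt = "(real^5) set"

definition torus_class :: "real^5 \<Rightarrow> torus_pt" where
  "torus_class x = {y. \<forall>i. y $ i - x $ i \<in> \<int>}"

definition torus5 :: "torus_pt topology" where
  "torus5 = quotient_topology euclidean torus_class"

definition alpha :: "real^5 \<Rightarrow> real^5" where
  "alpha x = (\<chi> i. if i = 1 then x $ i else if i = 4 then 1/2 - x $ i else - x $ i)"

definition beta :: "real^5 \<Rightarrow> real^5" where
  "beta x = (\<chi> i. if i = 4 then x $ i else if i = 2 then 1/2 - x $ i else - x $ i)"

definition gamma :: "real^5 \<Rightarrow> real^5" where
  "gamma x = (\<chi> i. if i = 5 then x $ i else if i = 3 then 1/2 - x $ i else - x $ i)"

text \<open>
  These maps permute the cosets of the lattice, so the maps they induce on the torus are the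
  image maps.
\<close>

definition torus_map :: "(real^5 \<Rightarrow> real^5) \<Rightarrow> torus_pt \<Rightarrow> torus_pt" where
  "torus_map h = restrict ((`) h) (topspace torus5)"

definition Gam :: "(torus_pt \<Rightarrow> torus_pt) set" where
  "Gam = generate (BijGroup (topspace torus5)) {torus_map alpha, torus_map beta, torus_map gamma}"

lemma torus_map_torus_class:
  assumes "h \<in> {alpha, beta, gamma}"
  shows "torus_map h (torus_class x) = torus_class (h x)"
proof -
  have inv: "h (h y) = y" for y
    using assms by (auto simp: alpha_def beta_def gamma_def vec_eq_iff)
  have "h y \<in> torus_class (h x)" if "y \<in> torus_class x" for x y
    unfolding torus_class_def mem_Collect_eq
  proof
    fix i
    have "y $ i - x $ i \<in> \<int>"
      using that by (simp add: torus_class_def)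
    moreover have "h y $ i - h x $ i = y $ i - x $ i \<or> h y $ i - h x $ i = - (y $ i - x $ i)"
      using assms by (auto simp: alpha_def beta_def gamma_def)
    ultimately show "h y $ i - h x $ i \<in> \<int>"
      by (metis Ints_minus)
  qed
  note * = this
  have "h ` torus_class x = torus_class (h x)"
  proof
    show "h ` torus_class x \<subseteq> torus_class (h x)"
      using * by blast
    show "torus_class (h x) \<subseteq> h ` torus_class x"
    proof
      fix y
      assume "y \<in> torus_class (h x)"
      then have "h y \<in> torus_class x"
        using *[of y "h x"] by (simp only: inv)
      then have "h (h y) \<in> h ` torus_class x"
        by (rule imageI)
      then show "y \<in> h ` torus_class x"
        by (simp only: inv)
    qed
  qed
  then show ?thesis
    by (simp add: torus_map_def torus5_def)
qed

lemma torus_map_in_carrier: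
  assumes "h \<in> {alpha, beta, gamma}"
  shows "torus_map h \<in> carrier (BijGroup (topspace torus5))"
proof -
  have inv: "h (h y) = y" for y
    using assms by (auto simp: alpha_def beta_def gamma_def vec_eq_iff)
  have "bij_betw (torus_map h) (topspace torus5) (topspace torus5)"
    by (rule bij_betw_byWitness[where f' = "torus_map h"])
      (auto simp: torus5_def torus_map_torus_class[OF assms] inv)
  then show ?thesis
    by (simp add: BijGroup_def Bij_def torus_map_def)
qed

type_synonym orbifold_pt = "torus_pt set"
type_synonym coords = "real \<times> (complex^2) \<Rightarrow> real^5"

definition Gam_orbit :: "torus_pt \<Rightarrow> orbifold_pt" where
  "Gam_orbit c = {g c | g. g \<in> Gam}"

definition orbifold :: "orbifold_pt topology" where
  "orbifold = quotient_topology torus5 Gam_orbit"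

definition orbifold_point :: "real^5 \<Rightarrow> orbifold_pt" where
  "orbifold_point x = Gam_orbit (torus_class x)"

definition singular_set :: "orbifold_pt set" where
  "singular_set = {Gam_orbit c | c. c \<in> topspace torus5 \<and>
     (\<exists>g\<in>Gam. g \<noteq> \<one>\<^bsub>BijGroup (topspace torus5)\<^esub> \<and> g c = c)}"

definition singular_circles :: "orbifold_pt set set" where
  "singular_circles = connected_components_of (subtopology orbifold singular_set)"

text \<open>
  Product coordinates around a singular circle \<open>C\<close>: an affine isometry from
  \<open>\<real> \<times> \<complex>\<^sup>2\<close> onto \<open>\<real>\<^sup>5\<close> that sends \<open>\<real> \<times> {0}\<close> to a line covering \<open>C\<close>.  Such a line
  is parallel to a coordinate axis, and some element of order two of the group of lifts acts as
  \<open>(t, z) \<mapsto> (t, -z)\<close>.  So \<open>(t, z) \<mapsto> orbifold_point (f (t, z))\<close> induces on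
  \<open>\<bar>z\<bar> < 1/10\<close> an identification of \<open>\<real>/\<int> \<times> (B/\<plusminus>1)\<close>, where \<open>B\<close> is the ball of radius
  \<open>1/10\<close>, with the tubular neighbourhood of \<open>C\<close>.
\<close>

definition tube_coordinates ::
    "orbifold_pt set \<Rightarrow> coords \<Rightarrow> bool" where
  "tube_coordinates C f \<longleftrightarrow>
     (\<exists>p A. linear A \<and> (\<forall>v. norm (A v) = norm v) \<and> f = (\<lambda>v. p + A v)) \<and>
     range (\<lambda>t. orbifold_point (f (t, 0))) = C"

definition open_tube :: "coords \<Rightarrow> orbifold_pt set" where
  "open_tube f = {orbifold_point (f (t, z)) | t z. norm z < 1/10}"


section \<open>The local model of the resolution\<close>

definition circle_class :: "real \<Rightarrow> real set" where
  "circle_class t = {s. s - t \<in> \<int>}"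

definition unit_circle :: "real set topology" where
  "unit_circle = quotient_topology euclidean circle_class"

definition complex_line :: "complex^2 \<Rightarrow> (complex^2) set" where
  "complex_line w = range (\<lambda>c. c *s w)"

definition CP1 :: "(complex^2) set topology" where
  "CP1 = quotient_topology (top_of_set (- {0})) complex_line"

type_synonym blowup_pt = "(complex^2) \<times> (complex^2) set"

text \<open>The blow-up at the origin of the closed ball of radius \<open>1/10\<close> in \<open>\<complex>\<^sup>2\<close>.\<close>

definition blowup :: "blowup_pt topology" where
  "blowup = subtopology (prod_topology euclidean CP1) {(z, L). norm z \<le> 1/10 \<and> z \<in> L}"

definition Y_class :: "blowup_pt \<Rightarrow> blowup_pt set" where
  "Y_class = (\<lambda>(z, L). {(z, L), (- z, L)})"

text \<open>
  The quotient of the blow-up by \<open>\<plusminus>1\<close>, i.e. the disk bundle of the cotangent bundle of the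
  2-sphere.  Its boundary is given by \<open>\<bar>z\<bar> = 1/10\<close>, where \<open>z\<close> determines the line \<open>L\<close>; forgetting
  \<open>L\<close> identifies the boundary with the 3-sphere of radius \<open>1/10\<close> modulo \<open>\<plusminus>1\<close>.
\<close>

definition Y_space :: "blowup_pt set topology" where
  "Y_space = quotient_topology blowup Y_class"


section \<open>The resolution\<close>

type_synonym piece_pt = "orbifold_pt + orbifold_pt set \<times> real set \<times> blowup_pt set"

text \<open>
  The parameter \<open>F\<close> chooses product coordinates around each singular circle.  Only the underlying
  topological space of the resolution is constructed; its smooth structure is not recorded.
\<close>

definition complement_of_tubes ::
    "(orbifold_pt set \<Rightarrow> coords) \<Rightarrow> orbifold_pt topology" where
  "complement_of_tubes F =
     subtopology orbifold (topspace orbifold - (\<Union>C\<in>singular_circles. open_tube (F C)))"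

inductive glue :: "(orbifold_pt set \<Rightarrow> coords) \<Rightarrow> piece_pt \<Rightarrow> piece_pt \<Rightarrow> bool"
  for F where
  "\<lbrakk>C \<in> singular_circles; norm z = 1/10; L \<in> topspace CP1; z \<in> L\<rbrakk> \<Longrightarrow>
     glue F (Inr (C, circle_class t, Y_class (z, L))) (Inl (orbifold_point (F C (t, z))))"

definition resolution ::
    "(orbifold_pt set \<Rightarrow> coords) \<Rightarrow> piece_pt set topology" where
  "resolution F =
     quotient_topology
       (disjoint_union_topology
          (complement_of_tubes F)
          (sum_topology (\<lambda>C. prod_topology unit_circle Y_space) singular_circles))
       (\<lambda>x. {y. equivclp (glue F) x y})"

end

theory Submission
  imports Defs
begin

text \<open>
  Let \<open>W\<close> be the complement in \<open>\<real>\<^sup>5\<close> of all lines that are fixed by some lift of \<open>\<alpha>\<close>, \<open>\<beta>\<close> or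
  \<open>\<gamma>\<close> (\<open>fixed_lines\<close>).  Blowing down identifies the complement of the exceptional set
  of the resolution \<open>X\<close> with the regular part of the orbifold, so the projection of \<open>\<real>\<^sup>5\<close> to the
  orbifold gives a map \<open>cover\<close> from \<open>W\<close> to \<open>X\<close> whose fibres are the orbits of the group of all lifts of
  elements of \<open>\<Gamma>\<close> (\<open>deck_group\<close>).  Three facts make every loop of \<open>X\<close> null-homotopic.

  \<^item> \<open>W\<close> is simply connected: the fixed lines have codimension four, so the cone over a polynomial loop
    from a generic point misses them (\<open>simply_connected_Compl_countable_lines\<close>).  The homotopy class
    of the image in \<open>X\<close> of a path in \<open>W\<close> therefore depends on its end points alone.

  \<^item> Every path in \<open>X\<close> between two points of the image of \<open>W\<close> is homotopic to the image of a path in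
    \<open>W\<close> (\<open>path_homotopic_to_lift\<close>).  This is a local matter.  It holds because each point of \<open>X\<close> has a
    neighbourhood whose loops are trivial and whose regular points are joined by images of paths: the
    image of a small ball at a regular point, and a contractible coordinate patch at a point of an
    exceptional sphere.  In the orbifold itself, loops around a singular circle lift to open paths of
    \<open>W\<close>; in the resolution they are killed because the patch is simply connected.

  \<^item> The group of lifts is generated by the half-turns about the fixed lines: the half-turns about two
    parallel lines differ by a translation, and the translations so obtained generate the
    lattice (\<open>deck_equiv_imp_half_turns\<close>).  A path in \<open>W\<close> from a point to its image under a half-turn
    has a trivial image in \<open>X\<close>, because it can be moved into the patch around a point of an
    exceptional sphere (\<open>half_turn_step_trivial\<close>).

  By the second fact a loop of \<open>X\<close> is homotopic to the image of a path from some \<open>w\<close> to some \<open>g w\<close>, where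
  \<open>g\<close> is a lift; by the third fact some such path has a trivial image, and by the first fact this does
  not depend on the path.

  The circles in the statement come with arbitrary product coordinates.  These are isometries that map the
  axis \<open>z = 0\<close> to a fixed line, and different fixed lines are at least \<open>1/4\<close> apart,
  more than twice the radius of a tube, so that the coordinates of a point in a tube are unique up to
  \<open>(t, z) \<mapsto> (t + n, \<plusminus>z)\<close> (\<open>tubes_far_apart\<close>).
\<close>

section \<open>Path homotopies in abstract spaces\<close>

definition path_homotopic :: "'a topology \<Rightarrow> (real \<Rightarrow> 'a) \<Rightarrow> (real \<Rightarrow> 'a) \<Rightarrow> bool" where
  "path_homotopic X p q =
     homotopic_with (\<lambda>r. r 0 = p 0 \<and> r 1 = p 1) (top_of_set {0..1}) X p q"

definition join_path :: "(real \<Rightarrow> 'a) \<Rightarrow> (real \<Rightarrow> 'a) \<Rightarrow> real \<Rightarrow> 'a" (infixr "\<oplus>\<^sub>p" 65) where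
  "p \<oplus>\<^sub>p q = (\<lambda>t. if t \<le> 1/2 then p (2 * t) else q (2 * t - 1))"

definition reverse_path :: "(real \<Rightarrow> 'a) \<Rightarrow> real \<Rightarrow> 'a" where
  "reverse_path p = (\<lambda>t. p (1 - t))"

lemma join_path_ends [simp]: "(p \<oplus>\<^sub>p q) 0 = p 0" "(p \<oplus>\<^sub>p q) 1 = q 1"
  by (simp_all add: join_path_def)

lemma reverse_path_ends [simp]: "reverse_path p 0 = p 1" "reverse_path p 1 = p 0"
  by (simp_all add: reverse_path_def)

lemma path_homotopic_imp_ends: "path_homotopic X p q \<Longrightarrow> q 0 = p 0 \<and> q 1 = p 1"
  unfolding path_homotopic_def by (drule homotopic_with_imp_property) auto

lemma path_homotopic_imp_pathin: "path_homotopic X p q \<Longrightarrow> pathin X p \<and> pathin X q"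
  unfolding path_homotopic_def pathin_def by (drule homotopic_with_imp_continuous_maps) auto

lemma path_homotopic_refl: "pathin X p \<Longrightarrow> path_homotopic X p p"
  by (simp add: path_homotopic_def pathin_def)

lemma path_homotopic_sym: "path_homotopic X p q \<Longrightarrow> path_homotopic X q p"
  using path_homotopic_imp_ends[of X p q]
  unfolding path_homotopic_def by (simp add: homotopic_with_sym)

lemma path_homotopic_trans [trans]:
  "path_homotopic X p q \<Longrightarrow> path_homotopic X q r \<Longrightarrow> path_homotopic X p r"
  using path_homotopic_imp_ends[of X p q]
  unfolding path_homotopic_def by (auto intro: homotopic_with_trans)

lemma path_homotopic_eq:
  assumes "pathin X p" "\<And>t. t \<in> {0..1} \<Longrightarrow> p t = q t"
  shows "path_homotopic X p q"
  unfolding path_homotopic_def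
  by (rule homotopic_with_equal) (use assms in \<open>auto simp: pathin_def\<close>)

lemma path_homotopic_compose:
  assumes "path_homotopic X p q" "continuous_map X Y h"
  shows "path_homotopic Y (h \<circ> p) (h \<circ> q)"
  using assms unfolding path_homotopic_def
  by (auto intro: homotopic_with_compose_continuous_map_left)

text \<open>
  The source of most homotopies below: paths in a simply connected
  Euclidean set, pushed forward.  Applied to an interval it yields all reparametrisations, and hence the
  groupoid laws for paths.
\<close>

lemma path_homotopic_simply_connected:
  fixes S :: "'b::real_normed_vector set"
  assumes "simply_connected S" and h: "continuous_map (top_of_set S) X h"
    and "path p" "path_image p \<subseteq> S" "path q" "path_image q \<subseteq> S" "p 0 = q 0" "p 1 = q 1"
  shows "path_homotopic X (h \<circ> p) (h \<circ> q)"
proof -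
  have "homotopic_paths S p q"
    using assms unfolding simply_connected_eq_homotopic_paths
    by (auto simp: pathstart_def pathfinish_def)
  then have "path_homotopic (top_of_set S) p q"
    by (simp add: path_homotopic_def homotopic_paths_def pathstart_def pathfinish_def)
  then show ?thesis
    using h by (rule path_homotopic_compose)
qed

lemma path_homotopic_reparam:
  assumes p: "pathin X p" and "continuous_on {0..1} f" "f ` {0..1} \<subseteq> {0..1}"
    and "continuous_on {0..1} g" "g ` {0..1} \<subseteq> {0..1}" and "f 0 = g 0" "f 1 = g 1"
  shows "path_homotopic X (p \<circ> f) (p \<circ> g)"
  by (rule path_homotopic_simply_connected[of "{0..1}"])
    (use assms in \<open>auto simp: pathin_def path_def path_image_def convex_imp_simply_connected\<close>)

lemma pathin_join:
  assumes "pathin X p" "pathin X q" "p 1 = q 0"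
  shows "pathin X (p \<oplus>\<^sub>p q)"
proof -
  have "continuous_map (top_of_set {0..1}) X (\<lambda>t. if t \<le> 1/2 then p (2 * t) else q (2 * t - 1))"
  proof (rule continuous_map_cases_le)
    show "continuous_map (subtopology (top_of_set {0..1}) {x \<in> topspace (top_of_set {0..1}). x \<le> 1/2}) X (\<lambda>t. p (2 * t))"
    proof (rule continuous_map_compose[of _ "top_of_set {0..1}" "\<lambda>t. 2 * t" _ p, unfolded o_def])
      show "continuous_map (top_of_set {0..1}) X p"
        using assms by (simp add: pathin_def)
    qed (auto simp: subtopology_subtopology intro!: continuous_intros)
    show "continuous_map (subtopology (top_of_set {0..1}) {x \<in> topspace (top_of_set {0..1}). 1/2 \<le> x}) X (\<lambda>t. q (2 * t - 1))"
    proof (rule continuous_map_compose[of _ "top_of_set {0..1}" "\<lambda>t. 2 * t - 1" _ q, unfolded o_def])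
      show "continuous_map (top_of_set {0..1}) X q"
        using assms by (simp add: pathin_def)
    qed (auto simp: subtopology_subtopology intro!: continuous_intros)
  next
    fix t :: real assume "t = 1/2"
    then have "2 * t = 1" by simp
    with assms(3) show "p (2 * t) = q (2 * t - 1)"
      by (simp only: diff_self)
  qed (auto intro!: continuous_intros)
  then show ?thesis
    by (simp add: pathin_def join_path_def)
qed

lemma pathin_reparam:
  assumes "pathin X p" "continuous_on {0..1} f" "f ` {0..1} \<subseteq> {0..1}"
  shows "pathin X (p \<circ> f)"
  using assms unfolding pathin_def
  by (intro continuous_map_compose[of _ "top_of_set {0..1}"]) (auto simp: image_subset_iff)

lemma pathin_reverse: "pathin X p \<Longrightarrow> pathin X (reverse_path p)"
  using pathin_reparam[of X p "\<lambda>t. 1 - t", OF _ continuous_on_diff[OF continuous_on_const continuous_on_id]]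
  by (auto simp: reverse_path_def o_def)

lemma path_homotopic_join:
  assumes pq: "path_homotopic X p p'" "path_homotopic X q q'" and "p 1 = q 0"
  shows "path_homotopic X (p \<oplus>\<^sub>p q) (p' \<oplus>\<^sub>p q')"
proof -
  let ?I = "top_of_set {0..1::real}" and ?Q = "top_of_set ({0..1::real} \<times> {0..1::real})"
  obtain h where h: "continuous_map (prod_topology ?I ?I) X h" "\<And>x. h (0,x) = p x" "\<And>x. h (1,x) = p' x"
    "\<And>t. t \<in> {0..1} \<Longrightarrow> h (t,0) = p 0 \<and> h (t,1) = p 1"
    using pq(1) unfolding path_homotopic_def homotopic_with_def by auto
  obtain k where k: "continuous_map (prod_topology ?I ?I) X k" "\<And>x. k (0,x) = q x" "\<And>x. k (1,x) = q' x"
    "\<And>t. t \<in> {0..1} \<Longrightarrow> k (t,0) = q 0 \<and> k (t,1) = q 1"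
    using pq(2) unfolding path_homotopic_def homotopic_with_def by auto
  have Q: "prod_topology ?I ?I = ?Q"
    by simp
  have hQ: "continuous_map ?Q X h" and kQ: "continuous_map ?Q X k"
    using h(1) k(1) Q by auto
  have "continuous_map ?Q X (\<lambda>z. if snd z \<le> 1/2 then h (fst z, 2 * snd z) else k (fst z, 2 * snd z - 1))"
  proof (rule continuous_map_cases_le)
    show "continuous_map (subtopology ?Q {x \<in> topspace ?Q. snd x \<le> 1/2}) X (\<lambda>z. h (fst z, 2 * snd z))"
      by (rule continuous_map_compose[of _ ?Q "\<lambda>z. (fst z, 2 * snd z)" _ h, unfolded o_def])
        (auto simp: subtopology_subtopology intro!: continuous_intros hQ)
    show "continuous_map (subtopology ?Q {x \<in> topspace ?Q. 1/2 \<le> snd x}) X (\<lambda>z. k (fst z, 2 * snd z - 1))"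
      by (rule continuous_map_compose[of _ ?Q "\<lambda>z. (fst z, 2 * snd z - 1)" _ k, unfolded o_def])
        (auto simp: subtopology_subtopology intro!: continuous_intros kQ)
  next
    fix x assume "x \<in> topspace ?Q" "snd x = 1/2"
    then have "2 * snd x = 1" "fst x \<in> {0..1}" by auto
    then show "h (fst x, 2 * snd x) = k (fst x, 2 * snd x - 1)"
      using h(4) k(4) \<open>p 1 = q 0\<close> by (simp only: diff_self)
  qed (auto intro!: continuous_intros)
  then show ?thesis
    unfolding path_homotopic_def homotopic_with_def Q
    by (intro exI[of _ "\<lambda>z. if snd z \<le> 1/2 then h (fst z, 2 * snd z) else k (fst z, 2 * snd z - 1)"])
      (auto simp: h(2-4) k(2-4) join_path_def)
qed

text \<open>
  Both sides are the same path up to a piecewise linear change of the parameter; so are the two sides of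
  the unit laws and of the inverse law below.
\<close>

lemma path_homotopic_join_assoc:
  assumes "pathin X p" "pathin X q" "pathin X r" "p 1 = q 0" "q 1 = r 0"
  shows "path_homotopic X ((p \<oplus>\<^sub>p q) \<oplus>\<^sub>p r) (p \<oplus>\<^sub>p (q \<oplus>\<^sub>p r))"
proof -
  let ?f = "\<lambda>t::real. if t \<le> 1/2 then (if t \<le> 1/4 then 2 * t else t + 1/4) else t/2 + 1/2"
  have c: "continuous_on {0..1} ?f"
  proof -
    have *: "?f = (\<lambda>t. min (min (2 * t) (t + 1/4)) (t/2 + 1/2))"
      by (auto simp: fun_eq_iff min_def)
    show ?thesis unfolding * by (auto intro!: continuous_intros)
  qed
  have "path_homotopic X ((p \<oplus>\<^sub>p (q \<oplus>\<^sub>p r)) \<circ> ?f) ((p \<oplus>\<^sub>p (q \<oplus>\<^sub>p r)) \<circ> (\<lambda>t. t))"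
    using assms c by (intro path_homotopic_reparam pathin_join) auto
  moreover have "(p \<oplus>\<^sub>p (q \<oplus>\<^sub>p r)) \<circ> ?f = (p \<oplus>\<^sub>p q) \<oplus>\<^sub>p r"
    by (auto simp: fun_eq_iff join_path_def algebra_simps)
  ultimately show ?thesis by (simp add: o_def)
qed

lemma path_homotopic_join_const:
  assumes "pathin X p" "a = p 1"
  shows "path_homotopic X (p \<oplus>\<^sub>p (\<lambda>t. a)) p"
proof -
  have "path_homotopic X (p \<circ> (\<lambda>t. min (2 * t) 1)) (p \<circ> (\<lambda>t. t))"
    using assms by (intro path_homotopic_reparam) (auto intro!: continuous_intros)
  moreover have "p \<circ> (\<lambda>t. min (2 * t) 1) = p \<oplus>\<^sub>p (\<lambda>t. a)"
    using assms by (auto simp: fun_eq_iff join_path_def min_def)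
  ultimately show ?thesis by (simp add: o_def)
qed

lemma path_homotopic_const_join:
  assumes "pathin X p" "a = p 0"
  shows "path_homotopic X ((\<lambda>t. a) \<oplus>\<^sub>p p) p"
proof -
  have "path_homotopic X (p \<circ> (\<lambda>t. max 0 (2 * t - 1))) (p \<circ> (\<lambda>t. t))"
    using assms by (intro path_homotopic_reparam) (auto intro!: continuous_intros)
  moreover have "p \<circ> (\<lambda>t. max 0 (2 * t - 1)) = (\<lambda>t. a) \<oplus>\<^sub>p p"
    using assms by (auto simp: fun_eq_iff join_path_def max_absorb1 max_absorb2)
  ultimately show ?thesis by (simp add: o_def)
qed

lemma path_homotopic_join_reverse:
  assumes "pathin X p"
  shows "path_homotopic X (p \<oplus>\<^sub>p reverse_path p) (\<lambda>t. p 0)"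
proof -
  have "path_homotopic X (p \<circ> (\<lambda>t. min (2 * t) (2 - 2 * t))) (p \<circ> (\<lambda>t. 0))"
    using assms by (intro path_homotopic_reparam) (auto intro!: continuous_intros)
  moreover have "p \<circ> (\<lambda>t. min (2 * t) (2 - 2 * t)) = p \<oplus>\<^sub>p reverse_path p"
    by (auto simp: fun_eq_iff join_path_def reverse_path_def min_def)
  ultimately show ?thesis by (simp add: o_def)
qed

lemma path_homotopic_cancel_left:
  assumes p: "pathin X p" and q: "pathin X q" and e: "p 0 = q 0"
  shows "path_homotopic X (p \<oplus>\<^sub>p (reverse_path p \<oplus>\<^sub>p q)) q"
proof -
  have "path_homotopic X (p \<oplus>\<^sub>p (reverse_path p \<oplus>\<^sub>p q)) ((p \<oplus>\<^sub>p reverse_path p) \<oplus>\<^sub>p q)"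
    using assms by (intro path_homotopic_sym[OF path_homotopic_join_assoc] pathin_reverse) auto
  also have "path_homotopic X \<dots> ((\<lambda>t. p 0) \<oplus>\<^sub>p q)"
    using assms by (intro path_homotopic_join path_homotopic_join_reverse path_homotopic_refl) auto
  also have "path_homotopic X \<dots> q"
    using assms by (intro path_homotopic_const_join) auto
  finally show ?thesis .
qed

lemma path_homotopic_if_loop_trivial:
  assumes p: "pathin X p" and q: "pathin X q" and e: "p 0 = q 0" "p 1 = q 1"
    and null: "path_homotopic X (reverse_path p \<oplus>\<^sub>p q) (\<lambda>t. p 1)"
  shows "path_homotopic X p q"
proof -
  have "path_homotopic X p (p \<oplus>\<^sub>p (\<lambda>t. p 1))"
    using p by (intro path_homotopic_sym[OF path_homotopic_join_const]) auto
  also have "path_homotopic X \<dots> (p \<oplus>\<^sub>p (reverse_path p \<oplus>\<^sub>p q))"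
    using p by (intro path_homotopic_join path_homotopic_refl path_homotopic_sym[OF null]) auto
  also have "path_homotopic X \<dots> q"
    using assms by (intro path_homotopic_cancel_left) auto
  finally show ?thesis .
qed

lemma join_path_in: "p ` {0..1} \<subseteq> U \<Longrightarrow> q ` {0..1} \<subseteq> U \<Longrightarrow> (p \<oplus>\<^sub>p q) ` {0..1} \<subseteq> U"
  by (auto simp: join_path_def image_subset_iff)

lemma reverse_path_in: "p ` {0..1} \<subseteq> U \<Longrightarrow> reverse_path p ` {0..1} \<subseteq> U"
  by (auto simp: reverse_path_def image_subset_iff)

lemma path_homotopic_split:
  assumes p: "pathin X p" and st: "0 \<le> a" "a \<le> b" "b \<le> c" "c \<le> 1"
  shows "path_homotopic X ((\<lambda>t. p (a + (b - a) * t)) \<oplus>\<^sub>p (\<lambda>t. p (b + (c - b) * t)))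
           (\<lambda>t. p (a + (c - a) * t))"
proof -
  let ?f = "\<lambda>t::real. if t \<le> 1/2 then a + (b - a) * (2 * t) else b + (c - b) * (2 * t - 1)"
  have bd: "a + (b - a) * x \<in> {a..b}" if "0 \<le> x" "x \<le> 1" "a \<le> b" for a b x :: real
    using that mult_left_mono[of x 1 "b - a"] by (auto)
  have 1: "continuous_on {0..1} ?f"
  proof -
    have *: "?f = (\<lambda>t. (b - a) * min (2 * t) 1 + (c - b) * max 0 (2 * t - 1) + a)"
      by (auto simp: fun_eq_iff min_def max_def algebra_simps)
    show ?thesis unfolding * by (intro continuous_intros)
  qed
  have 2: "?f ` {0..1} \<subseteq> {0..1}"
  proof -
    have "?f t \<in> {0..1}" if "t \<in> {0..1}" for t
    proof (cases "t \<le> 1/2")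
      case True
      then show ?thesis using that st bd[of "2 * t" a b] by auto
    next
      case False
      then show ?thesis using that st bd[of "2 * t - 1" b c] by auto
    qed
    then show ?thesis by blast
  qed
  have 3: "(\<lambda>t. a + (c - a) * t) ` {0..1} \<subseteq> {0..1}"
    using bd[of _ a c] st by fastforce
  have "path_homotopic X (p \<circ> ?f) (p \<circ> (\<lambda>t. a + (c - a) * t))"
    by (rule path_homotopic_reparam[OF p 1 2 _ 3]) (auto intro!: continuous_intros)
  moreover have "p \<circ> ?f = (\<lambda>t. p (a + (b - a) * t)) \<oplus>\<^sub>p (\<lambda>t. p (b + (c - b) * t))"
    by (auto simp: fun_eq_iff join_path_def)
  ultimately show ?thesis by (simp add: o_def)
qed

lemma pathin_segment:
  assumes p: "pathin X p" and st: "0 \<le> a" "a \<le> b" "b \<le> 1"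
  shows "pathin X (\<lambda>t. p (a + (b - a) * t))"
  using path_homotopic_imp_pathin[OF path_homotopic_split[OF p st(1,2) order_refl st(3)]] by blast

section \<open>Lifting paths up to homotopy\<close>

text \<open>
  A contraction moves the base point, say along \<open>v\<close>, so it is only a free homotopy.  Viewed as a map from
  the square whose lower side is the loop, it makes the loop homotopic to the other three sides of the
  square, that is to \<open>v\<close>, a constant path, and \<open>v\<close> backwards.
\<close>

lemma null_homotopic_if_contractible:
  assumes U: "contractible_space (subtopology X U)" and p: "pathin X p" "p ` {0..1} \<subseteq> U" "p 0 = p 1"
  shows "path_homotopic X p (\<lambda>t. p 0)"
proof -
  let ?U = "subtopology X U" and ?I = "top_of_set {0..1::real}"
  obtain H a where H: "continuous_map (prod_topology ?I ?U) ?U H"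
    "\<And>x. H (0, x) = x" "\<And>x. H (1, x) = a"
    using U unfolding contractible_space_def homotopic_with_def by auto
  have p': "continuous_map ?I ?U p"
    using p by (auto simp: pathin_def continuous_map_in_subtopology)
  define K where "K = (\<lambda>(s, t). H (s, p t))"
  have K: "continuous_map (top_of_set ({0..1} \<times> {0..1})) X K"
  proof -
    have "continuous_map (prod_topology ?I ?I) (prod_topology ?I ?U) (\<lambda>z. (fst z, p (snd z)))"
      by (intro continuous_map_pairedI continuous_map_fst
          continuous_map_compose[OF continuous_map_snd p', unfolded o_def])
    from continuous_map_compose[OF this H(1)] show ?thesis
      by (simp add: K_def o_def case_prod_unfold continuous_map_in_subtopology)
  qed
  \<comment> \<open>The path \<open>(m, k)\<close> runs through the left, the upper and the right side of the square.\<close>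
  define m where "m = (\<lambda>t::real. min (3 * t) (min 1 (3 - 3 * t)))"
  define k where "k = (\<lambda>t::real. max 0 (min 1 (3 * t - 1)))"
  define g where "g = (\<lambda>t::real. (m t, k t))"
  have m: "continuous_on {0..1} m" "m ` {0..1} \<subseteq> {0..1}" "m 0 = 0" "m 1 = 0"
    unfolding m_def by (intro continuous_intros, auto)
  have k: "continuous_on {0..1} k" "k ` {0..1} \<subseteq> {0..1}" "k 0 = 0" "k 1 = 1"
    unfolding k_def by (intro continuous_intros, auto)
  define v where "v = (\<lambda>s. H (s, p 0))"
  have v: "pathin X v"
  proof -
    have "continuous_map ?I (prod_topology ?I ?U) (\<lambda>s. (s, p 0))"
      using p' by (intro continuous_map_pairedI) (auto simp: continuous_map_def)
    from continuous_map_compose[OF this H(1)] show ?thesis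
      by (simp add: v_def o_def pathin_def continuous_map_in_subtopology)
  qed
  have "path_homotopic X (K \<circ> (\<lambda>t. (0, t))) (K \<circ> g)"
  proof (rule path_homotopic_simply_connected[OF _ K])
    show "simply_connected ({0..1} \<times> {0..1::real} :: (real \<times> real) set)"
      by (intro convex_imp_simply_connected convex_Times) auto
    show "path g" "path_image g \<subseteq> {0..1} \<times> {0..1}"
      using m(1,2) k(1,2) unfolding path_def path_image_def g_def
      by (auto intro!: continuous_on_Pair)
    show "path (\<lambda>t. (0::real, t::real))" "path_image (\<lambda>t. (0::real, t::real)) \<subseteq> {0..1} \<times> {0..1}"
      unfolding path_def path_image_def by (auto intro!: continuous_intros)
  qed (simp_all add: g_def m k)
  moreover have "K \<circ> (\<lambda>t. (0, t)) = p"
    by (auto simp: K_def H)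
  moreover have "K \<circ> g = v \<circ> m"
  proof
    fix t :: real
    have "k t = 0 \<or> m t = 1 \<or> k t = 1"
      unfolding k_def m_def by (smt (verit))
    then show "(K \<circ> g) t = (v \<circ> m) t"
      using p(3) by (elim disjE) (simp_all add: K_def g_def v_def H(3))
  qed
  moreover have "path_homotopic X (v \<circ> m) (\<lambda>t. p 0)"
  proof -
    have "path_homotopic X (v \<circ> m) (v \<circ> (\<lambda>t::real. 0))"
      using v m by (intro path_homotopic_reparam) auto
    moreover have "v \<circ> (\<lambda>t::real. 0) = (\<lambda>t. p 0)"
      by (simp add: v_def H(2) o_def)
    ultimately show ?thesis by (simp only:)
  qed
  ultimately have "path_homotopic X p (v \<circ> m)" "path_homotopic X (v \<circ> m) (\<lambda>t. p 0)"
    by simp_all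
  then show ?thesis
    by (rule path_homotopic_trans)
qed

text \<open>
  The local condition under which paths lift up to homotopy.  It makes sense for neighbourhoods of points
  outside the image of \<open>f\<close> as well, and this is how points of the exceptional set are treated.
\<close>

definition liftable_nbhd :: "'a::real_normed_vector set \<Rightarrow> 'b topology \<Rightarrow> ('a \<Rightarrow> 'b) \<Rightarrow> 'b set \<Rightarrow> bool" where
  "liftable_nbhd W X f U \<longleftrightarrow> openin X U \<and>
     (\<forall>p. pathin X p \<and> p ` {0..1} \<subseteq> U \<and> p 0 = p 1 \<longrightarrow> path_homotopic X p (\<lambda>t. p 0)) \<and>
     (\<forall>w\<in>W. \<forall>b \<in> f ` W \<inter> U. f w \<in> U \<longrightarrow>
        (\<exists>q. path q \<and> path_image q \<subseteq> W \<and> q 0 = w \<and> f (q 1) = b \<and> f ` path_image q \<subseteq> U))"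

lemma liftable_nbhd_lift:
  assumes U: "liftable_nbhd W X f U" and f: "continuous_map (top_of_set W) X f"
    and p: "pathin X p" "p ` {0..1} \<subseteq> U" and w: "w \<in> W" "p 0 = f w" and "p 1 \<in> f ` W"
  obtains q where "path q" "path_image q \<subseteq> W" "q 0 = w" "path_homotopic X p (f \<circ> q)"
proof -
  have "p 0 \<in> U" "p 1 \<in> U"
    using p(2) by auto
  then obtain q where q: "path q" "path_image q \<subseteq> W" "q 0 = w" "f (q 1) = p 1" "f ` path_image q \<subseteq> U"
    using U w \<open>p 1 \<in> f ` W\<close> unfolding liftable_nbhd_def by (metis IntI)
  have fq: "pathin X (f \<circ> q)"
    using q(1,2) f unfolding pathin_def path_def path_image_def
    by (intro continuous_map_compose[of _ "top_of_set W"]) auto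
  have loop: "path_homotopic X (reverse_path p \<oplus>\<^sub>p (f \<circ> q)) (\<lambda>t. (reverse_path p \<oplus>\<^sub>p (f \<circ> q)) 0)"
  proof -
    have "pathin X (reverse_path p \<oplus>\<^sub>p (f \<circ> q))"
      using p q w fq by (intro pathin_join pathin_reverse) auto
    moreover have "(reverse_path p \<oplus>\<^sub>p (f \<circ> q)) ` {0..1} \<subseteq> U"
      using p(2) q(5) by (intro join_path_in reverse_path_in) (auto simp: path_image_def)
    moreover have "(reverse_path p \<oplus>\<^sub>p (f \<circ> q)) 0 = (reverse_path p \<oplus>\<^sub>p (f \<circ> q)) 1"
      using q(4) by simp
    ultimately show ?thesis
      using U unfolding liftable_nbhd_def by blast
  qed
  have "path_homotopic X p (f \<circ> q)"
  proof (rule path_homotopic_if_loop_trivial[OF p(1) fq])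
    show "path_homotopic X (reverse_path p \<oplus>\<^sub>p (f \<circ> q)) (\<lambda>t. p 1)"
      using loop by simp
  qed (use w q in auto)
  with q that show thesis by blast
qed

text \<open>
  Cut the path into pieces that lie in liftable neighbourhoods.  A cutting point may lie outside the image
  of \<open>f\<close>, so it has to be joined to that image inside the intersection of both adjacent
  neighbourhoods.  The induction hypothesis \<open>G t\<close> accordingly says that the path up to time \<open>t\<close>, followed
  by any path to the image of \<open>f\<close> inside some fixed neighbourhood of \<open>p t\<close>, lifts; here the neighbourhood is
  chosen before the connecting path, which the next step may take as small as it needs.
\<close>

lemma path_homotopic_to_lift:
  fixes W :: "'a::real_normed_vector set"
  assumes f: "continuous_map (top_of_set W) X f"
    and loc: "\<And>x. x \<in> topspace X \<Longrightarrow> \<exists>U. x \<in> U \<and> liftable_nbhd W X f U"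
    and dense: "\<And>x N. openin X N \<Longrightarrow> x \<in> N \<Longrightarrow> \<exists>d. pathin X d \<and> d ` {0..1} \<subseteq> N \<and> d 0 = x \<and> d 1 \<in> f ` W"
    and p: "pathin X p" "p 0 = f w" "w \<in> W" "p 1 \<in> f ` W"
  obtains q where "path q" "path_image q \<subseteq> W" "q 0 = w" "path_homotopic X p (f \<circ> q)"
proof -
  define seg where "seg = (\<lambda>a b t. p (a + (b - a) * t))"
  define lifts where "lifts = (\<lambda>r. \<exists>q. path q \<and> path_image q \<subseteq> W \<and> q 0 = w \<and> path_homotopic X r (f \<circ> q))"
  define G where "G = (\<lambda>t. \<exists>N. openin X N \<and> p t \<in> N \<and>
    (\<forall>d. pathin X d \<and> d ` {0..1} \<subseteq> N \<and> d 0 = p t \<and> d 1 \<in> f ` W \<longrightarrow>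
       lifts (seg 0 t \<oplus>\<^sub>p d)))"
  have seg_ends [simp]: "seg a b 0 = p a" "seg a b 1 = p b" for a b
    by (simp_all add: seg_def)
  have pathin_lift: "pathin X (f \<circ> q)" if "path q" "path_image q \<subseteq> W" for q
    using that f unfolding pathin_def path_def path_image_def
    by (intro continuous_map_compose[of _ "top_of_set W"]) auto
  have top: "p t \<in> topspace X" if "t \<in> {0..1}" for t
    using p(1) that by (auto simp: pathin_def continuous_map_def)
  have pathin_seg: "pathin X (seg a b)" if "0 \<le> a" "a \<le> b" "b \<le> 1" for a b
    unfolding seg_def by (rule pathin_segment[OF p(1) that])
  have "G 0 \<longrightarrow> G 1"
  proof -
    define P where "P = (\<lambda>s t. 0 \<le> s \<and> s \<le> t \<and> t \<le> 1 \<and> G s \<longrightarrow> G t)"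
    have "0 \<le> (1::real)" by simp
    then have "P 0 1"
    proof (induction rule: Bolzano)
      case (trans a b c)
      then show ?case by (auto simp: P_def)
    next
      case (local x)
      then have "p x \<in> topspace X"
        by (intro top) simp
      then obtain U where U: "p x \<in> U" "liftable_nbhd W X f U"
        using loc by blast
      have Uo: "openin X U"
        using U(2) by (simp add: liftable_nbhd_def)
      have "openin (top_of_set {0..1}) {t \<in> topspace (top_of_set {0..1}). p t \<in> U}"
        using p(1) Uo unfolding pathin_def by (rule openin_continuous_map_preimage)
      moreover have "x \<in> {t \<in> topspace (top_of_set {0..1}). p t \<in> U}"
        using local U(1) by simp
      ultimately obtain e where e: "e > 0"
          and e': "\<And>t. t \<in> {0..1} \<Longrightarrow> dist t x < e \<Longrightarrow> t \<in> {t \<in> topspace (top_of_set {0..1}). p t \<in> U}"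
        unfolding openin_euclidean_subtopology_iff by blast
      have "G t" if st: "s \<le> x" "x \<le> t" "t - s < e" "0 \<le> s" "s \<le> t" "t \<le> 1" and Gs: "G s" for s t
      proof -
        obtain N where N: "openin X N" "p s \<in> N"
          and N': "\<forall>d. pathin X d \<and> d ` {0..1} \<subseteq> N \<and> d 0 = p s \<and> d 1 \<in> f ` W \<longrightarrow>
            lifts (seg 0 s \<oplus>\<^sub>p d)"
          using Gs unfolding G_def by blast
        have inU: "p u \<in> U" if "s \<le> u" "u \<le> t" for u
          using e'[of u] st that by (auto simp: dist_real_def)
        have segU: "seg s t ` {0..1} \<subseteq> U"
        proof -
          have "s \<le> s + (t - s) * u \<and> s + (t - s) * u \<le> t" if "0 \<le> u" "u \<le> 1" for u
            using that st(5) mult_left_mono[of u 1 "t - s"] by auto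
          then show ?thesis
            by (auto simp: seg_def intro!: inU)
        qed
        obtain d0 where d0: "pathin X d0" "d0 ` {0..1} \<subseteq> N \<inter> U" "d0 0 = p s" "d0 1 \<in> f ` W"
          using dense[OF openin_Int[OF N(1) Uo], of "p s"] N(2) inU[of s] st(1,2,5) by blast
        then have "lifts (seg 0 s \<oplus>\<^sub>p d0)"
          using N' by simp
        then obtain q0 where q0: "path q0" "path_image q0 \<subseteq> W" "q0 0 = w"
            "path_homotopic X (seg 0 s \<oplus>\<^sub>p d0) (f \<circ> q0)"
          unfolding lifts_def by blast
        have e0: "f (q0 1) = d0 1"
          using path_homotopic_imp_ends[OF q0(4)] by simp
        have "lifts (seg 0 t \<oplus>\<^sub>p d)"
          if d: "pathin X d" "d ` {0..1} \<subseteq> U" "d 0 = p t" "d 1 \<in> f ` W" for d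
        proof -
          let ?r = "reverse_path d0 \<oplus>\<^sub>p (seg s t \<oplus>\<^sub>p d)"
          have sst: "pathin X (seg s t)" and s0s: "pathin X (seg 0 s)"
            using st by (auto intro!: pathin_seg)
          have std: "pathin X (seg s t \<oplus>\<^sub>p d)"
            using sst d by (auto intro!: pathin_join)
          have r: "pathin X ?r"
            using std d0 by (auto intro!: pathin_join pathin_reverse)
          have "?r ` {0..1} \<subseteq> U"
            using d(2) d0(2) segU by (intro join_path_in reverse_path_in) auto
          moreover have "q0 1 \<in> W"
            using q0(2) by (auto simp: path_image_def)
          ultimately obtain q1 where q1: "path q1" "path_image q1 \<subseteq> W" "q1 0 = q0 1" "path_homotopic X ?r (f \<circ> q1)"
            using liftable_nbhd_lift[OF U(2) f r, of "q0 1"] e0 d(4) by auto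
          have "path (q0 +++ q1)" "path_image (q0 +++ q1) \<subseteq> W" "(q0 +++ q1) 0 = w"
            using q0 q1 by (simp_all add: pathstart_def pathfinish_def path_image_join)
              (simp add: joinpaths_def)
          moreover have "f \<circ> (q0 +++ q1) = (f \<circ> q0) \<oplus>\<^sub>p (f \<circ> q1)"
            by (auto simp: joinpaths_def join_path_def)
          moreover have "path_homotopic X (seg 0 t \<oplus>\<^sub>p d) ((f \<circ> q0) \<oplus>\<^sub>p (f \<circ> q1))"
          proof -
            have "path_homotopic X (seg 0 t \<oplus>\<^sub>p d) ((seg 0 s \<oplus>\<^sub>p seg s t) \<oplus>\<^sub>p d)"
              using st d p(1) unfolding seg_def
              by (intro path_homotopic_join path_homotopic_refl path_homotopic_sym[OF path_homotopic_split]) auto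
            also have "path_homotopic X \<dots> (seg 0 s \<oplus>\<^sub>p (seg s t \<oplus>\<^sub>p d))"
              using sst s0s d by (intro path_homotopic_join_assoc) auto
            also have "path_homotopic X \<dots> (seg 0 s \<oplus>\<^sub>p (d0 \<oplus>\<^sub>p ?r))"
              using s0s d0 std
              by (intro path_homotopic_join path_homotopic_refl path_homotopic_sym[OF path_homotopic_cancel_left]) auto
            also have "path_homotopic X \<dots> ((seg 0 s \<oplus>\<^sub>p d0) \<oplus>\<^sub>p ?r)"
              using s0s d0 r by (intro path_homotopic_sym[OF path_homotopic_join_assoc]) auto
            also have "path_homotopic X \<dots> ((f \<circ> q0) \<oplus>\<^sub>p (f \<circ> q1))"
              using q0(4) q1(4) by (intro path_homotopic_join) auto
            finally show ?thesis .
          qed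
          ultimately show ?thesis unfolding lifts_def by metis
        qed
        then show "G t"
          unfolding G_def using Uo inU[of t] st(2,5) by blast
      qed
      note step = this
      show ?case
      proof (intro exI[of _ e] conjI allI)
        show "a \<le> x \<and> x \<le> b \<and> b - a < e \<longrightarrow> P a b" for a b
          using step[of a b] by (simp add: P_def)
      qed (rule e)
    qed
    then show ?thesis by (simp add: P_def)
  qed
  moreover have "G 0"
  proof -
    obtain U where U: "p 0 \<in> U" "liftable_nbhd W X f U"
      using loc[OF top[of 0]] by auto
    have "lifts (seg 0 0 \<oplus>\<^sub>p d)"
      if d: "pathin X d" "d ` {0..1} \<subseteq> U" "d 0 = p 0" "d 1 \<in> f ` W" for d
    proof -
      obtain q where q: "path q" "path_image q \<subseteq> W" "q 0 = w" "path_homotopic X d (f \<circ> q)"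
        using liftable_nbhd_lift[OF U(2) f d(1,2) p(3)] d(3,4) p(2) by auto
      moreover have "path_homotopic X (seg 0 0 \<oplus>\<^sub>p d) d"
        unfolding seg_def using d by (simp add: path_homotopic_const_join)
      ultimately show ?thesis
        unfolding lifts_def using path_homotopic_trans[of X _ d] by blast
    qed
    moreover have "openin X U"
      using U(2) by (simp add: liftable_nbhd_def)
    ultimately show ?thesis
      unfolding G_def using U(1) by blast
  qed
  ultimately have "G 1" by simp
  then obtain N where N: "p 1 \<in> N" "\<forall>d. pathin X d \<and> d ` {0..1} \<subseteq> N \<and> d 0 = p 1 \<and> d 1 \<in> f ` W \<longrightarrow>
       lifts (seg 0 1 \<oplus>\<^sub>p d)"
    unfolding G_def by blast
  then have "lifts (seg 0 1 \<oplus>\<^sub>p (\<lambda>t. p 1))"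
    using p(4) top[of 1] by (simp add: image_subset_iff)
  then obtain q where q: "path q" "path_image q \<subseteq> W" "q 0 = w"
      "path_homotopic X (seg 0 1 \<oplus>\<^sub>p (\<lambda>t. p 1)) (f \<circ> q)"
    unfolding lifts_def by blast
  have "path_homotopic X p (seg 0 1 \<oplus>\<^sub>p (\<lambda>t. p 1))"
    using path_homotopic_sym[OF path_homotopic_join_const[OF p(1) refl]] by (simp add: seg_def)
  then show thesis
    using that[OF q(1-3)] path_homotopic_trans[OF _ q(4)] by blast
qed

text \<open>
  The last assumption is the triviality of the monodromy; only one path has to be exhibited for each pair
  of points in a fibre, as \<open>W\<close> is simply connected.
\<close>

theorem simply_connected_space_if_paths_lift:
  fixes W :: "'a::real_normed_vector set"
  assumes f: "continuous_map (top_of_set W) X f"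
    and loc: "\<And>x. x \<in> topspace X \<Longrightarrow> \<exists>U. x \<in> U \<and> liftable_nbhd W X f U"
    and dense: "\<And>x N. openin X N \<Longrightarrow> x \<in> N \<Longrightarrow> \<exists>d. pathin X d \<and> d ` {0..1} \<subseteq> N \<and> d 0 = x \<and> d 1 \<in> f ` W"
    and W: "simply_connected W"
    and mono: "\<And>w w'. w \<in> W \<Longrightarrow> w' \<in> W \<Longrightarrow> f w = f w' \<Longrightarrow>
      \<exists>q. path q \<and> path_image q \<subseteq> W \<and> q 0 = w \<and> q 1 = w' \<and> path_homotopic X (f \<circ> q) (\<lambda>t. f w)"
  shows "simply_connected_space X"
proof -
  have pathin_lift: "pathin X (f \<circ> q)" if "path q" "path_image q \<subseteq> W" for q
    using that f unfolding pathin_def path_def path_image_def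
    by (intro continuous_map_compose[of _ "top_of_set W"]) auto
  have dense': "\<exists>d. pathin X d \<and> d 0 = x \<and> d 1 \<in> f ` W" if "x \<in> topspace X" for x
    using dense[of "topspace X" x] that by auto
  have null: "path_homotopic X p (\<lambda>t. p 0)" if p: "pathin X p" "p 1 = p 0" for p
  proof -
    obtain d where d: "pathin X d" "d 0 = p 0" "d 1 \<in> f ` W"
      using dense' path_start_in_topspace[OF p(1)] by blast
    then obtain w where w: "w \<in> W" "d 1 = f w" by blast
    let ?l = "reverse_path d \<oplus>\<^sub>p (p \<oplus>\<^sub>p d)"
    have l: "pathin X ?l"
      using p d by (intro pathin_join pathin_reverse) auto
    obtain q where q: "path q" "path_image q \<subseteq> W" "q 0 = w" "path_homotopic X ?l (f \<circ> q)"
      using path_homotopic_to_lift[OF f loc dense l _ w(1)] w d by (metis join_path_ends reverse_path_ends(1))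
    have q1: "q 1 \<in> W" "f (q 1) = f w"
      using q(2) path_homotopic_imp_ends[OF q(4)] w by (auto simp: path_image_def)
    then obtain q' where q': "path q'" "path_image q' \<subseteq> W" "q' 0 = w" "q' 1 = q 1"
        "path_homotopic X (f \<circ> q') (\<lambda>t. f w)"
      using mono[of w "q 1"] w by auto
    have "path_homotopic X (f \<circ> q) (f \<circ> q')"
      using q q' by (intro path_homotopic_simply_connected[OF W f]) auto
    then have ln: "path_homotopic X ?l (\<lambda>t. f w)"
      using q(4) q'(5) path_homotopic_trans by blast
    have pd: "path_homotopic X (p \<oplus>\<^sub>p d) d"
    proof -
      have "path_homotopic X (p \<oplus>\<^sub>p d) (d \<oplus>\<^sub>p ?l)"
        using p d by (intro path_homotopic_sym[OF path_homotopic_cancel_left] pathin_join) auto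
      also have "path_homotopic X \<dots> (d \<oplus>\<^sub>p (\<lambda>t. f w))"
        using d by (intro path_homotopic_join path_homotopic_refl ln) auto
      also have "path_homotopic X \<dots> d"
        using d w by (intro path_homotopic_join_const) auto
      finally show ?thesis .
    qed
    have rd: "pathin X (reverse_path d)"
      using d by (intro pathin_reverse)
    have "path_homotopic X p (p \<oplus>\<^sub>p (\<lambda>t. p 0))"
      using p by (intro path_homotopic_sym[OF path_homotopic_join_const]) auto
    also have "path_homotopic X \<dots> (p \<oplus>\<^sub>p (d \<oplus>\<^sub>p reverse_path d))"
      using p d path_homotopic_join_reverse[OF d(1)]
      by (intro path_homotopic_join path_homotopic_refl path_homotopic_sym[of X "d \<oplus>\<^sub>p reverse_path d"]) auto
    also have "path_homotopic X \<dots> ((p \<oplus>\<^sub>p d) \<oplus>\<^sub>p reverse_path d)"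
      using p d rd by (intro path_homotopic_sym[OF path_homotopic_join_assoc]) auto
    also have "path_homotopic X \<dots> (d \<oplus>\<^sub>p reverse_path d)"
      using rd by (intro path_homotopic_join pd path_homotopic_refl) auto
    also have "path_homotopic X \<dots> (\<lambda>t. p 0)"
      using path_homotopic_join_reverse[OF d(1)] d(2) by simp
    finally show ?thesis .
  qed
  have "path_connected_space X"
    unfolding path_connected_space_def
  proof (intro ballI)
    fix x y assume xy: "x \<in> topspace X" "y \<in> topspace X"
    obtain d e where d: "pathin X d" "d 0 = x" "d 1 \<in> f ` W" and e: "pathin X e" "e 0 = y" "e 1 \<in> f ` W"
      using dense' xy by meson
    obtain v w where vw: "v \<in> W" "w \<in> W" "d 1 = f v" "e 1 = f w"
      using d e by blast
    have "path_connected W"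
      using W by (rule simply_connected_imp_path_connected)
    then obtain g where g: "path g" "path_image g \<subseteq> W" "g 0 = v" "g 1 = w"
      using vw unfolding path_connected_def pathstart_def pathfinish_def by blast
    have "pathin X (d \<oplus>\<^sub>p ((f \<circ> g) \<oplus>\<^sub>p reverse_path e))"
      using d e g vw by (intro pathin_join pathin_reverse pathin_lift) auto
    then show "\<exists>g. pathin X g \<and> g 0 = x \<and> g 1 = y"
      using d e by (intro exI[of _ "d \<oplus>\<^sub>p ((f \<circ> g) \<oplus>\<^sub>p reverse_path e)"]) auto
  qed
  moreover have "homotopic_with (\<lambda>q. q 0 = p 0 \<and> q 1 = p 0) (top_of_set {0..1}) X p (\<lambda>t. p 0)"
    if "pathin X p" "p 1 = p 0" for p
    using null[OF that] that by (simp add: path_homotopic_def)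
  ultimately show ?thesis
    unfolding simply_connected_space_def by blast
qed

section \<open>Complements of countably many lines\<close>

text \<open>
  For a polynomial loop \<open>g\<close> the cone over \<open>g\<close> with apex \<open>v\<close> meets a given line only if \<open>v\<close> is of the form
  \<open>g t + k (y - g t)\<close> with \<open>k \<ge> 1\<close> and \<open>y\<close> on the line.  These points form a smooth image of a space of
  dimension three, so almost no \<open>v\<close> is bad for any of the countably many lines.
\<close>

lemma simply_connected_Compl_countable_lines:
  fixes a b :: "'i \<Rightarrow> 'a::euclidean_space"
  assumes dim: "DIM('a) > 3" and I: "countable I"
    and closed: "closed (\<Union>i\<in>I. range (\<lambda>s. a i + s *\<^sub>R b i))"
  shows "simply_connected (- (\<Union>i\<in>I. range (\<lambda>s. a i + s *\<^sub>R b i)))" (is "simply_connected ?W")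
proof -
  have opW: "open ?W"
    using closed by (rule open_Compl)
  define bad where "bad g = {v. \<exists>t\<in>{0..1}. \<exists>s\<in>{0<..1}. g t + s *\<^sub>R (v - g t) \<notin> ?W}" for g :: "real \<Rightarrow> 'a"
  have negligible_bad: "negligible (bad g)" if g: "polynomial_function g" for g
  proof -
    \<comment> \<open>The factor \<open>fst (snd z)\<close> is the inverse \<open>1 / s\<close> of the parameter of the cone.\<close>
    define F where "F = (\<lambda>i (z::real \<times> real \<times> real). g (fst z) + fst (snd z) *\<^sub>R (a i + snd (snd z) *\<^sub>R b i - g (fst z)))"
    have neg: "negligible (range (F i))" for i
    proof (rule negligible_differentiable_image_lowdim)
      show "DIM(real \<times> real \<times> real) < DIM('a)"
        using dim by simp
      have "g differentiable at t" for t
        using differentiable_at_polynomial_function[OF g] .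
      then have "(\<lambda>z::real \<times> real \<times> real. g (fst z)) differentiable at z" for z
        by (intro differentiable_chain_at[of fst z g, unfolded o_def])
          (auto intro: bounded_linear_imp_differentiable bounded_linear_fst)
      then have "F i differentiable at z" for z
        unfolding F_def
        by (intro differentiable_add differentiable_scaleR differentiable_diff differentiable_const
            bounded_linear_imp_differentiable[OF bounded_linear_fst_comp]
            bounded_linear_imp_differentiable[OF bounded_linear_snd_comp] bounded_linear_snd)
      then show "F i differentiable_on UNIV"
        by (simp add: differentiable_on_def differentiable_at_withinI)
    qed
    have "bad g \<subseteq> (\<Union>i\<in>I. range (F i))"
    proof
      fix v assume "v \<in> bad g"
      then obtain t s i r where *: "s > 0" "i \<in> I" "g t + s *\<^sub>R (v - g t) = a i + r *\<^sub>R b i"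
        by (auto simp: bad_def)
      have "v = g t + (1 / s) *\<^sub>R (s *\<^sub>R (v - g t))"
        using *(1) by simp
      also have "s *\<^sub>R (v - g t) = a i + r *\<^sub>R b i - g t"
        using *(3) by (simp add: algebra_simps)
      finally have "v = F i (t, 1/s, r)"
        by (simp add: F_def)
      with *(2) show "v \<in> (\<Union>i\<in>I. range (F i))" by blast
    qed
    moreover have "negligible (\<Union>i\<in>I. range (F i))"
      using neg I by (intro negligible_countable_Union) auto
    ultimately show ?thesis
      by (rule negligible_subset[rotated])
  qed
  have cone: "g t + s *\<^sub>R (v - g t) \<in> ?W"
    if "v \<notin> bad g" "path_image g \<subseteq> ?W" "t \<in> {0..1}" "s \<in> {0..1}" for g v t s
  proof (cases "s = 0")
    case True
    moreover have "g t \<in> ?W"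
      using that(2,3) unfolding path_image_def by blast
    ultimately show ?thesis by simp
  next
    case False
    then have "s \<in> {0<..1}" using that by auto
    then show ?thesis using that(1,3) unfolding bad_def by blast
  qed
  have "path_component ?W x y" if xy: "x \<in> ?W" "y \<in> ?W" for x y
  proof -
    have "negligible (bad (\<lambda>t. x) \<union> bad (\<lambda>t. y))"
      by (intro negligible_Un negligible_bad) auto
    then obtain v where v: "v \<notin> bad (\<lambda>t. x)" "v \<notin> bad (\<lambda>t. y)"
      using non_negligible_UNIV by (metis UNIV_eq_I UnCI)
    have seg: "path_component ?W z v" if "z \<in> ?W" "v \<notin> bad (\<lambda>t. z)" for z
    proof -
      have "closed_segment z v \<subseteq> ?W"
      proof
        fix u assume "u \<in> closed_segment z v"
        then obtain s where "0 \<le> s" "s \<le> 1" "u = z + s *\<^sub>R (v - z)"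
          by (auto simp: closed_segment_def algebra_simps)
        then show "u \<in> ?W"
          using cone[OF that(2), of 0 s] that(1) unfolding path_image_def by auto
      qed
      then show ?thesis
        using path_component_linepath by blast
    qed
    show ?thesis
      by (rule path_component_trans[OF seg[OF xy(1) v(1)] path_component_sym[OF seg[OF xy(2) v(2)]]])
  qed
  then have pc: "path_connected ?W"
    by (simp add: path_connected_component)
  have "\<exists>v. v \<in> ?W \<and> homotopic_loops ?W p (linepath v v)"
    if p: "path p" "path_image p \<subseteq> ?W" "pathfinish p = pathstart p" for p
  proof -
    obtain e where e: "e > 0" and near: "\<And>h. \<lbrakk>path h; pathstart h = pathstart p; pathfinish h = pathfinish p;
        \<forall>t \<in> {0..1}. norm (h t - p t) < e\<rbrakk> \<Longrightarrow> homotopic_paths ?W p h"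
      using homotopic_nearby_paths[OF p(1) opW p(2)] by blast
    obtain g where g: "polynomial_function g" "pathstart g = pathstart p" "pathfinish g = pathfinish p"
        "\<And>t. t \<in> {0..1} \<Longrightarrow> norm (g t - p t) < e"
      using path_approx_polynomial_function[OF p(1) e] by blast
    have pg: "path g"
      using g(1) by (simp add: path_polynomial_function)
    have hp: "homotopic_paths ?W p g"
      using near[OF pg g(2,3)] g(4) by blast
    have gW: "path_image g \<subseteq> ?W"
      using hp by (rule homotopic_paths_imp_subset[THEN conjunct2])
    obtain v where v: "v \<notin> bad g"
      using negligible_bad[OF g(1)] non_negligible_UNIV by (metis UNIV_eq_I)
    have gl: "pathfinish g = pathstart g"
      using g p by simp
    have "homotopic_loops ?W g (linepath v v)"
    proof (rule homotopic_loops_linear[OF pg _ gl])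
      fix t :: real assume t: "t \<in> {0..1}"
      show "closed_segment (g t) (linepath v v t) \<subseteq> ?W"
      proof
        fix u assume "u \<in> closed_segment (g t) (linepath v v t)"
        then obtain s where "0 \<le> s" "s \<le> 1" "u = g t + s *\<^sub>R (v - g t)"
          by (auto simp: closed_segment_def algebra_simps linepath_refl)
        then show "u \<in> ?W"
          using cone[OF v gW t, of s] by auto
      qed
    qed auto
    moreover have "homotopic_loops ?W p g"
      using homotopic_paths_imp_homotopic_loops[OF hp p(3)] gl g(2) by simp
    moreover have "v \<in> ?W"
      using cone[OF v gW, of 0 1] by simp
    ultimately show ?thesis
      using homotopic_loops_trans by blast
  qed
  then show ?thesis
    unfolding simply_connected_eq_contractible_loop_some using pc by blast
qed

section \<open>The group of lifts\<close>

lemma exhaust_5: "(i::5) = 1 \<or> i = 2 \<or> i = 3 \<or> i = 4 \<or> i = 5"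
proof (induct i)
  case (of_int z)
  then have "0 \<le> z" and "z < 5" by simp_all
  then have "z = 0 \<or> z = 1 \<or> z = 2 \<or> z = 3 \<or> z = 4" by arith
  then show ?case by auto
qed

lemma forall_5: "(\<forall>i::5. P i) \<longleftrightarrow> P 1 \<and> P 2 \<and> P 3 \<and> P 4 \<and> P 5"
  by (metis exhaust_5)

text \<open>
  The affine map \<open>deck a b c n\<close> is the lift of \<open>\<alpha>\<^sup>a \<beta>\<^sup>b \<gamma>\<^sup>c\<close> whose translation part has been normalised to
  half a unit where \<open>shifts\<close> holds, plus the lattice vector \<open>n\<close>; \<open>flips\<close> tells which coordinates change
  sign.  Modulo the lattice signs do not affect a half unit, so both \<open>flips\<close> and \<open>shifts\<close> are
  homomorphisms in \<open>(a, b, c)\<close>.  This makes the group law one coordinatewise computation.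
\<close>

definition flips :: "bool \<Rightarrow> bool \<Rightarrow> bool \<Rightarrow> 5 \<Rightarrow> bool" where
  "flips a b c i = (if i = 1 then b \<noteq> c else if i = 4 then a \<noteq> c else if i = 5 then a \<noteq> b
     else a \<noteq> (b \<noteq> c))"

definition shifts :: "bool \<Rightarrow> bool \<Rightarrow> bool \<Rightarrow> 5 \<Rightarrow> bool" where
  "shifts a b c i = (if i = 2 then b else if i = 3 then c else if i = 4 then a else False)"

definition deck :: "bool \<Rightarrow> bool \<Rightarrow> bool \<Rightarrow> int^5 \<Rightarrow> real^5 \<Rightarrow> real^5" where
  "deck a b c n x = (\<chi> i. of_int (n $ i) + of_bool (shifts a b c i) / 2
     + (if flips a b c i then - x $ i else x $ i))"

lemma flips_xor: "flips (a \<noteq> a') (b \<noteq> b') (c \<noteq> c') i \<longleftrightarrow> flips a b c i \<noteq> flips a' b' c' i"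
  by (auto simp: flips_def)

lemma shifts_xor: "shifts (a \<noteq> a') (b \<noteq> b') (c \<noteq> c') i \<longleftrightarrow> shifts a b c i \<noteq> shifts a' b' c' i"
  by (auto simp: shifts_def)

lemma deck_translation: "deck False False False n x = x + (\<chi> i. of_int (n $ i))"
  by (simp add: deck_def flips_def shifts_def vec_eq_iff)

lemma deck_deck:
  "\<exists>n''. \<forall>x. deck a b c n (deck a' b' c' n' x) = deck (a \<noteq> a') (b \<noteq> b') (c \<noteq> c') n'' x"
proof -
  \<comment> \<open>The last summand is the carry from adding two half units, the second one possibly with a sign.\<close>
  define n'' :: "int^5" where "n'' = (\<chi> i. n $ i + (if flips a b c i then - n' $ i else n' $ i)
    + (if shifts a b c i \<and> shifts a' b' c' i \<and> \<not> flips a b c i then 1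
       else if \<not> shifts a b c i \<and> shifts a' b' c' i \<and> flips a b c i then - 1 else 0))"
  have "deck a b c n (deck a' b' c' n' x) = deck (a \<noteq> a') (b \<noteq> b') (c \<noteq> c') n'' x" for x
    unfolding deck_def n''_def vec_eq_iff flips_xor shifts_xor
    by (auto simp: of_bool_def)
  then show ?thesis by blast
qed

lemma deck_inverse: "\<exists>n'. \<forall>x. deck a b c n' (deck a b c n x) = x"
proof -
  obtain m where m: "\<And>x. deck a b c n (deck a b c n x) = deck False False False m x"
    using deck_deck[of a b c n a b c n] by auto
  obtain k where k: "\<And>x. deck False False False (- m) (deck a b c n x) = deck a b c k x"
    using deck_deck[of False False False "- m" a b c n] by auto
  have "deck a b c k (deck a b c n x) = x" for x
    by (simp add: k[symmetric] m) (simp add: deck_translation vec_eq_iff)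
  then show ?thesis by blast
qed

definition deck_group :: "(real^5 \<Rightarrow> real^5) set" where
  "deck_group = {deck a b c n | a b c n. True}"

lemma id_in_deck_group: "(\<lambda>x. x) \<in> deck_group"
proof -
  have "(\<lambda>x. x) = deck False False False 0"
    by (auto simp: deck_translation fun_eq_iff vec_eq_iff)
  then show ?thesis
    unfolding deck_group_def by blast
qed

lemma deck_group_compose: "g \<in> deck_group \<Longrightarrow> h \<in> deck_group \<Longrightarrow> (\<lambda>x. g (h x)) \<in> deck_group"
  unfolding deck_group_def using deck_deck by (fastforce simp: fun_eq_iff)

lemma deck_group_inverse:
  assumes "g \<in> deck_group"
  obtains h where "h \<in> deck_group" "\<And>x. h (g x) = x" "\<And>x. g (h x) = x"
proof -
  obtain a b c n where g: "g = deck a b c n"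
    using assms unfolding deck_group_def by blast
  obtain n' where n': "\<And>x. deck a b c n' (deck a b c n x) = x"
    using deck_inverse by metis
  obtain n'' where n'': "\<And>x. deck a b c n'' (deck a b c n' x) = x"
    using deck_inverse by metis
  have "deck a b c n (deck a b c n' x) = x" for x
    by (metis n' n'')
  then show thesis
    using that[of "deck a b c n'"] n' g unfolding deck_group_def by blast
qed

lemma deck_group_diff: 
  assumes "g \<in> deck_group"
  shows "\<exists>D. (\<forall>v. norm (D v) = norm v) \<and> (\<forall>x v. g (x + v) = g x + D v)"
proof -
  obtain a b c n where g: "g = deck a b c n"
    using assms unfolding deck_group_def by blast
  define D :: "real^5 \<Rightarrow> real^5" where "D = (\<lambda>v. \<chi> i. if flips a b c i then - v $ i else v $ i)"
  have "norm (D v) = norm v" for v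
    unfolding norm_vec_def D_def by (rule L2_set_cong) auto
  moreover have "g (x + v) = g x + D v" for x v
    by (auto simp: g deck_def D_def vec_eq_iff)
  ultimately show ?thesis by blast
qed

lemma deck_group_dist:
  assumes "g \<in> deck_group"
  shows "dist (g x) (g y) = dist x y"
proof -
  obtain D where D: "\<And>v. norm (D v) = norm v" "\<And>x v. g (x + v) = g x + D v"
    using deck_group_diff[OF assms] by blast
  have "g x = g y + D (x - y)"
    using D(2)[of y "x - y"] by simp
  then show ?thesis
    by (simp add: dist_norm D(1))
qed

lemma continuous_on_deck_group:
  assumes "g \<in> deck_group"
  shows "continuous_on S g"
  unfolding continuous_on_iff deck_group_dist[OF assms] by blast

definition deck_equiv :: "real^5 \<Rightarrow> real^5 \<Rightarrow> bool" where
  "deck_equiv x y \<longleftrightarrow> (\<exists>g\<in>deck_group. y = g x)"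

lemma deck_equiv_refl: "deck_equiv x x"
  unfolding deck_equiv_def using id_in_deck_group by (rule rev_bexI) simp

lemma deck_equiv_sym: "deck_equiv x y \<Longrightarrow> deck_equiv y x"
  unfolding deck_equiv_def by (metis deck_group_inverse)

lemma deck_equiv_trans: "deck_equiv x y \<Longrightarrow> deck_equiv y z \<Longrightarrow> deck_equiv x z"
  unfolding deck_equiv_def
proof (elim bexE)
  fix g h assume "g \<in> deck_group" "h \<in> deck_group" "y = g x" "z = h y"
  then show "\<exists>g\<in>deck_group. z = g x"
    using deck_group_compose[of h g] by (intro bexI[of _ "\<lambda>x. h (g x)"]) simp_all
qed

lemma torus_class_eq_iff: "torus_class x = torus_class y \<longleftrightarrow> (\<forall>i. y $ i - x $ i \<in> \<int>)"
proof
  assume "torus_class x = torus_class y"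
  moreover have "y \<in> torus_class y" by (simp add: torus_class_def)
  ultimately show "\<forall>i. y $ i - x $ i \<in> \<int>"
    by (auto simp: torus_class_def)
next
  assume *: "\<forall>i. y $ i - x $ i \<in> \<int>"
  have "z $ i - y $ i \<in> \<int> \<longleftrightarrow> z $ i - x $ i \<in> \<int>" for z i
    using Ints_add[of "z $ i - y $ i" "y $ i - x $ i"] Ints_diff[of "z $ i - x $ i" "y $ i - x $ i"] *
    by auto
  then show "torus_class x = torus_class y"
    by (auto simp: torus_class_def)
qed

lemma torus_class_eq_translation: "torus_class x = torus_class y \<longleftrightarrow> (\<exists>n. y = deck False False False n x)"
proof
  assume "torus_class x = torus_class y"
  then have "\<forall>i. \<exists>m. y $ i - x $ i = of_int m"
    by (auto simp: torus_class_eq_iff Ints_def)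
  then obtain m where "\<And>i. y $ i - x $ i = of_int (m i)"
    by metis
  then have "y = deck False False False (\<chi> i. m i) x"
    by (auto simp: deck_translation vec_eq_iff algebra_simps)
  then show "\<exists>n. y = deck False False False n x" ..
qed (auto simp: torus_class_eq_iff deck_translation)

lemma topspace_torus5: "topspace torus5 = range torus_class"
  by (simp add: torus5_def)

lemma torus_class_deck: "torus_class (deck a b c n x) = torus_class (deck a b c 0 x)"
  by (simp add: torus_class_eq_iff deck_def)

lemma alpha_eq_deck: "alpha = deck True False False 0"
  by (auto simp: alpha_def deck_def flips_def shifts_def fun_eq_iff vec_eq_iff)
lemma beta_eq_deck: "beta = deck False True False 0"
  by (auto simp: beta_def deck_def flips_def shifts_def fun_eq_iff vec_eq_iff)
lemma gamma_eq_deck: "gamma = deck False False True 0"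
  by (auto simp: gamma_def deck_def flips_def shifts_def fun_eq_iff vec_eq_iff)

abbreviation BijT where "BijT \<equiv> BijGroup (topspace torus5)"

lemma mult_BijT: "g \<in> carrier BijT \<Longrightarrow> h \<in> carrier BijT \<Longrightarrow> (g \<otimes>\<^bsub>BijT\<^esub> h) (torus_class x) = g (h (torus_class x))"
  by (simp add: BijGroup_def compose_def topspace_torus5)

lemma one_BijT: "\<one>\<^bsub>BijT\<^esub> (torus_class x) = torus_class x"
  by (simp add: BijGroup_def topspace_torus5)

lemma gens_BijT: "{torus_map alpha, torus_map beta, torus_map gamma} \<subseteq> carrier BijT"
  using torus_map_in_carrier by auto

lemma Gam_carrier: "g \<in> Gam \<Longrightarrow> g \<in> carrier BijT"
  unfolding Gam_def using group.generate_in_carrier[OF group_BijGroup gens_BijT] .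

lemma Gam_imp_deck:
  assumes "g \<in> Gam"
  shows "\<exists>a b c. \<forall>x. g (torus_class x) = torus_class (deck a b c 0 x)"
proof -
  have gen: "\<exists>a b c. \<forall>x. h (torus_class x) = torus_class (deck a b c 0 x)"
    if "h \<in> {torus_map alpha, torus_map beta, torus_map gamma}" for h
    using that alpha_eq_deck beta_eq_deck gamma_eq_deck torus_map_torus_class by (metis insertCI insertE singletonD)
  have self_inverse: "inv\<^bsub>BijT\<^esub> h = h" if h: "h \<in> {torus_map alpha, torus_map beta, torus_map gamma}" for h
  proof -
    have hc: "h \<in> carrier BijT" using gens_BijT h by blast
    obtain a b c where abc: "\<And>x. h (torus_class x) = torus_class (deck a b c 0 x)"
      using gen[OF h] by blast
    obtain n where n: "\<And>x. deck a b c 0 (deck a b c 0 x) = deck False False False n x"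
      using deck_deck[of a b c 0 a b c 0] by auto
    have "(h \<otimes>\<^bsub>BijT\<^esub> h) = \<one>\<^bsub>BijT\<^esub>"
    proof
      fix t
      show "(h \<otimes>\<^bsub>BijT\<^esub> h) t = \<one>\<^bsub>BijT\<^esub> t"
      proof (cases "t \<in> topspace torus5")
        case True
        then obtain x where t: "t = torus_class x" by (auto simp: topspace_torus5)
        show ?thesis
          unfolding t mult_BijT[OF hc hc] one_BijT abc n by (metis torus_class_eq_translation)
      next
        case False
        then show ?thesis using hc by (auto simp: BijGroup_def compose_def)
      qed
    qed
    then show ?thesis
      using group.inv_equality[OF group_BijGroup _ hc hc] by simp
  qed
  from assms show ?thesis
    unfolding Gam_def
  proof (induction rule: generate.induct)
    case one
    have "\<forall>x. \<one>\<^bsub>BijT\<^esub> (torus_class x) = torus_class (deck False False False 0 x)"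
      unfolding one_BijT by (metis torus_class_eq_translation)
    then show ?case by blast
  next
    case (incl h)
    then show ?case by (rule gen)
  next
    case (inv k)
    show ?case using gen[OF inv.hyps] self_inverse[OF inv.hyps] by simp
  next
    case (eng h1 h2)
    obtain a b c where 1: "\<And>x. h1 (torus_class x) = torus_class (deck a b c 0 x)"
      using eng by blast
    obtain a' b' c' where 2: "\<And>x. h2 (torus_class x) = torus_class (deck a' b' c' 0 x)"
      using eng by blast
    have c: "h1 \<in> carrier BijT" "h2 \<in> carrier BijT"
      using eng Gam_carrier unfolding Gam_def by auto
    obtain n where n: "\<And>x. deck a b c 0 (deck a' b' c' 0 x) = deck (a \<noteq> a') (b \<noteq> b') (c \<noteq> c') n x"
      using deck_deck by metis
    have "\<forall>x. (h1 \<otimes>\<^bsub>BijT\<^esub> h2) (torus_class x) = torus_class (deck (a \<noteq> a') (b \<noteq> b') (c \<noteq> c') 0 x)"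
      unfolding mult_BijT[OF c] 2 1 n by (simp add: torus_class_deck[of _ _ _ n])
    then show ?case by blast
  qed
qed

lemma deck_imp_Gam: "\<exists>g\<in>Gam. \<forall>x. g (torus_class x) = torus_class (deck a b c 0 x)"
proof -
  have mult: "\<exists>g\<in>Gam. \<forall>x. g (torus_class x) = torus_class (deck (a \<noteq> a') (b \<noteq> b') (c \<noteq> c') 0 x)"
    if 1: "\<exists>g\<in>Gam. \<forall>x. g (torus_class x) = torus_class (deck a b c 0 x)"
      and 2: "\<exists>g\<in>Gam. \<forall>x. g (torus_class x) = torus_class (deck a' b' c' 0 x)"
    for a b c a' b' c'
  proof -
    obtain g h where g: "g \<in> Gam" "\<And>x. g (torus_class x) = torus_class (deck a b c 0 x)"
      and h: "h \<in> Gam" "\<And>x. h (torus_class x) = torus_class (deck a' b' c' 0 x)"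
      using 1 2 by blast
    obtain n where n: "\<And>x. deck a b c 0 (deck a' b' c' 0 x) = deck (a \<noteq> a') (b \<noteq> b') (c \<noteq> c') n x"
      using deck_deck by metis
    have "g \<otimes>\<^bsub>BijT\<^esub> h \<in> Gam"
      using g h unfolding Gam_def by (intro generate.eng)
    moreover have "\<forall>x. (g \<otimes>\<^bsub>BijT\<^esub> h) (torus_class x) = torus_class (deck (a \<noteq> a') (b \<noteq> b') (c \<noteq> c') 0 x)"
      unfolding mult_BijT[OF Gam_carrier[OF g(1)] Gam_carrier[OF h(1)]] h g n
      by (simp add: torus_class_deck[of _ _ _ n])
    ultimately show ?thesis by blast
  qed
  have A: "\<exists>g\<in>Gam. \<forall>x. g (torus_class x) = torus_class (deck True False False 0 x)"
    unfolding Gam_def using torus_map_torus_class[of alpha]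
    by (intro bexI[of _ "torus_map alpha"]) (auto simp: alpha_eq_deck intro: generate.incl)
  have B: "\<exists>g\<in>Gam. \<forall>x. g (torus_class x) = torus_class (deck False True False 0 x)"
    unfolding Gam_def using torus_map_torus_class[of beta]
    by (intro bexI[of _ "torus_map beta"]) (auto simp: beta_eq_deck intro: generate.incl)
  have C: "\<exists>g\<in>Gam. \<forall>x. g (torus_class x) = torus_class (deck False False True 0 x)"
    unfolding Gam_def using torus_map_torus_class[of gamma]
    by (intro bexI[of _ "torus_map gamma"]) (auto simp: gamma_eq_deck intro: generate.incl)
  note AA = mult[OF A A] and AB = mult[OF A B] and AC = mult[OF A C] and BC = mult[OF B C]
  note ABC = mult[OF AB C]
  show ?thesis
    using A B C AA AB AC BC ABC by (cases a; cases b; cases c) simp_all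
qed

text \<open>
  Passing to the quotient of the torus by \<open>\<Gamma>\<close> is passing to the quotient of \<open>\<real>\<^sup>5\<close> by all lifts.
\<close>

lemma orbifold_point_eq_set: "orbifold_point x = {torus_class y | y. deck_equiv x y}"
proof
  show "orbifold_point x \<subseteq> {torus_class y | y. deck_equiv x y}"
  proof
    fix t assume "t \<in> orbifold_point x"
    then obtain g where g: "g \<in> Gam" "t = g (torus_class x)"
      by (auto simp: orbifold_point_def Gam_orbit_def)
    then obtain a b c where "t = torus_class (deck a b c 0 x)"
      using Gam_imp_deck by metis
    then show "t \<in> {torus_class y | y. deck_equiv x y}"
      unfolding deck_equiv_def deck_group_def by blast
  qed
  show "{torus_class y | y. deck_equiv x y} \<subseteq> orbifold_point x"
  proof
    fix t assume "t \<in> {torus_class y | y. deck_equiv x y}"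
    then obtain a b c n where "t = torus_class (deck a b c n x)"
      by (auto simp: deck_equiv_def deck_group_def)
    then show "t \<in> orbifold_point x"
      using deck_imp_Gam[of a b c] torus_class_deck
      unfolding orbifold_point_def Gam_orbit_def by (metis (mono_tags, lifting) mem_Collect_eq)
  qed
qed

lemma torus_class_eq_imp_deck_equiv: "torus_class x = torus_class y \<Longrightarrow> deck_equiv x y"
  unfolding torus_class_eq_translation deck_equiv_def deck_group_def by blast

lemma orbifold_point_eq_iff: "orbifold_point x = orbifold_point y \<longleftrightarrow> deck_equiv x y"
proof
  assume "orbifold_point x = orbifold_point y"
  then have "torus_class y \<in> {torus_class y | y. deck_equiv x y}"
    using deck_equiv_refl[of y] unfolding orbifold_point_eq_set by blast
  then show "deck_equiv x y"
    using torus_class_eq_imp_deck_equiv deck_equiv_trans by auto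
next
  assume "deck_equiv x y"
  then have "deck_equiv x z \<longleftrightarrow> deck_equiv y z" for z
    using deck_equiv_sym deck_equiv_trans by blast
  then show "orbifold_point x = orbifold_point y"
    unfolding orbifold_point_eq_set by simp
qed

section \<open>The fixed lines\<close>

abbreviation line_axes :: "5 set" where "line_axes \<equiv> {1, 4, 5}"

text \<open>
  A lift of \<open>\<alpha>\<close>, \<open>\<beta>\<close> or \<open>\<gamma>\<close> fixes a line parallel to the axis 1, 4 or 5.  Along such a line the remaining
  coordinates are multiples of \<open>1/2\<close>, except for the one given by \<open>quarter_axis\<close>, which is \<open>1/4\<close> modulo
  \<open>1/2\<close>.
\<close>

definition quarter_axis :: "5 \<Rightarrow> 5" where
  "quarter_axis j = (if j = 1 then 4 else if j = 4 then 2 else 3)"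

definition singular_lines :: "5 \<Rightarrow> (real^5) set" where
  "singular_lines j = {x. \<forall>i. i \<noteq> j \<longrightarrow> 2 * x $ i - of_bool (i = quarter_axis j) / 2 \<in> \<int>}"

definition fixed_lines :: "(real^5) set" where
  "fixed_lines = (\<Union>j\<in>line_axes. singular_lines j)"

lemma fixed_linesE:
  assumes "x \<in> fixed_lines" obtains j where "j \<in> line_axes" "x \<in> singular_lines j"
  using assms unfolding fixed_lines_def by blast

lemma fixed_linesI: "j \<in> line_axes \<Longrightarrow> x \<in> singular_lines j \<Longrightarrow> x \<in> fixed_lines"
  unfolding fixed_lines_def by blast

lemma Ints_eq_0: "(r::real) \<in> \<int> \<Longrightarrow> \<bar>r\<bar> < 1 \<Longrightarrow> r = 0"
  by (auto elim!: Ints_cases simp flip: of_int_abs)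

lemma deck_singular_lines:
  assumes g: "g \<in> deck_group" and x: "x \<in> singular_lines j"
  shows "g x \<in> singular_lines j"
proof -
  obtain a b c n where g: "g = deck a b c n"
    using g unfolding deck_group_def by blast
  have "2 * deck a b c n x $ i - of_bool (i = quarter_axis j) / 2 \<in> \<int>" if "i \<noteq> j" for i
  proof -
    define m where "m = 2 * x $ i - of_bool (i = quarter_axis j) / 2"
    have m: "m \<in> \<int>"
      using x that unfolding singular_lines_def m_def by blast
    have x2: "2 * x $ i = m + of_bool (i = quarter_axis j) / 2"
      by (simp add: m_def)
    have "2 * deck a b c n x $ i = 2 * of_int (n $ i) + of_bool (shifts a b c i)
        + (if flips a b c i then - (2 * x $ i) else 2 * x $ i)"
      by (simp add: deck_def)
    then have "2 * deck a b c n x $ i - of_bool (i = quarter_axis j) / 2 =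
        of_int (2 * (n $ i) + of_bool (shifts a b c i) - of_bool (flips a b c i \<and> i = quarter_axis j))
        + (if flips a b c i then - m else m)"
      unfolding x2 by (auto simp: of_bool_def)
    also have "\<dots> \<in> \<int>"
      using m by (intro Ints_add Ints_of_int) auto
    finally show ?thesis .
  qed
  then show ?thesis
    by (simp add: g singular_lines_def)
qed

lemma deck_fixed_lines:
  assumes "g \<in> deck_group" shows "g x \<in> fixed_lines \<longleftrightarrow> x \<in> fixed_lines"
proof -
  obtain h where h: "h \<in> deck_group" "\<And>x. h (g x) = x"
    using deck_group_inverse[OF assms] by metis
  show ?thesis
  proof
    assume "g x \<in> fixed_lines"
    then obtain j where "j \<in> line_axes" "g x \<in> singular_lines j" by (rule fixed_linesE)
    then show "x \<in> fixed_lines"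
      using deck_singular_lines[OF h(1), of "g x" j] h(2) by (intro fixed_linesI) simp_all
  next
    assume "x \<in> fixed_lines"
    then obtain j where "j \<in> line_axes" "x \<in> singular_lines j" by (rule fixed_linesE)
    then show "g x \<in> fixed_lines"
      using deck_singular_lines[OF assms] by (intro fixed_linesI) simp_all
  qed
qed

text \<open>
  The products of two or three of the involutions translate some coordinate by half a unit, so they move
  every point far.  A lift of one of the involutions is a half-turn about a fixed line followed by a
  translation along it, so the middle of a point and its image is on that line.  The case of a fixed point
  shows that points with a non-trivial stabiliser are on fixed lines; the case of a short move shows
  that different points of a small ball in the complement of these lines are not equivalent.
\<close>

lemma deck_small_move:
  assumes small: "\<And>i. \<bar>deck a b c n x $ i - x $ i\<bar> < 1/2"
  shows "(\<not> a \<and> \<not> b \<and> \<not> c \<and> deck a b c n x = x) \<or>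
    (1/2) *\<^sub>R (x + deck a b c n x) \<in> fixed_lines"
proof -
  have nothalf: False if "\<bar>of_int k + (1/2::real)\<bar> < 1/2" for k :: int
  proof -
    have "of_int (- 1) < (of_int k::real)" "(of_int k :: real) < of_int 0"
      using that unfolding abs_less_iff by simp_all
    then show False unfolding of_int_less_iff by linarith
  qed
  have nofix: False if "shifts a b c i" "\<not> flips a b c i" for i
    using nothalf[of "n $ i"] small[of i] that by (simp add: deck_def)
  have mid: "(1/2) *\<^sub>R (x + deck a b c n x) \<in> singular_lines j"
    if "\<And>i. i \<noteq> j \<Longrightarrow> flips a b c i" "\<And>i. i \<noteq> j \<Longrightarrow> shifts a b c i \<longleftrightarrow> i = quarter_axis j" for j
    using that by (simp add: singular_lines_def deck_def add_divide_distrib)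
  consider "\<not> a \<and> \<not> b \<and> \<not> c" | "a \<and> \<not> b \<and> \<not> c" | "\<not> a \<and> b \<and> \<not> c" | "\<not> a \<and> \<not> b \<and> c"
    | "b \<and> (a \<noteq> c)" | "\<not> b \<and> a \<and> c" | "a \<and> b \<and> c" by blast
  then show ?thesis
  proof cases
    case 1
    have "n $ i = 0" for i
      using small[of i] 1 by (simp add: deck_translation)
    then have "deck a b c n x = x"
      using 1 by (simp add: deck_translation vec_eq_iff)
    with 1 show ?thesis by blast
  next
    case 2
    then have "(1/2) *\<^sub>R (x + deck a b c n x) \<in> singular_lines 1"
      by (intro mid) (auto simp: flips_def shifts_def quarter_axis_def)
    then show ?thesis by (auto intro: fixed_linesI)
  next
    case 3
    then have "(1/2) *\<^sub>R (x + deck a b c n x) \<in> singular_lines 4"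
      by (intro mid) (auto simp: flips_def shifts_def quarter_axis_def)
    then show ?thesis by (auto intro: fixed_linesI)
  next
    case 4
    then have "(1/2) *\<^sub>R (x + deck a b c n x) \<in> singular_lines 5"
      by (intro mid) (auto simp: flips_def shifts_def quarter_axis_def)
    then show ?thesis by (auto intro: fixed_linesI)
  next
    case 5
    then show ?thesis using nofix[of 2] by (auto simp: flips_def shifts_def)
  next
    case 6
    then show ?thesis using nofix[of 3] by (auto simp: flips_def shifts_def)
  next
    case 7
    then show ?thesis using nofix[of 4] by (auto simp: flips_def shifts_def)
  qed
qed

text \<open>
  Two lines for the same involution differ by a multiple of \<open>1/2\<close> in some coordinate.  For two different
  involutions there is a coordinate, transverse to both lines, in which one line has values in
  \<open>\<int>/2\<close> and the other one in \<open>1/4 + \<int>/2\<close>.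
\<close>

lemma singular_lines_separated:
  assumes x: "x \<in> singular_lines j" and y: "y \<in> singular_lines k" and jk: "j \<in> line_axes" "k \<in> line_axes"
    and near: "\<And>i. \<bar>x $ i - y $ i\<bar> < 1/4"
  shows "j = k \<and> (\<forall>i. i \<noteq> j \<longrightarrow> x $ i = y $ i)"
proof -
  have same: "(i = quarter_axis j \<longleftrightarrow> i = quarter_axis k) \<and> x $ i = y $ i" if "i \<noteq> j" "i \<noteq> k" for i
  proof -
    let ?m = "2 * x $ i - of_bool (i = quarter_axis j) / 2" and ?l = "2 * y $ i - of_bool (i = quarter_axis k) / 2"
    have "?m - ?l \<in> \<int>"
      using x y that unfolding singular_lines_def by (blast intro: Ints_diff)
    moreover have near2: "\<bar>2 * x $ i - 2 * y $ i\<bar> < 1/2"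
      using near[of i] by linarith
    moreover have "\<bar>(of_bool (i = quarter_axis j) - of_bool (i = quarter_axis k) :: real)\<bar> \<le> 1"
      by (simp add: of_bool_def)
    ultimately have "?m - ?l = 0"
      by (intro Ints_eq_0) (assumption, linarith)
    then show ?thesis
      using near2 by (cases "i = quarter_axis j"; cases "i = quarter_axis k"; simp)
  qed
  have "j = k"
  proof (rule ccontr)
    assume "j \<noteq> k"
    then show False
      using jk same[of 2] same[of 3] by (auto simp: quarter_axis_def)
  qed
  with same show ?thesis by blast
qed

definition axis_reflection :: "5 \<Rightarrow> real^5 \<Rightarrow> real^5" where
  "axis_reflection j v = (\<chi> i. if i = j then v $ i else - v $ i)"

text \<open>
  In each transverse coordinate \<open>g\<close> fixes a multiple of \<open>1/4\<close>.  This forces \<open>shifts\<close> to vanish except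
  where a quarter is reflected, which leaves only the identity and the involution that belongs to the line.
  So the neighbourhood of a singular circle is the product of a circle of length one with a ball modulo
  \<open>\<plusminus>1\<close>, without any twisting.
\<close>

lemma deck_line_stabiliser:
  assumes x: "x \<in> singular_lines j" and j: "j \<in> line_axes" and g: "g \<in> deck_group"
    and gx: "\<And>i. i \<noteq> j \<Longrightarrow> g x $ i = x $ i"
  shows "g x $ j - x $ j \<in> \<int> \<and>
    ((\<forall>v. g (x + v) = g x + v) \<or> (\<forall>v. g (x + v) = g x + axis_reflection j v))"
proof -
  obtain a b c n where g: "g = deck a b c n"
    using g unfolding deck_group_def by blast
  have sh: "shifts a b c i \<longleftrightarrow> flips a b c i \<and> i = quarter_axis j" if i: "i \<noteq> j" for i
  proof -
    obtain m where "2 * x $ i - of_bool (i = quarter_axis j) / 2 = of_int m"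
      using x i unfolding singular_lines_def Ints_def by blast
    then have x2: "2 * x $ i = of_int m + of_bool (i = quarter_axis j) / 2"
      by simp
    have e: "2 * of_int (n $ i) + of_bool (shifts a b c i)
        + (if flips a b c i then - (2 * x $ i) else 2 * x $ i) = 2 * x $ i"
    proof -
      have "of_int (n $ i) + of_bool (shifts a b c i) / 2 + (if flips a b c i then - x $ i else x $ i) = x $ i"
        using gx[OF i] by (simp add: g deck_def)
      then show ?thesis by (cases "flips a b c i"; simp only: if_True if_False; linarith)
    qed
    show ?thesis
    proof (cases "flips a b c i")
      case True
      then have "2 * of_int (n $ i) + of_bool (shifts a b c i) = 2 * of_int m + (of_bool (i = quarter_axis j)::real)"
        using e unfolding x2 by simp
      then have "of_int (2 * (n $ i) + of_bool (shifts a b c i)) = (of_int (2 * m + of_bool (i = quarter_axis j)) :: real)"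
        by simp
      then have "2 * (n $ i) + of_bool (shifts a b c i) = 2 * m + of_bool (i = quarter_axis j)"
        by (simp only: of_int_eq_iff)
      then have "shifts a b c i \<longleftrightarrow> i = quarter_axis j"
        by (cases "shifts a b c i"; cases "i = quarter_axis j"; simp; presburger)
      then show ?thesis using True by blast
    next
      case False
      then have "2 * of_int (n $ i) + (of_bool (shifts a b c i)::real) = 0"
        using e by simp
      then have "of_int (2 * (n $ i) + of_bool (shifts a b c i)) = (of_int 0 :: real)"
        by simp
      then have "2 * (n $ i) + of_bool (shifts a b c i) = 0"
        by (simp only: of_int_eq_iff)
      then have "\<not> shifts a b c i"
        by (cases "shifts a b c i"; simp; presburger)
      then show ?thesis using False by blast
    qed
  qed
  have fl: "(\<forall>i. \<not> flips a b c i) \<or> (\<forall>i. flips a b c i \<longleftrightarrow> i \<noteq> j)" and sj: "\<not> flips a b c j" "\<not> shifts a b c j"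
    using sh[of 1] sh[of 2] sh[of 3] sh[of 4] sh[of 5] j
    by (auto simp: forall_5 flips_def shifts_def quarter_axis_def)
  have "g x $ j - x $ j = of_int (n $ j)"
    using sj by (simp add: g deck_def)
  moreover have "(\<forall>v. g (x + v) = g x + v) \<or> (\<forall>v. g (x + v) = g x + axis_reflection j v)"
    using fl
  proof
    assume "\<forall>i. \<not> flips a b c i"
    then have "\<forall>v. g (x + v) = g x + v"
      by (simp add: g deck_def vec_eq_iff)
    then show ?thesis ..
  next
    assume "\<forall>i. flips a b c i \<longleftrightarrow> i \<noteq> j"
    then have "\<forall>v. g (x + v) = g x + axis_reflection j v"
      by (simp add: g deck_def vec_eq_iff axis_reflection_def)
    then show ?thesis ..
  qed
  ultimately show ?thesis by simp
qed

definition half_turn :: "5 \<Rightarrow> real^5 \<Rightarrow> real^5 \<Rightarrow> real^5" where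
  "half_turn j u x = u + axis_reflection j (x - u)"

lemma half_turn_in_deck_group:
  assumes u: "u \<in> singular_lines j" and j: "j \<in> line_axes"
  shows "half_turn j u \<in> deck_group"
proof -
  have "\<exists>m::int. i \<noteq> j \<longrightarrow> 2 * u $ i - of_bool (i = quarter_axis j) / 2 = of_int m" for i
    using u unfolding singular_lines_def Ints_def by blast
  then obtain m where m: "\<And>i. i \<noteq> j \<Longrightarrow> 2 * u $ i - of_bool (i = quarter_axis j) / 2 = of_int (m i :: int)"
    by metis
  define n :: "int^5" where "n = (\<chi> i. if i = j then 0 else m i)"
  have n: "of_int (n $ i) = (if i = j then 0 else 2 * u $ i - of_bool (i = quarter_axis j) / 2)" for i
    using m by (simp add: n_def)
  have "half_turn j u = deck (j = 1) (j = 4) (j = 5) n"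
    using j by (auto simp: half_turn_def axis_reflection_def deck_def n flips_def shifts_def
        quarter_axis_def fun_eq_iff vec_eq_iff)
  then show ?thesis
    unfolding deck_group_def by blast
qed

lemma deck_group_half_turn:
  assumes "g \<in> deck_group"
  shows "half_turn j (g u) (g x) = g (half_turn j u x)"
proof -
  obtain a b c n where "g = deck a b c n"
    using assms unfolding deck_group_def by blast
  then show ?thesis
    by (auto simp: half_turn_def axis_reflection_def deck_def vec_eq_iff)
qed

definition half_turn_step :: "real^5 \<Rightarrow> real^5 \<Rightarrow> bool" where
  "half_turn_step x y \<longleftrightarrow> (\<exists>j u. j \<in> line_axes \<and> u \<in> singular_lines j \<and> y = half_turn j u x)"

text \<open>
  For \<open>v\<close> transverse to the axis, half-turns about the parallel lines through \<open>u\<close> and \<open>u + v\<close> compose to the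
  translation by \<open>2 v\<close>.  As a unit
  vector along the \<open>i\<close>-th coordinate can be obtained in this way from lines parallel to any other axis, all
  lattice translations are products of half-turns.
\<close>

lemma deck_equiv_imp_half_turns:
  assumes "deck_equiv x y"
  shows "half_turn_step\<^sup>*\<^sup>* x y"
proof -
  have transl1: "half_turn_step\<^sup>*\<^sup>* x (x + axis i (of_int m))" for x i and m :: int
  proof -
    \<comment> \<open>any axis for which the \<open>i\<close>-th coordinate is transverse\<close>
    define j :: 5 where "j = (if i = 1 then 4 else 1)"
    have j: "j \<in> line_axes" "i \<noteq> j" by (auto simp: j_def)
    define u :: "real^5" where "u = (\<chi> k. of_bool (k = quarter_axis j) / 4)"
    define u' where "u' = u + axis i (of_int m / 2)"
    have u: "u \<in> singular_lines j"
      by (simp add: singular_lines_def u_def)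
    have u': "u' \<in> singular_lines j"
      by (auto simp: singular_lines_def u'_def u_def axis_def)
    have "half_turn j u' (half_turn j u x) = x + axis i (of_int m)"
      using j by (auto simp: half_turn_def axis_reflection_def u'_def axis_def vec_eq_iff)
    moreover have "half_turn_step x (half_turn j u x)"
        "half_turn_step (half_turn j u x) (half_turn j u' (half_turn j u x))"
      unfolding half_turn_step_def using j u u' by blast+
    ultimately show ?thesis
      by (metis converse_rtranclp_into_rtranclp r_into_rtranclp)
  qed
  have transl: "half_turn_step\<^sup>*\<^sup>* x (x + (\<chi> i. of_int (n $ i)))" for x and n :: "int^5"
  proof -
    have "(\<chi> i. of_int (n $ i)) = axis 1 (of_int (n $ 1)) + axis 2 (of_int (n $ 2)) + axis 3 (of_int (n $ 3))
        + axis 4 (of_int (n $ 4)) + (axis 5 (of_int (n $ 5)) :: real^5)"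
      by (auto simp: vec_eq_iff axis_def forall_5)
    then show ?thesis
      by (simp only: add.assoc[symmetric]) (meson rtranclp_trans transl1)
  qed
  have gen: "half_turn_step\<^sup>*\<^sup>* x (deck (j = 1) (j = 4) (j = 5) 0 x)" if j: "j \<in> line_axes" for j x
  proof -
    define u :: "real^5" where "u = (\<chi> k. of_bool (k = quarter_axis j) / 4)"
    have u: "u \<in> singular_lines j"
      by (simp add: singular_lines_def u_def)
    have "half_turn j u x = deck (j = 1) (j = 4) (j = 5) 0 x"
      using j by (auto simp: half_turn_def axis_reflection_def deck_def flips_def shifts_def u_def
        quarter_axis_def vec_eq_iff)
    moreover have "half_turn_step x (half_turn j u x)"
      unfolding half_turn_step_def using j u by blast
    ultimately show ?thesis
      by (simp add: r_into_rtranclp)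
  qed
  have gen': "half_turn_step\<^sup>*\<^sup>* x (deck a False False 0 x)" "half_turn_step\<^sup>*\<^sup>* x (deck False b False 0 x)"
      "half_turn_step\<^sup>*\<^sup>* x (deck False False c 0 x)" for a b c x
  proof -
    have id: "deck False False False 0 x = x" for x
      by (simp add: deck_translation vec_eq_iff)
    show "half_turn_step\<^sup>*\<^sup>* x (deck a False False 0 x)"
      using gen[of 1 x] by (cases a) (simp_all add: id)
    show "half_turn_step\<^sup>*\<^sup>* x (deck False b False 0 x)"
      using gen[of 4 x] by (cases b) (simp_all add: id)
    show "half_turn_step\<^sup>*\<^sup>* x (deck False False c 0 x)"
      using gen[of 5 x] by (cases c) (simp_all add: id)
  qed
  obtain a b c n where y: "y = deck a b c n x"
    using assms unfolding deck_equiv_def deck_group_def by blast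
  obtain k where k: "deck a False False 0 (deck False b False 0 (deck False False c 0 x)) = deck a b c k x"
    using deck_deck[of False b False 0 False False c 0] deck_deck[of a False False 0 False b c] by force
  have "half_turn_step\<^sup>*\<^sup>* x (deck a b c k x)"
    unfolding k[symmetric] by (meson gen' rtranclp_trans)
  moreover have "y = deck a b c k x + (\<chi> i. of_int ((n - k) $ i))"
    by (simp add: y deck_def vec_eq_iff)
  ultimately show ?thesis
    using transl rtranclp_trans by metis
qed

lemma dist_component_le: "\<bar>x $ i - y $ i\<bar> \<le> dist x (y :: real^5)"
  using component_le_norm_cart[of "x - y" i] by (simp add: dist_norm)

text \<open>
  This ties the singular set, defined on the torus, to the explicit lines in \<open>\<real>\<^sup>5\<close>.
\<close>

lemma orbifold_point_in_singular_set: "orbifold_point x \<in> singular_set \<longleftrightarrow> x \<in> fixed_lines"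
proof
  assume "orbifold_point x \<in> singular_set"
  then obtain t g where t: "orbifold_point x = Gam_orbit t" "t \<in> topspace torus5"
    and g: "g \<in> Gam" "g \<noteq> \<one>\<^bsub>BijT\<^esub>" "g t = t"
    unfolding singular_set_def by blast
  obtain y where y: "t = torus_class y"
    using t(2) by (auto simp: topspace_torus5)
  have xy: "deck_equiv x y"
    using t(1) unfolding y orbifold_point_def[symmetric] orbifold_point_eq_iff .
  obtain a b c where abc: "\<And>x. g (torus_class x) = torus_class (deck a b c 0 x)"
    using Gam_imp_deck[OF g(1)] by blast
  have "a \<or> b \<or> c"
  proof (rule ccontr)
    assume "\<not> (a \<or> b \<or> c)"
    then have id: "g (torus_class x) = torus_class x" for x
      unfolding abc using torus_class_eq_translation by metis
    \<comment> \<open>Elements of the group are extensional, so they are determined by their values on the torus.\<close>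
    have "g = \<one>\<^bsub>BijT\<^esub>"
    proof
      fix s show "g s = \<one>\<^bsub>BijT\<^esub> s"
      proof (cases "s \<in> topspace torus5")
        case True
        then show ?thesis using id one_BijT by (auto simp: topspace_torus5)
      next
        case False
        have "g \<in> extensional (topspace torus5)"
          using Gam_carrier[OF g(1)] by (simp add: BijGroup_def Bij_def)
        then show ?thesis using False by (simp add: BijGroup_def extensional_def)
      qed
    qed
    with g(2) show False by simp
  qed
  have "torus_class (deck a b c 0 y) = torus_class y"
    using g(3) unfolding y abc .
  then obtain n where "y = deck False False False n (deck a b c 0 y)"
    unfolding torus_class_eq_translation by blast
  moreover obtain n' where "\<And>x. deck False False False n (deck a b c 0 x) = deck a b c n' x"
    using deck_deck[of False False False n a b c 0] by auto
  ultimately have "deck a b c n' y = y" by metis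
  then have "(1/2) *\<^sub>R (y + y) \<in> fixed_lines"
    using deck_small_move[of a b c n' y] \<open>a \<or> b \<or> c\<close> by fastforce
  then have "y \<in> fixed_lines"
    by (simp flip: scaleR_2)
  then show "x \<in> fixed_lines"
    using xy deck_fixed_lines unfolding deck_equiv_def by blast
next
  assume "x \<in> fixed_lines"
  then obtain j where j: "j \<in> line_axes" "x \<in> singular_lines j" by (rule fixed_linesE)
  have hx: "half_turn j x \<in> deck_group"
    using half_turn_in_deck_group j by blast
  obtain n where h: "half_turn j x = deck (j = 1) (j = 4) (j = 5) n"
  proof -
    obtain a b c n where abc: "half_turn j x = deck a b c n"
      using hx unfolding deck_group_def by blast
    have "flips a b c i \<longleftrightarrow> i \<noteq> j" for i
    proof -
      have "half_turn j x (axis i 1) $ i - half_turn j x 0 $ i = (if i = j then 1 else - 1)"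
        by (simp add: half_turn_def axis_reflection_def axis_def)
      then show ?thesis
        unfolding abc by (simp add: deck_def axis_def split: if_splits)
    qed
    from this[of 1] this[of 2] this[of 4] this[of 5] have "a = (j = 1)" "b = (j = 4)" "c = (j = 5)"
      using j(1) by (auto simp: flips_def)
    then show thesis using that abc by blast
  qed
  obtain g where g: "g \<in> Gam" "\<And>x. g (torus_class x) = torus_class (deck (j = 1) (j = 4) (j = 5) 0 x)"
    using deck_imp_Gam by meson
  have "g (torus_class x) = torus_class (half_turn j x x)"
    unfolding g(2) h by (metis torus_class_deck)
  moreover have "half_turn j x x = x"
    by (simp add: half_turn_def axis_reflection_def vec_eq_iff)
  ultimately have gx: "g (torus_class x) = torus_class x" by simp
  have "g \<noteq> \<one>\<^bsub>BijT\<^esub>"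
  proof
    assume "g = \<one>\<^bsub>BijT\<^esub>"
    \<comment> \<open>The second coordinate is reflected for every axis, so it moves by \<open>1/2\<close>.\<close>
    define y where "y = x + (\<chi> i. 1/4)"
    have "g (torus_class y) = torus_class (half_turn j x y)"
      unfolding g(2) h by (metis torus_class_deck)
    then have e: "torus_class y = torus_class (half_turn j x y)"
      using \<open>g = \<one>\<^bsub>BijT\<^esub>\<close> one_BijT by simp
    have "half_turn j x y $ 2 - y $ 2 = - 1/2"
      using j(1) by (auto simp: half_turn_def axis_reflection_def y_def)
    moreover have "half_turn j x y $ 2 - y $ 2 \<in> \<int>"
      using e unfolding torus_class_eq_iff by blast
    ultimately have "(- 1/2 :: real) \<in> \<int>" by simp
    then show False using Ints_eq_0[of "- 1/2"] by simp
  qed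
  then show "orbifold_point x \<in> singular_set"
    unfolding singular_set_def orbifold_point_def using g(1) gx
    by (auto simp: topspace_torus5 intro!: exI[of _ "torus_class x"])
qed

lemma closed_fixed_lines: "closed fixed_lines"
proof -
  have "closed {x::real^5. 2 * x $ i - c \<in> \<int>}" for i c
  proof -
    have "closed ((\<lambda>x::real^5. 2 * x $ i - c) -` \<int>)"
      by (intro continuous_closed_vimage closed_Ints) (auto intro!: continuous_intros)
    then show ?thesis by (simp add: vimage_def)
  qed
  then have "closed (singular_lines j)" for j
    unfolding singular_lines_def by (intro closed_Collect_all closed_Collect_imp) auto
  then show ?thesis
    unfolding fixed_lines_def by auto
qed

lemma fixed_lines_eq_Union_lines:
  obtains a b and I :: "(5 \<times> int \<times> int \<times> int \<times> int \<times> int) set" where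
    "fixed_lines = (\<Union>i\<in>I. range (\<lambda>s. a i + s *\<^sub>R b i))"
proof
  define a :: "5 \<times> int \<times> int \<times> int \<times> int \<times> int \<Rightarrow> real^5" where
    "a = (\<lambda>(j, m1, m2, m3, m4, m5). \<chi> i. if i = j then 0 else
       of_int (if i = 1 then m1 else if i = 2 then m2 else if i = 3 then m3 else if i = 4 then m4 else m5) / 2
       + of_bool (i = quarter_axis j) / 4)"
  define b :: "5 \<times> int \<times> int \<times> int \<times> int \<times> int \<Rightarrow> real^5" where "b = (\<lambda>(j, m). axis j 1)"
  define I where "I = line_axes \<times> (UNIV :: (int \<times> int \<times> int \<times> int \<times> int) set)"
  have 1: "a (j, m) + s *\<^sub>R b (j, m) \<in> singular_lines j" for j m s
    by (cases m) (auto simp: singular_lines_def a_def b_def axis_def)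
  have 2: "\<exists>m s. x = a (j, m) + s *\<^sub>R b (j, m)" if x: "x \<in> singular_lines j" for x j
  proof -
    have "\<exists>m::int. i \<noteq> j \<longrightarrow> 2 * x $ i - of_bool (i = quarter_axis j) / 2 = of_int m" for i
      using x unfolding singular_lines_def Ints_def by blast
    then obtain m where m: "\<And>i. i \<noteq> j \<Longrightarrow> 2 * x $ i - of_bool (i = quarter_axis j) / 2 = of_int (m i :: int)"
      by metis
    have m': "x $ i = of_int (m i) / 2 + of_bool (i = quarter_axis j) / 4" if "i \<noteq> j" for i
      using m[OF that] by simp
    have "x $ i = (a (j, m 1, m 2, m 3, m 4, m 5) + (x $ j) *\<^sub>R b (j, m 1, m 2, m 3, m 4, m 5)) $ i" for i
      using m'[of i] exhaust_5[of i] by (cases "i = j") (auto simp: a_def b_def axis_def)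
    then show ?thesis unfolding vec_eq_iff by blast
  qed
  show "fixed_lines = (\<Union>i\<in>I. range (\<lambda>s. a i + s *\<^sub>R b i))"
  proof
    show "fixed_lines \<subseteq> (\<Union>i\<in>I. range (\<lambda>s. a i + s *\<^sub>R b i))"
    proof
      fix x assume "x \<in> fixed_lines"
      then obtain j where "j \<in> line_axes" "x \<in> singular_lines j" by (rule fixed_linesE)
      then obtain m s where "(j, m) \<in> I" "x = a (j, m) + s *\<^sub>R b (j, m)"
        using 2 unfolding I_def by blast
      then show "x \<in> (\<Union>i\<in>I. range (\<lambda>s. a i + s *\<^sub>R b i))" by blast
    qed
    show "(\<Union>i\<in>I. range (\<lambda>s. a i + s *\<^sub>R b i)) \<subseteq> fixed_lines"
      using 1 fixed_linesI unfolding I_def by blast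
  qed
qed

lemma simply_connected_Compl_fixed_lines: "simply_connected (- fixed_lines)"
proof -
  obtain a b and I :: "(5 \<times> int \<times> int \<times> int \<times> int \<times> int) set" where
    e: "fixed_lines = (\<Union>i\<in>I. range (\<lambda>s. a i + s *\<^sub>R b i))"
    by (rule fixed_lines_eq_Union_lines)
  show ?thesis
    unfolding e
  proof (rule simply_connected_Compl_countable_lines)
    show "DIM(real^5) > 3" by simp
    show "countable I" by simp
    show "closed (\<Union>i\<in>I. range (\<lambda>s. a i + s *\<^sub>R b i))"
      using closed_fixed_lines unfolding e .
  qed
qed

section \<open>Product coordinates around the singular circles\<close>

text \<open>
  The normal form of product coordinates: up to a sign \<open>\<sigma>\<close>, the first factor runs along a fixed line, and
  the second one is mapped isometrically into its orthogonal complement.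
\<close>

definition tube_chart :: "5 \<Rightarrow> coords \<Rightarrow> bool" where
  "tube_chart j f \<longleftrightarrow> j \<in> line_axes \<and> surj f \<and>
     (\<exists>p \<sigma> B. p \<in> singular_lines j \<and> \<bar>\<sigma>\<bar> = 1 \<and> linear B \<and> (\<forall>z. norm (B z) = norm z \<and> B z $ j = 0) \<and>
        f = (\<lambda>(t, z). p + axis j (\<sigma> * t) + B z))"

lemma norm_axis_eq: "norm (axis k c :: 'a::real_inner^'n) = norm c"
  by (simp add: norm_eq_sqrt_inner inner_axis_axis)

lemma linear_isometry_surj:
  fixes A :: "'a::euclidean_space \<Rightarrow> 'b::euclidean_space"
  assumes A: "linear A" "\<And>v. norm (A v) = norm v" and dim: "DIM('a) = DIM('b)"
  shows "surj A"
proof -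
  have "inj A"
    using A by (simp add: linear_injective_0) (metis norm_eq_zero)
  then have "dim (range A) = DIM('b)"
    using dim_image_eq[OF A(1), of UNIV] dim by simp
  then have "span (range A) = UNIV"
    by (simp only: dim_eq_full)
  moreover have "subspace (range A)"
    using A(1) by (simp add: linear_subspace_image)
  ultimately show ?thesis
    by (metis span_eq_iff)
qed

text \<open>
  The image of the axis \<open>z = 0\<close> is a line contained in the union of the fixed lines.  As these are separated,
  it stays on a single one of them for a short time, hence for ever.
\<close>

lemma tube_coordinates_imp_chart:
  assumes f: "tube_coordinates C f" and C: "C \<subseteq> singular_set"
  shows "\<exists>j. tube_chart j f"
proof -
  obtain p A where A: "linear A" "\<And>v. norm (A v) = norm v" and fA: "f = (\<lambda>v. p + A v)"
    and range: "range (\<lambda>t. orbifold_point (f (t, 0))) = C"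
    using f unfolding tube_coordinates_def by blast
  have fl: "f (t, 0) \<in> fixed_lines" for t
  proof -
    have "orbifold_point (f (t, 0)) \<in> singular_set"
      using range C by blast
    then show ?thesis by (simp only: orbifold_point_in_singular_set)
  qed
  define v where "v = A (1, 0)"
  have At: "A (t, 0) = t *\<^sub>R v" for t
    using linear_scale[OF A(1), of t "(1, 0)"] by (simp add: v_def)
  have nv: "norm v = 1"
    unfolding v_def A(2) by (simp add: norm_Pair)
  have ft: "f (t, 0) = p + t *\<^sub>R v" for t
    by (simp add: fA At)
  obtain j where j: "j \<in> line_axes" "p \<in> singular_lines j"
    using fixed_linesE[OF fl[of 0]] unfolding ft by auto
  obtain k where k: "k \<in> line_axes" "p + (1/8) *\<^sub>R v \<in> singular_lines k"
    using fixed_linesE[OF fl[of "1/8"]] unfolding ft by blast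
  have "\<bar>p $ i - (p + (1/8) *\<^sub>R v) $ i\<bar> < 1/4" for i
    using component_le_norm_cart[of v i] nv by simp
  then have "j = k \<and> (\<forall>i. i \<noteq> j \<longrightarrow> p $ i = (p + (1/8) *\<^sub>R v) $ i)"
    by (rule singular_lines_separated[OF j(2) k(2) j(1) k(1)])
  then have vi: "v $ i = 0" if "i \<noteq> j" for i
    using that by simp
  define \<sigma> where "\<sigma> = v $ j"
  have v: "v = axis j \<sigma>"
    using vi by (auto simp: vec_eq_iff axis_def \<sigma>_def)
  have s1: "\<bar>\<sigma>\<bar> = 1"
    using nv unfolding v by (simp add: norm_axis_eq)
  define B where "B z = A (0, z)" for z
  have B: "linear B"
  proof (rule linearI)
    fix x y :: "complex^2" and r :: real
    show "B (x + y) = B x + B y"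
      using linear_add[OF A(1), of "(0, x)" "(0, y)"] by (simp add: B_def)
    show "B (r *\<^sub>R x) = r *\<^sub>R B x"
      using linear_scale[OF A(1), of r "(0, x)"] by (simp add: B_def)
  qed
  have nB: "norm (B z) = norm z" for z
    unfolding B_def A(2) by (simp add: norm_Pair)
  have fB: "f (t, z) = p + axis j (\<sigma> * t) + B z" for t z
  proof -
    have "A (t, z) = A (t, 0) + A (0, z)"
      using linear_add[OF A(1), of "(t, 0)" "(0, z)"] by simp
    moreover have "A (t, 0) = axis j (\<sigma> * t)"
      unfolding At v by (simp add: vec_eq_iff axis_def)
    ultimately show ?thesis by (simp add: fA B_def)
  qed
  have Bj: "B z $ j = 0" for z
  proof -
    have "norm (A (1, z)) ^ 2 = 1 + norm z ^ 2"
      unfolding A(2) by (simp add: norm_Pair)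
    moreover have "A (1, z) = v + B z"
      using linear_add[OF A(1), of "(1, 0)" "(0, z)"] by (simp add: v_def B_def)
    moreover have "norm (v + B z) ^ 2 = norm v ^ 2 + norm (B z) ^ 2 + 2 * (v \<bullet> B z)"
      by (simp add: power2_norm_eq_inner inner_simps inner_commute)
    ultimately have "v \<bullet> B z = 0"
      using nv nB by simp
    then show ?thesis
      using s1 unfolding v by (auto simp: inner_axis' inner_axis)
  qed
  have "surj A"
    by (rule linear_isometry_surj[OF A]) simp
  have "surj f"
  proof (rule surjI)
    fix x show "f (inv_into UNIV A (x - p)) = x"
      using surj_f_inv_f[OF \<open>surj A\<close>, of "x - p"] by (simp add: fA)
  qed
  moreover have "f = (\<lambda>(t, z). p + axis j (\<sigma> * t) + B z)"
    using fB by (auto simp: fun_eq_iff)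
  ultimately show ?thesis
    unfolding tube_chart_def using j s1 B nB Bj by blast
qed

lemma tube_chart_axis: "tube_chart j f \<Longrightarrow> j \<in> line_axes"
  unfolding tube_chart_def by (elim conjE)

lemma tube_chart_surj: "tube_chart j f \<Longrightarrow> surj f"
  unfolding tube_chart_def by (elim conjE)

lemma tube_chart_dist:
  assumes "tube_chart j f" shows "dist (f v) (f w) = dist v w"
proof -
  obtain p \<sigma> B where *: "\<bar>\<sigma>\<bar> = 1" "linear B" "\<And>z. norm (B z) = norm z" "\<And>z. B z $ j = 0"
    "f = (\<lambda>(t, z). p + axis j (\<sigma> * t) + B z)"
    using assms unfolding tube_chart_def by blast
  obtain t z s y where vw: "v = (t, z)" "w = (s, y)" by (cases v; cases w)
  have "f v - f w = axis j (\<sigma> * (t - s)) + B (z - y)"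
    by (simp add: *(5) vw linear_diff[OF *(2)] vec_eq_iff axis_def algebra_simps)
  moreover have "norm (axis j (\<sigma> * (t - s)) + B (z - y)) ^ 2 = norm (t - s) ^ 2 + norm (z - y) ^ 2"
  proof -
    have "axis j (\<sigma> * (t - s)) \<bullet> B (z - y) = 0"
      by (simp add: inner_axis' *(4))
    then have "norm (axis j (\<sigma> * (t - s)) + B (z - y)) ^ 2 = norm (axis j (\<sigma> * (t - s)) :: real^5) ^ 2 + norm (B (z - y)) ^ 2"
      by (rule norm_add_Pythagorean[unfolded orthogonal_def])
    then show ?thesis
      by (simp add: norm_axis_eq abs_mult *(1,3))
  qed
  ultimately have "dist (f v) (f w) ^ 2 = dist v w ^ 2"
    unfolding dist_norm by (simp add: vw norm_Pair)
  then show ?thesis by simp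
qed

lemma tube_chart_inj: "tube_chart j f \<Longrightarrow> f v = f w \<Longrightarrow> v = w"
  using tube_chart_dist[of j f v w] by simp

lemma tube_chart_continuous: "tube_chart j f \<Longrightarrow> continuous_on S f"
  unfolding continuous_on_iff using tube_chart_dist[of j f] by simp blast

lemma tube_chart_line: "tube_chart j f \<Longrightarrow> f (t, 0) \<in> singular_lines j"
  unfolding tube_chart_def by (auto simp: singular_lines_def axis_def linear_0)

lemma tube_chart_half_turn:
  assumes "tube_chart j f" shows "half_turn j (f (s, 0)) (f (t, z)) = f (t, - z)"
proof -
  obtain p \<sigma> B where *: "linear B" "\<And>z. B z $ j = 0" "f = (\<lambda>(t, z). p + axis j (\<sigma> * t) + B z)"
    using assms unfolding tube_chart_def by blast
  show ?thesis
    by (simp add: *(3) half_turn_def axis_reflection_def vec_eq_iff axis_def linear_0[OF *(1)] linear_neg[OF *(1)] *(2))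
qed

lemma tube_chart_line_onto:
  assumes "tube_chart j f" "\<And>i. i \<noteq> j \<Longrightarrow> y $ i = f (t, 0) $ i"
  shows "\<exists>s. y = f (s, 0)"
proof -
  obtain p \<sigma> B where *: "linear B" "\<bar>\<sigma>\<bar> = 1" "f = (\<lambda>(t, z). p + axis j (\<sigma> * t) + B z)"
    using assms(1) unfolding tube_chart_def by blast
  have "\<sigma> * \<sigma> = 1" using *(2) by (metis abs_mult_self_eq mult_1)
  then have "y $ i = f (\<sigma> * (y $ j - p $ j), 0) $ i" for i
    using assms(2)[of i] by (cases "i = j") (auto simp: *(3) linear_0[OF *(1)] axis_def mult.assoc[symmetric])
  then show ?thesis unfolding vec_eq_iff by blast
qed

lemma tube_chart_on_fixed_lines:
  assumes f: "tube_chart j f" and z: "norm z < 1/4"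
  shows "f (t, z) \<in> fixed_lines \<longleftrightarrow> z = 0"
proof
  assume "z = 0"
  then show "f (t, z) \<in> fixed_lines"
    using tube_chart_line[OF f] tube_chart_axis[OF f] fixed_linesI by simp
next
  assume "f (t, z) \<in> fixed_lines"
  then obtain k where k: "k \<in> line_axes" "f (t, z) \<in> singular_lines k" by (rule fixed_linesE)
  have "dist (f (t, z)) (f (t, 0)) < 1/4"
    using z by (simp add: tube_chart_dist[OF f] dist_Pair_Pair)
  then have "\<bar>f (t, z) $ i - f (t, 0) $ i\<bar> < 1/4" for i
    using dist_component_le[of "f (t, z)" i "f (t, 0)"] by linarith
  then have "k = j \<and> (\<forall>i. i \<noteq> k \<longrightarrow> f (t, z) $ i = f (t, 0) $ i)"
    by (rule singular_lines_separated[OF k(2) tube_chart_line[OF f] k(1) tube_chart_axis[OF f]])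
  then obtain s where "f (t, z) = f (s, 0)"
    using tube_chart_line_onto[OF f, of "f (t, z)" t] by blast
  then show "z = 0"
    using tube_chart_inj[OF f] by blast
qed

lemma tube_chart_translate:
  assumes f: "tube_chart j f" and m: "m \<in> \<int>"
  shows "\<exists>g\<in>deck_group. \<forall>t z. g (f (t, z)) = f (t + m, z)"
proof -
  obtain p \<sigma> B where *: "\<bar>\<sigma>\<bar> = 1" "f = (\<lambda>(t, z). p + axis j (\<sigma> * t) + B z)"
    using f unfolding tube_chart_def by blast
  have "\<sigma> = 1 \<or> \<sigma> = - 1" using *(1) by linarith
  then have "\<sigma> * m \<in> \<int>"
    using m by auto
  then obtain k :: int where k: "\<sigma> * m = of_int k" by (auto elim: Ints_cases)
  have "deck False False False (axis j k) (f (t, z)) = f (t + m, z)" for t z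
    by (simp add: *(2) deck_translation vec_eq_iff axis_def k distrib_left)
  then show ?thesis
    unfolding deck_group_def by blast
qed

lemma tube_chart_stabiliser:
  assumes f: "tube_chart j f" and g: "g \<in> deck_group" and gf: "g (f (t, 0)) = f (s, 0)"
  shows "s - t \<in> \<int>" "\<And>z. g (f (t, z)) = f (s, z) \<or> g (f (t, z)) = f (s, - z)"
proof -
  obtain p \<sigma> B where *: "\<bar>\<sigma>\<bar> = 1" "linear B" "\<And>z. B z $ j = 0" "f = (\<lambda>(t, z). p + axis j (\<sigma> * t) + B z)"
    using f unfolding tube_chart_def by blast
  have eq: "g (f (t, 0)) $ i = f (t, 0) $ i" if "i \<noteq> j" for i
    using that unfolding gf by (simp add: *(4) axis_def)
  have stab: "g (f (t, 0)) $ j - f (t, 0) $ j \<in> \<int> \<and> ((\<forall>v. g (f (t, 0) + v) = g (f (t, 0)) + v) \<or>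
      (\<forall>v. g (f (t, 0) + v) = g (f (t, 0)) + axis_reflection j v))"
    by (rule deck_line_stabiliser[OF tube_chart_line[OF f] tube_chart_axis[OF f] g]) (rule eq)
  have "\<sigma> * (s - t) \<in> \<int>"
    using conjunct1[OF stab] unfolding gf by (simp add: *(4) axis_def linear_0[OF *(2)] algebra_simps)
  moreover have "\<sigma> = 1 \<or> \<sigma> = - 1" using *(1) by linarith
  ultimately show "s - t \<in> \<int>"
    by (metis Ints_minus minus_diff_eq mult_1 mult_minus1)
  fix z
  have ft: "f (t, z) = f (t, 0) + B z" "f (s, z) = f (s, 0) + B z" "f (s, - z) = f (s, 0) - B z"
    by (simp_all add: *(4) linear_0[OF *(2)] linear_neg[OF *(2)])
  have r: "axis_reflection j (B z) = - B z"
    by (simp add: axis_reflection_def vec_eq_iff *(3))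
  show "g (f (t, z)) = f (s, z) \<or> g (f (t, z)) = f (s, - z)"
    using conjunct2[OF stab] unfolding ft(2,3) ft(1)
    by (elim disjE) (simp_all add: gf r)
qed

lemma topspace_orbifold: "topspace orbifold = range orbifold_point"
  by (auto simp: orbifold_def topspace_torus5 orbifold_point_def)

locale tube_system =
  fixes F :: "orbifold_pt set \<Rightarrow> coords"
  assumes tubes: "\<And>C. C \<in> singular_circles \<Longrightarrow> tube_coordinates C (F C)"
begin

lemma range_core: "C \<in> singular_circles \<Longrightarrow> range (\<lambda>t. orbifold_point (F C (t, 0))) = C"
  using tubes unfolding tube_coordinates_def by blast

lemma chart: "C \<in> singular_circles \<Longrightarrow> \<exists>j. tube_chart j (F C)"
  using tube_coordinates_imp_chart[OF tubes] connected_components_of_subset[of C "subtopology orbifold singular_set"]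
  unfolding singular_circles_def by (simp add: subset_iff)

lemma circles_disjoint: "C \<in> singular_circles \<Longrightarrow> C' \<in> singular_circles \<Longrightarrow> x \<in> C \<Longrightarrow> x \<in> C' \<Longrightarrow> C = C'"
  using pairwise_disjoint_connected_components_of[of "subtopology orbifold singular_set"]
  unfolding singular_circles_def pairwise_def disjnt_def by blast

lemma fixed_lines_covered:
  assumes "u \<in> fixed_lines"
  shows "\<exists>C\<in>singular_circles. \<exists>g\<in>deck_group. \<exists>t. u = g (F C (t, 0))"
proof -
  have "orbifold_point u \<in> topspace (subtopology orbifold singular_set)"
    using assms by (simp add: orbifold_point_in_singular_set topspace_orbifold)
  then obtain C where C: "C \<in> singular_circles" "orbifold_point u \<in> C"
    using Union_connected_components_of[of "subtopology orbifold singular_set"]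
    unfolding singular_circles_def by blast
  then have "orbifold_point u \<in> range (\<lambda>t. orbifold_point (F C (t, 0)))"
    using range_core[OF C(1)] by simp
  then obtain t where "orbifold_point u = orbifold_point (F C (t, 0))"
    by blast
  then have "deck_equiv (F C (t, 0)) u"
    by (simp only: orbifold_point_eq_iff[symmetric])
  then show ?thesis
    using C(1) unfolding deck_equiv_def by blast
qed

text \<open>
  If lifts of two tubes come close, then their axes are less than \<open>1/4\<close> apart and so coincide, and the
  lift that relates them stabilises this line.  The margin \<open>1/20\<close> lets this lemma describe a whole neighbourhood
  of a point; equality of the two points gives the uniqueness of tube coordinates.
\<close>

lemma tubes_far_apart:
  assumes C: "C \<in> singular_circles" "C' \<in> singular_circles" and g: "g \<in> deck_group" "g' \<in> deck_group"
    and z: "norm z \<le> 1/10" "norm z' \<le> 1/10"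
    and near: "dist (g (F C (t, z))) (g' (F C' (t', z'))) < 1/20"
  shows "C = C' \<and> (\<exists>s. s - t' \<in> \<int> \<and>
    (g' (F C' (t', z')) = g (F C (s, z')) \<or> g' (F C' (t', z')) = g (F C (s, - z'))))"
proof -
  obtain j where j: "tube_chart j (F C)" using chart[OF C(1)] by blast
  obtain j' where j': "tube_chart j' (F C')" using chart[OF C(2)] by blast
  obtain k where k: "k \<in> deck_group" "\<And>x. k (g x) = x" "\<And>x. g (k x) = x"
    using deck_group_inverse[OF g(1)] by metis
  \<comment> \<open>Moving both points back by \<open>g\<close>, it is enough to compare a tube with its image under \<open>h\<close>.\<close>
  define h where "h = (\<lambda>x. k (g' x))"
  have h: "h \<in> deck_group"
    unfolding h_def by (rule deck_group_compose[OF k(1) g(2)])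
  have gh: "g' x = g (h x)" for x
    by (simp add: h_def k)
  let ?u = "F C (t, 0)" and ?u' = "h (F C' (t', 0))"
  have "dist (F C (t, z)) (h (F C' (t', z'))) < 1/20"
    using near unfolding gh deck_group_dist[OF g(1)] .
  moreover have "dist ?u (F C (t, z)) \<le> 1/10"
    using z by (simp add: tube_chart_dist[OF j] dist_Pair_Pair)
  moreover have "dist (h (F C' (t', z'))) ?u' \<le> 1/10"
    using z by (simp add: deck_group_dist[OF h] tube_chart_dist[OF j'] dist_Pair_Pair)
  ultimately have "dist ?u ?u' < 1/4"
    using dist_triangle[of ?u ?u' "F C (t, z)"] dist_triangle[of "F C (t, z)" ?u' "h (F C' (t', z'))"] by linarith
  then have near4: "\<bar>?u $ i - ?u' $ i\<bar> < 1/4" for i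
    using dist_component_le[of ?u i ?u'] by linarith
  have "?u' \<in> singular_lines j'"
    using deck_singular_lines[OF h tube_chart_line[OF j']] .
  then have "j = j' \<and> (\<forall>i. i \<noteq> j \<longrightarrow> ?u $ i = ?u' $ i)"
    using near4 by (rule singular_lines_separated[OF tube_chart_line[OF j] _ tube_chart_axis[OF j] tube_chart_axis[OF j']])
  then obtain s where s: "?u' = F C (s, 0)"
    using tube_chart_line_onto[OF j, of ?u' t] by auto
  then have "deck_equiv (F C' (t', 0)) (F C (s, 0))"
    using h unfolding deck_equiv_def by metis
  then have "orbifold_point (F C' (t', 0)) = orbifold_point (F C (s, 0))"
    unfolding orbifold_point_eq_iff .
  moreover have "orbifold_point (F C' (t', 0)) \<in> C'" "orbifold_point (F C (s, 0)) \<in> C"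
    using range_core C by blast+
  ultimately have CC: "C = C'"
    using circles_disjoint[OF C] by simp
  have "s - t' \<in> \<int>" "h (F C (t', z')) = F C (s, z') \<or> h (F C (t', z')) = F C (s, - z')"
    using tube_chart_stabiliser[OF j h] s CC by auto
  then show ?thesis
    using CC unfolding gh by metis
qed

lemma tube_coordinates_unique:
  assumes C: "C \<in> singular_circles" "C' \<in> singular_circles" and z: "norm z \<le> 1/10" "norm z' \<le> 1/10"
    and eq: "orbifold_point (F C (t, z)) = orbifold_point (F C' (t', z'))"
  shows "C = C' \<and> t - t' \<in> \<int> \<and> (z = z' \<or> z = - z')"
proof -
  obtain g where g: "g \<in> deck_group" "F C (t, z) = g (F C' (t', z'))"
    using deck_equiv_sym eq unfolding orbifold_point_eq_iff deck_equiv_def by metis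
  have "C = C' \<and> (\<exists>s. s - t' \<in> \<int> \<and>
    (g (F C' (t', z')) = F C (s, z') \<or> g (F C' (t', z')) = F C (s, - z')))"
  proof (rule tubes_far_apart[OF C id_in_deck_group g(1) z])
    show "dist (F C (t, z)) (g (F C' (t', z'))) < 1/20"
      by (simp add: g(2))
  qed
  then obtain s where s: "C = C'" "s - t' \<in> \<int>"
      and s3': "g (F C' (t', z')) = F C (s, z') \<or> g (F C' (t', z')) = F C (s, - z')"
    by blast
  have s3: "F C (t, z) = F C (s, z') \<or> F C (t, z) = F C (s, - z')"
    using s3' unfolding g(2) .
  obtain j where j: "tube_chart j (F C)" using chart[OF C(1)] by blast
  have "(t, z) = (s, z') \<or> (t, z) = (s, - z')"
    using s3 tube_chart_inj[OF j] by blast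
  then show ?thesis using s by auto
qed

lemma orbifold_point_tube_cong:
  assumes C: "C \<in> singular_circles" and t: "t - t' \<in> \<int>" and z: "z = z' \<or> z = - z'"
  shows "orbifold_point (F C (t, z)) = orbifold_point (F C (t', z'))"
proof -
  obtain j where j: "tube_chart j (F C)" using chart[OF C(1)] by blast
  obtain g where g: "g \<in> deck_group" "\<And>s z. g (F C (s, z)) = F C (s + (t - t'), z)"
    using tube_chart_translate[OF j t] by blast
  have 1: "deck_equiv (F C (t', z')) (F C (t, z'))" for z'
    unfolding deck_equiv_def using g(1) g(2)[of t' z'] by (intro bexI[of _ g]) simp_all
  have 2: "deck_equiv (F C (t, - z')) (F C (t, z'))"
    using half_turn_in_deck_group[OF tube_chart_line[OF j] tube_chart_axis[OF j]] tube_chart_half_turn[OF j]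
    unfolding deck_equiv_def by (metis minus_minus)
  show ?thesis
    using z 1 2 unfolding orbifold_point_eq_iff by (metis deck_equiv_sym deck_equiv_trans)
qed

end

section \<open>Products, sums and quotients of topologies\<close>

lemma open_map_prod:
  assumes f: "open_map X X' f" and g: "open_map Y Y' g"
  shows "open_map (prod_topology X Y) (prod_topology X' Y') (\<lambda>z. (f (fst z), g (snd z)))"
  unfolding open_map_def
proof (intro allI impI)
  fix S assume S: "openin (prod_topology X Y) S"
  show "openin (prod_topology X' Y') ((\<lambda>z. (f (fst z), g (snd z))) ` S)"
    unfolding openin_prod_topology_alt
  proof (intro allI impI)
    fix x' y' assume "(x', y') \<in> (\<lambda>z. (f (fst z), g (snd z))) ` S"
    then obtain x y where xy: "(x, y) \<in> S" "x' = f x" "y' = g y" by auto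
    obtain U V where UV: "openin X U" "openin Y V" "x \<in> U" "y \<in> V" "U \<times> V \<subseteq> S"
      using S xy(1) unfolding openin_prod_topology_alt by meson
    have "f ` U \<times> g ` V \<subseteq> (\<lambda>z. (f (fst z), g (snd z))) ` S"
    proof
      fix q assume "q \<in> f ` U \<times> g ` V"
      then obtain u v where "u \<in> U" "v \<in> V" "q = (f u, g v)" by blast
      then show "q \<in> (\<lambda>z. (f (fst z), g (snd z))) ` S"
        using UV(5) by (intro image_eqI[of _ _ "(u, v)"]) auto
    qed
    moreover have "openin X' (f ` U)" "openin Y' (g ` V)"
      using f g UV(1,2) unfolding open_map_def by simp_all
    moreover have "x' \<in> f ` U" "y' \<in> g ` V"
      using xy UV(3,4) by simp_all
    ultimately show "\<exists>U V. openin X' U \<and> openin Y' V \<and> x' \<in> U \<and> y' \<in> V \<and>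
        U \<times> V \<subseteq> (\<lambda>z. (f (fst z), g (snd z))) ` S"
      by (intro exI[of _ "f ` U"] exI[of _ "g ` V"] conjI)
  qed
qed

text \<open>
  The maps to which this is applied divide by a group of homeomorphisms, so the saturation of an open set is a
  union of its translates.  Openness is what makes products and restrictions of these maps quotient maps again.
\<close>

lemma open_map_quotient_topology:
  assumes "\<And>U. openin X U \<Longrightarrow> openin X {x \<in> topspace X. f x \<in> f ` U}"
  shows "open_map X (quotient_topology X f) f"
  unfolding open_map_def openin_quotient_topology
  using assms openin_subset by blast

lemma continuous_map_disjoint_union:
  assumes "continuous_map X Z (\<lambda>x. f (Inl x))" "continuous_map Y Z (\<lambda>y. f (Inr y))"
  shows "continuous_map (disjoint_union_topology X Y) Z f"
  unfolding continuous_map_def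
proof (intro conjI allI impI)
  show "f \<in> topspace (disjoint_union_topology X Y) \<rightarrow> topspace Z"
    using assms by (auto simp: continuous_map_def)
  fix U assume U: "openin Z U"
  let ?S = "{x \<in> topspace (disjoint_union_topology X Y). f x \<in> U}"
  have "Inl -` ?S = {x \<in> topspace X. f (Inl x) \<in> U}" "Inr -` ?S = {x \<in> topspace Y. f (Inr x) \<in> U}"
    by auto
  then show "openin (disjoint_union_topology X Y) ?S"
    using assms U unfolding openin_disjoint_union_topology continuous_map_def by auto
qed

lemma continuous_map_sum:
  assumes "\<And>i. i \<in> I \<Longrightarrow> continuous_map (X i) Z (\<lambda>x. f (i, x))"
  shows "continuous_map (sum_topology X I) Z f"
  unfolding continuous_map_def
proof (intro conjI allI impI)
  show "f \<in> topspace (sum_topology X I) \<rightarrow> topspace Z"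
  proof
    fix x assume "x \<in> topspace (sum_topology X I)"
    then have "fst x \<in> I" "snd x \<in> topspace (X (fst x))" by auto
    then show "f x \<in> topspace Z"
      using funcset_mem[OF continuous_map_funspace[OF assms[of "fst x"]], of "snd x"] by simp
  qed
  fix U assume U: "openin Z U"
  have "openin (X i) {x. (i, x) \<in> {x \<in> topspace (sum_topology X I). f x \<in> U}}" if "i \<in> I" for i
  proof -
    have "{x. (i, x) \<in> {x \<in> topspace (sum_topology X I). f x \<in> U}} = {x \<in> topspace (X i). f (i, x) \<in> U}"
      using that by auto
    then show ?thesis
      using assms[OF that] U by (simp add: continuous_map_def)
  qed
  then show "openin (sum_topology X I) {x \<in> topspace (sum_topology X I). f x \<in> U}"
    unfolding openin_sum_topology by auto
qed

lemma continuous_map_Inl: "continuous_map X (disjoint_union_topology X Y) Inl"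
  by (auto simp: continuous_map_def openin_disjoint_union_topology vimage_def
      elim!: back_subst[of "openin X"] dest: openin_subset)

lemma continuous_map_Inr: "continuous_map Y (disjoint_union_topology X Y) Inr"
  by (auto simp: continuous_map_def openin_disjoint_union_topology vimage_def
      elim!: back_subst[of "openin Y"] dest: openin_subset)

lemma openin_Inr_image:
  fixes X :: "'a topology" and Y :: "'b topology"
  assumes "openin Y V" shows "openin (disjoint_union_topology X Y) (Inr ` V)"
proof -
  have "Inr -` (Inr ` V :: ('a + 'b) set) = V" "Inl -` (Inr ` V :: ('a + 'b) set) = {}"
    by auto
  then show ?thesis
    using assms openin_subset[OF assms] by (auto simp: openin_disjoint_union_topology)
qed

lemma continuous_map_sum_injection:
  assumes "i \<in> I" shows "continuous_map (X i) (sum_topology X I) (Pair i)"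
  unfolding continuous_map_def
proof (intro conjI allI impI)
  show "Pair i \<in> topspace (X i) \<rightarrow> topspace (sum_topology X I)"
    using assms by auto
  fix U assume "openin (sum_topology X I) U"
  then have "openin (X i) {x. (i, x) \<in> U}"
    using assms by (auto simp: openin_sum_topology)
  moreover have "{x. (i, x) \<in> U} = {x \<in> topspace (X i). (i, x) \<in> U}"
    using openin_subset[OF calculation] by auto
  ultimately show "openin (X i) {x \<in> topspace (X i). (i, x) \<in> U}" by simp
qed

section \<open>The building blocks\<close>

lemma circle_class_eq_iff: "circle_class t = circle_class s \<longleftrightarrow> t - s \<in> \<int>"
proof
  assume "circle_class t = circle_class s"
  moreover have "t \<in> circle_class t" by (simp add: circle_class_def)
  ultimately show "t - s \<in> \<int>" by (auto simp: circle_class_def)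
next
  assume ts: "t - s \<in> \<int>"
  have "r - t \<in> \<int> \<longleftrightarrow> r - s \<in> \<int>" for r
    using Ints_add[of "r - t" "t - s"] Ints_diff[of "r - s" "t - s"] ts by auto
  then show "circle_class t = circle_class s"
    by (simp add: circle_class_def)
qed

lemma topspace_unit_circle: "topspace unit_circle = range circle_class"
  by (simp add: unit_circle_def)

lemma continuous_map_circle_class: "continuous_map euclidean unit_circle circle_class"
  unfolding unit_circle_def by (rule quotient_imp_continuous_map[OF quotient_map_quotient_topology])

lemma open_map_circle_class: "open_map euclidean unit_circle circle_class"
  unfolding unit_circle_def
proof (rule open_map_quotient_topology)
  fix U :: "real set" assume "openin euclidean U"
  then have U: "open U" by simp
  have "{x \<in> topspace euclidean. circle_class x \<in> circle_class ` U} = (\<Union>m\<in>\<int>. (\<lambda>x. x + m) -` U)"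
    by (auto simp: circle_class_eq_iff image_iff) 
      (metis add.commute diff_add_cancel Ints_minus minus_diff_eq, metis add_diff_cancel_left' Ints_minus minus_diff_eq diff_add_cancel)
  moreover have "open (\<Union>m\<in>\<int>. (\<lambda>x. x + m) -` U)"
    using U by (intro open_UN ballI open_vimage) (auto intro!: continuous_intros)
  ultimately show "openin euclidean {x \<in> topspace euclidean. circle_class x \<in> circle_class ` U}"
    by simp
qed

lemma complex_line_iff: "z \<in> complex_line w \<longleftrightarrow> (\<exists>c. z = c *s w)"
  by (auto simp: complex_line_def)

lemma complex_line_scale:
  assumes "c \<noteq> 0" shows "complex_line (c *s w) = complex_line w"
proof -
  have "d *s w = (d / c) *s (c *s w)" for d
    using assms by (simp add: vector_smult_assoc)
  then have "d *s w \<in> complex_line (c *s w)" for d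
    unfolding complex_line_iff by blast
  moreover have "d *s (c *s w) \<in> complex_line w" for d
    unfolding complex_line_iff vector_smult_assoc by blast
  ultimately show ?thesis
    by (auto simp: complex_line_iff)
qed

lemma complex_line_uminus [simp]: "complex_line (- w) = complex_line w"
  using complex_line_scale[of "- 1" w] by simp

lemma complex_line_eq_iff:
  assumes "w \<noteq> 0" "w' \<noteq> 0"
  shows "complex_line w = complex_line w' \<longleftrightarrow> (\<exists>c. c \<noteq> 0 \<and> w' = c *s w)"
proof
  assume "complex_line w = complex_line w'"
  moreover have "w' \<in> complex_line w'"
    by (auto simp: complex_line_iff intro!: exI[of _ 1])
  ultimately have "w' \<in> complex_line w" by simp
  then obtain c where "w' = c *s w"
    by (auto simp: complex_line_iff)
  with assms(2) show "\<exists>c. c \<noteq> 0 \<and> w' = c *s w" by (intro exI[of _ c]) auto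
qed (auto simp: complex_line_scale)

lemma self_in_complex_line [simp]: "w \<in> complex_line w"
  by (auto simp: complex_line_iff intro!: exI[of _ 1])

lemma zero_in_complex_line [simp]: "0 \<in> complex_line w"
  by (auto simp: complex_line_iff intro!: exI[of _ 0])

lemma complex_line_of_member:
  assumes "z \<in> complex_line w" "z \<noteq> 0" shows "complex_line w = complex_line z"
proof -
  obtain c where "z = c *s w" using assms by (auto simp: complex_line_iff)
  then show ?thesis using assms(2) complex_line_scale[of c w] by auto
qed

lemma topspace_CP1: "topspace CP1 = complex_line ` (- {0})"
  by (simp add: CP1_def)

lemma continuous_map_complex_line: "continuous_map (top_of_set (- {0})) CP1 complex_line"
  unfolding CP1_def by (rule quotient_imp_continuous_map[OF quotient_map_quotient_topology])

lemma open_map_complex_line: "open_map (top_of_set (- {0})) CP1 complex_line"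
  unfolding CP1_def
proof (rule open_map_quotient_topology)
  fix U :: "(complex^2) set" assume "openin (top_of_set (- {0})) U"
  then have U: "open U" "U \<subseteq> - {0}"
    by (simp_all add: openin_open_eq open_Compl)
  have "{x \<in> topspace (top_of_set (- {0})). complex_line x \<in> complex_line ` U}
      = (\<Union>c\<in>-{0}. (\<lambda>x. c *s x) -` U)" (is "?L = ?R")
  proof
    show "?L \<subseteq> ?R"
    proof
      fix x assume "x \<in> ?L"
      then obtain u where u: "x \<noteq> 0" "u \<in> U" "complex_line x = complex_line u" by auto
      then obtain c where "c \<noteq> 0" "u = c *s x"
        using complex_line_eq_iff[of x u] U(2) by auto
      then show "x \<in> ?R" using u by auto
    qed
    show "?R \<subseteq> ?L"
    proof
      fix x assume "x \<in> ?R"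
      then obtain c where c: "c \<noteq> 0" "c *s x \<in> U" by auto
      then have "complex_line x = complex_line (c *s x)" "x \<noteq> 0"
        using U(2) by (auto simp: complex_line_scale)
      then show "x \<in> ?L" using c by auto
    qed
  qed
  moreover have "open ?R"
    using U unfolding vector_scalar_mult_def
    by (intro open_UN ballI open_vimage) (auto intro!: continuous_intros)
  moreover have "?L \<subseteq> - {0}" by auto
  ultimately show "openin (top_of_set (- {0})) ?L"
    by (simp only: openin_open_eq open_Compl closed_singleton simp_thms)
qed

lemma topspace_blowup: "topspace blowup = {(z, L). L \<in> topspace CP1 \<and> norm z \<le> 1/10 \<and> z \<in> L}"
  by (auto simp: blowup_def)

lemma Y_class_eq_iff: "Y_class (z, L) = Y_class (z', L') \<longleftrightarrow> L = L' \<and> (z = z' \<or> z = - z')"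
  by (auto simp: Y_class_def doubleton_eq_iff)

lemma topspace_Y_space: "topspace Y_space = Y_class ` topspace blowup"
  by (simp add: Y_space_def)

lemma continuous_map_Y_class: "continuous_map blowup Y_space Y_class"
  unfolding Y_space_def by (rule quotient_imp_continuous_map[OF quotient_map_quotient_topology])

lemma uminus_complex_line:
  assumes "L \<in> topspace CP1" "z \<in> L" shows "- z \<in> L"
proof -
  obtain w where w: "L = complex_line w"
    using assms(1) by (auto simp: topspace_CP1)
  with assms(2) have "\<exists>c. z = c *s w"
    by (simp only: complex_line_iff)
  with w obtain c where L: "L = complex_line w" "z = c *s w"
    by blast
  have "- z = (- c) *s w" by (simp add: L(2))
  then show ?thesis unfolding L(1) complex_line_iff by blast
qed

lemma open_map_Y_class: "open_map blowup Y_space Y_class"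
  unfolding Y_space_def
proof (rule open_map_quotient_topology)
  fix U assume U: "openin blowup U"
  have neg: "continuous_map blowup blowup (\<lambda>x. (- fst x, snd x))"
    unfolding blowup_def continuous_map_in_subtopology
  proof (intro conjI continuous_map_pairedI)
    show "continuous_map (subtopology (prod_topology euclidean CP1) {(z, L). norm z \<le> 1/10 \<and> z \<in> L}) euclidean (\<lambda>x. - fst x)"
      by (intro continuous_map_from_subtopology continuous_map_minus continuous_map_fst)
    show "continuous_map (subtopology (prod_topology euclidean CP1) {(z, L). norm z \<le> 1/10 \<and> z \<in> L}) CP1 snd"
      by (intro continuous_map_from_subtopology continuous_map_snd)
  qed (auto simp: uminus_complex_line)
  have "{x \<in> topspace blowup. Y_class x \<in> Y_class ` U} = U \<union> {x \<in> topspace blowup. (- fst x, snd x) \<in> U}"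
    using openin_subset[OF U] by (auto simp: Y_class_eq_iff image_iff) (metis minus_minus Y_class_eq_iff)+
  then show "openin blowup {x \<in> topspace blowup. Y_class x \<in> Y_class ` U}"
    using U openin_continuous_map_preimage[OF neg U] by auto
qed

lemma quotient_map_orbifold_point: "quotient_map euclidean orbifold orbifold_point"
proof -
  have "orbifold_point = Gam_orbit \<circ> torus_class"
    by (simp add: orbifold_point_def fun_eq_iff)
  then show ?thesis
    unfolding orbifold_def torus5_def
    by (metis quotient_map_compose quotient_map_quotient_topology)
qed

lemma continuous_map_orbifold_point: "continuous_map euclidean orbifold orbifold_point"
  by (rule quotient_imp_continuous_map[OF quotient_map_orbifold_point])

lemma open_map_orbifold_point: "open_map euclidean orbifold orbifold_point"
  unfolding open_map_def
proof (intro allI impI)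
  fix U :: "(real^5) set" assume "openin euclidean U"
  then have U: "open U" by simp
  have "{x \<in> topspace euclidean. orbifold_point x \<in> orbifold_point ` U} = (\<Union>g\<in>deck_group. g -` U)"
    by (auto simp: image_iff orbifold_point_eq_iff deck_equiv_def Bex_def)
  moreover have "open (\<Union>g\<in>deck_group. g -` U)"
    using U by (intro open_UN ballI open_vimage continuous_on_deck_group)
  ultimately have "openin euclidean {x \<in> topspace euclidean. orbifold_point x \<in> orbifold_point ` U}"
    by simp
  moreover have "orbifold_point ` U \<subseteq> topspace orbifold"
    by (auto simp: topspace_orbifold)
  ultimately show "openin orbifold (orbifold_point ` U)"
    using quotient_map_orbifold_point unfolding quotient_map_def by blast
qed

text \<open>
  Homogeneous parameters for the blow-up: the pair \<open>(z, w)\<close> stands for the point \<open>z\<close> of the line through \<open>w\<close>.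
  In this way \<open>S\<^sup>1 \<times> Y\<close> becomes the quotient of a subset of a Euclidean space by an open map, and maps and
  homotopies on it can be written down by formulas in \<open>t\<close>, \<open>z\<close> and \<open>w\<close>.
\<close>

definition blowup_params :: "((complex^2) \<times> (complex^2)) set" where
  "blowup_params = {(z, w). w \<noteq> 0 \<and> norm z \<le> 1/10 \<and> z \<in> complex_line w}"

definition tube_param :: "real \<times> (complex^2) \<times> (complex^2) \<Rightarrow> real set \<times> blowup_pt set" where
  "tube_param = (\<lambda>(t, z, w). (circle_class t, Y_class (z, complex_line w)))"

lemma blowup_param:
  "continuous_map (top_of_set blowup_params) blowup (\<lambda>x. (fst x, complex_line (snd x)))"
  "open_map (top_of_set blowup_params) blowup (\<lambda>x. (fst x, complex_line (snd x)))"
proof -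
  let ?P = "prod_topology euclidean (top_of_set (- {0 :: complex^2})) :: ((complex^2) \<times> (complex^2)) topology"
    and ?V = "{(z :: complex^2, L :: (complex^2) set). norm z \<le> 1/10 \<and> z \<in> L}"
  have sub: "top_of_set blowup_params = subtopology ?P blowup_params"
  proof -
    have "?P = top_of_set (UNIV \<times> - {0})"
      by (metis prod_topology_subtopology_eu subtopology_UNIV)
    moreover have "blowup_params = blowup_params \<inter> (UNIV \<times> - {0})"
      by (auto simp: blowup_params_def)
    ultimately show ?thesis
      by (simp add: subtopology_subtopology Int_commute)
  qed
  have V: "{x \<in> topspace ?P. (fst x, complex_line (snd x)) \<in> ?V} = blowup_params"
    by (auto simp: blowup_params_def)
  have c: "continuous_map ?P (prod_topology euclidean CP1) (\<lambda>x. (fst x, complex_line (snd x)))"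
    by (intro continuous_map_pairedI continuous_map_fst
        continuous_map_compose[OF continuous_map_snd continuous_map_complex_line, unfolded o_def])
  show "continuous_map (top_of_set blowup_params) blowup (\<lambda>x. (fst x, complex_line (snd x)))"
    unfolding sub blowup_def continuous_map_in_subtopology
    using continuous_map_from_subtopology[OF c] by (auto simp: blowup_params_def)
  have "open_map ?P (prod_topology euclidean CP1) (\<lambda>x. (id (fst x), complex_line (snd x)))"
    by (rule open_map_prod[OF open_map_id open_map_complex_line])
  then show "open_map (top_of_set blowup_params) blowup (\<lambda>x. (fst x, complex_line (snd x)))"
    unfolding sub blowup_def by (intro open_map_restriction[OF _ V]) simp
qed

lemma tube_param_prod:
  "tube_param = (\<lambda>x. (circle_class (fst x), Y_class (fst (snd x), complex_line (snd (snd x)))))"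
  by (auto simp: tube_param_def)

lemma tube_param_domain: "top_of_set (UNIV \<times> blowup_params) = prod_topology euclideanreal (top_of_set blowup_params)"
  by (metis prod_topology_subtopology_eu subtopology_UNIV)

lemma continuous_map_tube_param:
  "continuous_map (top_of_set (UNIV \<times> blowup_params)) (prod_topology unit_circle Y_space) tube_param"
  unfolding tube_param_domain tube_param_prod
  by (intro continuous_map_pairedI
      continuous_map_compose[OF continuous_map_fst continuous_map_circle_class, unfolded o_def]
      continuous_map_compose[OF continuous_map_snd
        continuous_map_compose[OF blowup_param(1) continuous_map_Y_class], unfolded o_def])

lemma open_map_tube_param:
  "open_map (top_of_set (UNIV \<times> blowup_params)) (prod_topology unit_circle Y_space) tube_param"
  unfolding tube_param_domain tube_param_prod
  using open_map_prod[OF open_map_circle_class open_map_compose[OF blowup_param(2) open_map_Y_class]]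
  by (simp add: o_def)

lemma tube_param_surj: "tube_param ` (UNIV \<times> blowup_params) = topspace (prod_topology unit_circle Y_space)"
proof
  show "tube_param ` (UNIV \<times> blowup_params) \<subseteq> topspace (prod_topology unit_circle Y_space)"
    using continuous_map_image_subset_topspace[OF continuous_map_tube_param] by simp
  show "topspace (prod_topology unit_circle Y_space) \<subseteq> tube_param ` (UNIV \<times> blowup_params)"
  proof
    fix q assume "q \<in> topspace (prod_topology unit_circle Y_space)"
    then obtain t z w where q: "q = (circle_class t, Y_class (z, complex_line w))" "w \<noteq> 0" "norm z \<le> 1/10" "z \<in> complex_line w"
      by (auto simp: topspace_unit_circle topspace_Y_space topspace_blowup topspace_CP1)
    then show "q \<in> tube_param ` (UNIV \<times> blowup_params)"
      by (intro image_eqI[of _ _ "(t, z, w)"]) (auto simp: tube_param_def blowup_params_def)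
  qed
qed

lemma quotient_map_tube_param:
  "quotient_map (top_of_set (UNIV \<times> blowup_params)) (prod_topology unit_circle Y_space) tube_param"
  using continuous_map_tube_param open_map_tube_param tube_param_surj
  by (intro continuous_open_imp_quotient_map) auto

section \<open>Contracting a neighbourhood of an exceptional point\<close>

definition shrink_coord :: "2 \<Rightarrow> real \<Rightarrow> complex^2 \<Rightarrow> complex^2" where
  "shrink_coord k s v = (\<chi> i. if i = k then v $ i else of_real (1 - s) * v $ i)"

lemma shrink_coord_scale: "shrink_coord k s (c *s v) = c *s shrink_coord k s v"
  by (simp add: shrink_coord_def vec_eq_iff)

lemma shrink_coord_uminus: "shrink_coord k s (- v) = - shrink_coord k s v"
  by (simp add: shrink_coord_def vec_eq_iff)

lemma shrink_coord_0: "shrink_coord k 0 v = v"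
  by (simp add: shrink_coord_def vec_eq_iff)

lemma shrink_coord_1: "shrink_coord k 1 v = (v $ k) *s axis k 1"
  by (simp add: shrink_coord_def vec_eq_iff axis_def)

lemma norm_shrink_coord:
  assumes "s \<in> {0..1}" shows "norm (shrink_coord k s v) \<le> norm v"
proof (rule norm_le_componentwise_cart)
  fix i show "norm (shrink_coord k s v $ i) \<le> norm (v $ i)"
    using assms mult_right_mono[of "1 - s" 1 "norm (v $ i)"]
    by (auto simp: shrink_coord_def norm_mult simp del: of_real_diff)
qed

lemma continuous_on_shrink_coord [continuous_intros]:
  assumes "continuous_on S s" "continuous_on S v"
  shows "continuous_on S (\<lambda>x. shrink_coord k (s x) (v x))"
  unfolding shrink_coord_def
proof (rule continuous_on_vec_lambda)
  fix i show "continuous_on S (\<lambda>x. if i = k then v x $ i else of_real (1 - s x) * v x $ i)"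
    using assms by (cases "i = k") (auto intro!: continuous_intros)
qed

definition exceptional_params :: "2 \<Rightarrow> real \<Rightarrow> (real \<times> (complex^2) \<times> (complex^2)) set" where
  "exceptional_params k t0 = {(t, z, w). \<bar>t - t0\<bar> < 1/4 \<and> (z, w) \<in> blowup_params \<and> norm z < 1/10 \<and> w $ k \<noteq> 0}"

text \<open>
  A contraction of the part where \<open>w\<^sub>k \<noteq> 0\<close>: the linear map that shrinks the other coordinate is applied to
  both \<open>z\<close> and \<open>w\<close>, which keeps \<open>z\<close> on the line through \<open>w\<close>, while \<open>z\<close> is moreover scaled to zero and \<open>t\<close>
  moves to \<open>t\<^sub>0\<close>.  At each time it is linear in \<open>z\<close> and in \<open>w\<close>, so it descends to lines and to the quotient
  by \<open>\<plusminus>1\<close>.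
\<close>

definition exceptional_contraction :: "2 \<Rightarrow> real \<Rightarrow> real \<times> real \<times> (complex^2) \<times> (complex^2) \<Rightarrow> real \<times> (complex^2) \<times> (complex^2)" where
  "exceptional_contraction k t0 = (\<lambda>(s, t, z, w).
     (t0 + (1 - s) * (t - t0), (1 - s) *\<^sub>R shrink_coord k s z, shrink_coord k s w))"

lemma scaleR_eq_smult: "r *\<^sub>R v = complex_of_real r *s v"
  by (simp add: vec_eq_iff) (simp add: scaleR_conv_of_real)

lemma exceptional_contraction_in:
  assumes s: "s \<in> {0..1}" and x: "x \<in> exceptional_params k t0"
  shows "exceptional_contraction k t0 (s, x) \<in> exceptional_params k t0"
proof -
  obtain t z w where xe: "x = (t, z, w)" by (cases x)
  have x': "\<bar>t - t0\<bar> < 1/4" "norm z < 1/10" "w $ k \<noteq> 0" "z \<in> complex_line w"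
    using x by (auto simp: xe exceptional_params_def blowup_params_def)
  have "\<bar>(1 - s) * (t - t0)\<bar> \<le> \<bar>t - t0\<bar>"
    using s mult_right_mono[of "1 - s" 1 "\<bar>t - t0\<bar>"] by (simp add: abs_mult)
  moreover have "norm ((1 - s) *\<^sub>R shrink_coord k s z) \<le> norm z"
  proof -
    have "norm ((1 - s) *\<^sub>R shrink_coord k s z) \<le> norm (shrink_coord k s z)"
      using s mult_right_mono[of "1 - s" 1 "norm (shrink_coord k s z)"] by simp
    then show ?thesis using norm_shrink_coord[OF s, of k z] by linarith
  qed
  moreover have "(1 - s) *\<^sub>R shrink_coord k s z \<in> complex_line (shrink_coord k s w)"
  proof -
    obtain c where "z = c *s w" using x'(4) by (auto simp: complex_line_iff)
    then have "(1 - s) *\<^sub>R shrink_coord k s z = (of_real (1 - s) * c) *s shrink_coord k s w"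
      by (simp only: shrink_coord_scale scaleR_eq_smult vector_smult_assoc)
    then show ?thesis unfolding complex_line_iff by blast
  qed
  moreover have "shrink_coord k s w $ k \<noteq> 0"
    using x'(3) by (simp add: shrink_coord_def)
  moreover from this have "shrink_coord k s w \<noteq> 0" by auto
  ultimately show ?thesis
    using x' by (simp add: xe exceptional_params_def exceptional_contraction_def blowup_params_def del: norm_scaleR)
qed

lemma continuous_exceptional_contraction:
  "continuous_map (prod_topology (top_of_set {0..1}) (top_of_set (exceptional_params k t0)))
     (top_of_set (exceptional_params k t0)) (exceptional_contraction k t0)"
proof -
  have *: "exceptional_contraction k t0 = (\<lambda>x. (t0 + (1 - fst x) * (fst (snd x) - t0),
      (1 - fst x) *\<^sub>R shrink_coord k (fst x) (fst (snd (snd x))), shrink_coord k (fst x) (snd (snd (snd x)))))"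
    by (auto simp: exceptional_contraction_def)
  have "continuous_on ({0..1} \<times> exceptional_params k t0) (exceptional_contraction k t0)"
    unfolding * by (intro continuous_intros)
  moreover have "exceptional_contraction k t0 ` ({0..1} \<times> exceptional_params k t0) \<subseteq> exceptional_params k t0"
    using exceptional_contraction_in by blast
  ultimately show ?thesis
    by (simp add: image_subset_iff_funcset)
qed

lemma openin_exceptional_params: "openin (top_of_set (UNIV \<times> blowup_params)) (exceptional_params k t0)"
proof -
  let ?P = "\<lambda>x::real \<times> (complex^2) \<times> (complex^2). \<bar>fst x - t0\<bar> < 1/4 \<and> norm (fst (snd x)) < 1/10 \<and> snd (snd x) $ k \<noteq> 0"
  have "open {x. ?P x}"
    by (intro open_Collect_conj open_Collect_less open_Collect_neq continuous_intros)
  then have "openin (top_of_set (UNIV \<times> blowup_params)) ((UNIV \<times> blowup_params) \<inter> {x. ?P x})"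
    by (rule openin_open_Int)
  moreover have "(UNIV \<times> blowup_params) \<inter> {x. ?P x} = exceptional_params k t0"
    by (auto simp: exceptional_params_def)
  ultimately show ?thesis by simp
qed

text \<open>
  Used to join two points of a coordinate patch: as \<open>z\<close> and \<open>-z\<close> are the same point of the quotient, one of
  them can be reached along a straight segment on which the distinguished coordinate does not vanish.
\<close>

lemma segment_avoids_zero:
  fixes a b :: complex
  assumes "a \<noteq> 0" "b \<noteq> 0"
  shows "(\<forall>s\<in>{0..1}. of_real (1 - s) * a + of_real s * b \<noteq> 0) \<or>
    (\<forall>s\<in>{0..1}. of_real (1 - s) * a - of_real s * b \<noteq> 0)"
proof (rule ccontr)
  assume "\<not> ?thesis"
  then obtain s r :: real where s: "0 \<le> s" "s \<le> 1" "of_real (1 - s) * a + of_real s * b = 0"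
    and r: "0 \<le> r" "r \<le> 1" "of_real (1 - r) * a - of_real r * b = 0"
    by auto
  have 1: "of_real (1 - s) * a = - (of_real s * b)"
    using s(3) by (simp add: eq_neg_iff_add_eq_0)
  have 2: "of_real (1 - r) * a = of_real r * b"
    using r(3) by simp
  have "of_real ((1 - s) * r + (1 - r) * s) * b = of_real (1 - s) * (of_real r * b) + of_real (1 - r) * (of_real s * b)"
    by (simp add: algebra_simps)
  also have "\<dots> = of_real (1 - r) * (of_real (1 - s) * a) + of_real (1 - r) * (of_real s * b)"
    unfolding 2[symmetric] by (simp only: mult.left_commute)
  also have "\<dots> = 0"
    unfolding 1 by simp
  finally have "(1 - s) * r + (1 - r) * s = 0"
    using assms(2) by (metis mult_eq_0_iff of_real_eq_0_iff)
  moreover have "(1 - s) * r \<ge> 0" "(1 - r) * s \<ge> 0"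
    using s r by simp_all
  ultimately have "(1 - s) * r = 0" "(1 - r) * s = 0"
    by linarith+
  then have "s = 1 \<or> r = 0"
    by auto
  then show False
    using 1 2 assms by auto
qed

section \<open>The resolution and its blow-down map\<close>

context tube_system
begin

abbreviation X :: "piece_pt set topology" where
  "X \<equiv> resolution F"

definition pieces :: "piece_pt topology" where
  "pieces = disjoint_union_topology (complement_of_tubes F)
     (sum_topology (\<lambda>C. prod_topology unit_circle Y_space) singular_circles)"

definition cls :: "piece_pt \<Rightarrow> piece_pt set" where
  "cls x = {y. equivclp (glue F) x y}"

lemma resolution_eq: "resolution F = quotient_topology pieces cls"
proof -
  have "cls = (\<lambda>x. {y. equivclp (glue F) x y})"
    by (simp add: cls_def fun_eq_iff)
  then show ?thesis by (simp add: resolution_def pieces_def)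
qed

lemma quotient_map_cls: "quotient_map pieces X cls"
  unfolding resolution_eq by (rule quotient_map_quotient_topology)

lemma continuous_map_cls: "continuous_map pieces X cls"
  by (rule quotient_imp_continuous_map[OF quotient_map_cls])

lemma cls_eq: "equivclp (glue F) x y \<Longrightarrow> cls x = cls y"
  unfolding cls_def by (auto intro: equivclp_trans equivclp_sym)

lemma self_in_cls: "x \<in> cls x"
  by (simp add: cls_def)

definition tube_map :: "orbifold_pt set \<Rightarrow> real \<times> (complex^2) \<times> (complex^2) \<Rightarrow> piece_pt set" where
  "tube_map C x = cls (Inr (C, tube_param x))"

definition outer_map :: "real^5 \<Rightarrow> piece_pt set" where
  "outer_map x = cls (Inl (orbifold_point x))"

definition outside :: "(real^5) set" where
  "outside = {x. \<forall>C\<in>singular_circles. orbifold_point x \<notin> open_tube (F C)}"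

lemma continuous_map_tube_map:
  assumes "C \<in> singular_circles"
  shows "continuous_map (top_of_set (UNIV \<times> blowup_params)) X (tube_map C)"
proof -
  have "continuous_map (prod_topology unit_circle Y_space) pieces (Inr \<circ> Pair C)"
    unfolding pieces_def
    by (rule continuous_map_compose[OF continuous_map_sum_injection[of C singular_circles "\<lambda>C. prod_topology unit_circle Y_space", OF assms] continuous_map_Inr])
  then have "continuous_map (top_of_set (UNIV \<times> blowup_params)) X (cls \<circ> ((Inr \<circ> Pair C) \<circ> tube_param))"
    by (intro continuous_map_compose[OF _ continuous_map_cls] continuous_map_compose[OF continuous_map_tube_param])
  then show ?thesis
    by (simp add: o_def tube_map_def[abs_def])
qed

lemma continuous_map_outer_map: "continuous_map (top_of_set outside) X outer_map"
proof -
  have "continuous_map (top_of_set outside) (complement_of_tubes F) orbifold_point"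
    unfolding complement_of_tubes_def continuous_map_in_subtopology
    using continuous_map_from_subtopology[OF continuous_map_orbifold_point]
    by (auto simp: outside_def topspace_orbifold)
  then have "continuous_map (top_of_set outside) X (cls \<circ> (Inl \<circ> orbifold_point))"
    unfolding pieces_def
    by (intro continuous_map_compose[OF _ continuous_map_cls] continuous_map_compose[of _ "complement_of_tubes F"])
      (auto simp: pieces_def continuous_map_Inl)
  then show ?thesis
    by (simp add: o_def outer_map_def[abs_def])
qed

lemma resolution_cases:
  assumes "x \<in> topspace X"
  obtains (outer) w where "w \<in> outside" "x = outer_map w"
    | (tube) C t z w where "C \<in> singular_circles" "(z, w) \<in> blowup_params" "x = tube_map C (t, z, w)"
proof -
  obtain y where y: "y \<in> topspace pieces" "x = cls y"
    using assms by (auto simp: resolution_eq)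
  show thesis
  proof (cases y)
    case (Inl p)
    then have "p \<in> topspace orbifold" "\<forall>C\<in>singular_circles. p \<notin> open_tube (F C)"
      using y(1) by (auto simp: pieces_def complement_of_tubes_def)
    then obtain w where "p = orbifold_point w" "w \<in> outside"
      by (auto simp: topspace_orbifold outside_def)
    then show thesis using outer y(2) Inl by (simp add: outer_map_def)
  next
    case (Inr q)
    then obtain C r where q: "q = (C, r)" "C \<in> singular_circles" "r \<in> topspace (prod_topology unit_circle Y_space)"
      using y(1) by (cases q) (auto simp: pieces_def)
    then obtain t z w where "r = tube_param (t, z, w)" "(z, w) \<in> blowup_params"
      unfolding tube_param_surj[symmetric] by auto
    then show thesis using tube q(2) y(2) Inr q(1) by (simp add: tube_map_def)
  qed
qed

lemma outer_map_eq_tube_map: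
  assumes "C \<in> singular_circles" "norm z = 1/10"
  shows "tube_map C (t, z, z) = outer_map (F C (t, z))"
proof -
  have "glue F (Inr (C, circle_class t, Y_class (z, complex_line z))) (Inl (orbifold_point (F C (t, z))))"
  proof (rule glue.intros[OF assms])
    have "z \<noteq> 0" using assms(2) by auto
    then show "complex_line z \<in> topspace CP1" by (simp add: topspace_CP1)
  qed simp
  then show ?thesis
    unfolding tube_map_def outer_map_def by (intro cls_eq) (auto simp: tube_param_def r_into_equivclp)
qed

lemma tube_map_cong:
  assumes "t - t' \<in> \<int>" "z = z' \<or> z = - z'" "complex_line w = complex_line w'"
  shows "tube_map C (t, z, w) = tube_map C (t', z', w')"
proof -
  have "circle_class t = circle_class t'" "Y_class (z, complex_line w) = Y_class (z', complex_line w')"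
    using assms unfolding circle_class_eq_iff Y_class_eq_iff by auto
  then show ?thesis
    by (simp add: tube_map_def tube_param_def)
qed

text \<open>
  Only points with \<open>|z| = 1/10\<close> are glued.
\<close>

lemma equivclp_glue_interior:
  assumes z: "norm z < 1/10" and eq: "equivclp (glue F) (Inr (C, tube_param (t, z, w))) y"
  shows "y = Inr (C, tube_param (t, z, w))"
proof -
  have no: "\<not> glue F (Inr (C, tube_param (t, z, w))) v" "\<not> glue F v (Inr (C, tube_param (t, z, w)))" for v
  proof -
    show "\<not> glue F (Inr (C, tube_param (t, z, w))) v"
    proof
      assume "glue F (Inr (C, tube_param (t, z, w))) v"
      then obtain z' L where "Y_class (z, complex_line w) = Y_class (z', L)" "norm z' = 1/10"
        by cases (auto simp: tube_param_def)
      then show False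
        using z unfolding Y_class_eq_iff by auto
    qed
    show "\<not> glue F v (Inr (C, tube_param (t, z, w)))"
      by (auto elim: glue.cases)
  qed
  from eq show ?thesis
    unfolding equivclp_def
    by (cases rule: converse_rtranclpE) (auto simp: symclp_def no)
qed

text \<open>
  No other point is identified with a point of the given set, so that its preimage in the disjoint union
  of the pieces is its image in \<open>S\<^sup>1 \<times> Y\<close>, which is open.
\<close>

lemma open_tube_map_image:
  assumes C: "C \<in> singular_circles" and O: "openin (top_of_set (UNIV \<times> blowup_params)) O'"
    and small: "\<And>t z w. (t, z, w) \<in> O' \<Longrightarrow> norm z < 1/10"
  shows "openin X (tube_map C ` O')"
  unfolding resolution_eq openin_quotient_topology
proof
  have sub: "O' \<subseteq> UNIV \<times> blowup_params"
    using openin_subset[OF O] by simp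
  have op: "openin (prod_topology unit_circle Y_space) (tube_param ` O')"
    using open_map_tube_param O unfolding open_map_def by blast
  have top: "Inr (C, q) \<in> topspace pieces" if "q \<in> tube_param ` O'" for q
    using C openin_subset[OF op] that by (auto simp: pieces_def)
  have eq: "{x \<in> topspace pieces. cls x \<in> tube_map C ` O'} = Inr ` (Pair C ` tube_param ` O')"
  proof
    show "{x \<in> topspace pieces. cls x \<in> tube_map C ` O'} \<subseteq> Inr ` (Pair C ` tube_param ` O')"
    proof
      fix x assume "x \<in> {x \<in> topspace pieces. cls x \<in> tube_map C ` O'}"
      then obtain t z w where o: "(t, z, w) \<in> O'" "cls x = cls (Inr (C, tube_param (t, z, w)))"
        unfolding tube_map_def by (auto simp: image_iff)
      then have "x \<in> cls (Inr (C, tube_param (t, z, w)))"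
        using self_in_cls by blast
      then have "x = Inr (C, tube_param (t, z, w))"
        using equivclp_glue_interior[OF small[OF o(1)]] by (simp add: cls_def)
      with o(1) show "x \<in> Inr ` (Pair C ` tube_param ` O')" by blast
    qed
    show "Inr ` (Pair C ` tube_param ` O') \<subseteq> {x \<in> topspace pieces. cls x \<in> tube_map C ` O'}"
      using top by (auto simp: tube_map_def)
  qed
  show "tube_map C ` O' \<subseteq> cls ` topspace pieces"
    using top unfolding tube_map_def by blast
  have "{x. (D, x) \<in> Pair C ` tube_param ` O'} = (if D = C then tube_param ` O' else {})" for D
    by auto
  then have "openin (sum_topology (\<lambda>C. prod_topology unit_circle Y_space) singular_circles) (Pair C ` tube_param ` O')"
    unfolding openin_sum_topology using op openin_subset[OF op] C by auto
  then have "openin pieces (Inr ` (Pair C ` tube_param ` O'))"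
    unfolding pieces_def by (rule openin_Inr_image)
  then show "openin pieces {x \<in> topspace pieces. cls x \<in> tube_map C ` O'}"
    by (simp only: eq)
qed

text \<open>
  The map that collapses each exceptional sphere.  It is defined by a choice of coordinates of the point
  \<open>q\<close>; another choice differs by an integer in \<open>t\<close> and a sign in \<open>z\<close>, which leaves the value unchanged.
\<close>

definition blowdown_piece :: "piece_pt \<Rightarrow> orbifold_pt" where
  "blowdown_piece = case_sum (\<lambda>p. p) (\<lambda>(C, q). orbifold_point
     (F C (SOME v. \<exists>L. q = (circle_class (fst v), Y_class (snd v, L)))))"

definition blowdown :: "piece_pt set \<Rightarrow> orbifold_pt" where
  "blowdown S = blowdown_piece (SOME x. x \<in> S)"

lemma blowdown_piece_Inl: "blowdown_piece (Inl p) = p"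
  by (simp add: blowdown_piece_def)

lemma blowdown_piece_Inr:
  assumes C: "C \<in> singular_circles"
  shows "blowdown_piece (Inr (C, circle_class t, Y_class (z, L))) = orbifold_point (F C (t, z))"
proof -
  let ?P = "\<lambda>v. \<exists>L'. (circle_class t, Y_class (z, L)) = (circle_class (fst v), Y_class (snd v, L'))"
  define v where "v = (SOME v. ?P v)"
  have "?P v"
    unfolding v_def by (rule someI[of ?P "(t, z)"]) auto
  then have "t - fst v \<in> \<int>" "z = snd v \<or> z = - snd v"
    by (auto simp: circle_class_eq_iff Y_class_eq_iff)
  then have "orbifold_point (F C (t, z)) = orbifold_point (F C (fst v, snd v))"
    by (rule orbifold_point_tube_cong[OF C])
  then show ?thesis
    by (simp add: blowdown_piece_def v_def)
qed

lemma blowdown_cls: "blowdown (cls x) = blowdown_piece x"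
proof -
  have glue: "blowdown_piece x = blowdown_piece y" if "glue F x y" for x y
    using that by cases (simp add: blowdown_piece_Inl blowdown_piece_Inr)
  have "blowdown_piece x = blowdown_piece y" if "equivclp (glue F) x y" for y
    using that unfolding equivclp_def
    by (induction rule: rtranclp_induct) (auto simp: symclp_def dest: glue)
  moreover have "(SOME y. y \<in> cls x) \<in> cls x"
    using self_in_cls by (rule someI)
  ultimately show ?thesis
    unfolding blowdown_def cls_def by force
qed

lemma blowdown_tube_map: "C \<in> singular_circles \<Longrightarrow> blowdown (tube_map C (t, z, w)) = orbifold_point (F C (t, z))"
  by (simp add: tube_map_def blowdown_cls tube_param_def blowdown_piece_Inr)

lemma blowdown_outer_map: "blowdown (outer_map x) = orbifold_point x"
  by (simp add: outer_map_def blowdown_cls blowdown_piece_Inl)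

lemma continuous_map_blowdown: "continuous_map X orbifold blowdown"
proof -
  have tube: "continuous_map (prod_topology unit_circle Y_space) orbifold (\<lambda>q. blowdown_piece (Inr (C, q)))"
    if C: "C \<in> singular_circles" for C
  proof -
    obtain j where "tube_chart j (F C)" using chart[OF C] by blast
    then have "continuous_on UNIV (F C)" by (rule tube_chart_continuous)
    then have "continuous_on (UNIV \<times> blowup_params) (\<lambda>x. F C (fst x, fst (snd x)))"
      by (rule continuous_on_compose2) (auto intro!: continuous_intros)
    then have "continuous_map (top_of_set (UNIV \<times> blowup_params)) orbifold (orbifold_point \<circ> (\<lambda>x. F C (fst x, fst (snd x))))"
      by (intro continuous_map_compose[OF _ continuous_map_orbifold_point]) simp
    moreover have "orbifold_point \<circ> (\<lambda>x. F C (fst x, fst (snd x))) = (\<lambda>q. blowdown_piece (Inr (C, q))) \<circ> tube_param"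
      by (auto simp: fun_eq_iff tube_param_def blowdown_piece_Inr[OF C])
    ultimately have "continuous_map (top_of_set (UNIV \<times> blowup_params)) orbifold
        ((\<lambda>q. blowdown_piece (Inr (C, q))) \<circ> tube_param)"
      by (simp only:)
    then show ?thesis
      by (rule continuous_compose_quotient_map[OF quotient_map_tube_param])
  qed
  have "continuous_map pieces orbifold blowdown_piece"
    unfolding pieces_def
  proof (rule continuous_map_disjoint_union)
    show "continuous_map (complement_of_tubes F) orbifold (\<lambda>x. blowdown_piece (Inl x))"
      unfolding blowdown_piece_Inl complement_of_tubes_def
      by (simp add: continuous_map_from_subtopology)
    show "continuous_map (sum_topology (\<lambda>C. prod_topology unit_circle Y_space) singular_circles) orbifold
        (\<lambda>y. blowdown_piece (Inr y))"
      by (rule continuous_map_sum) (rule tube)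
  qed
  moreover have "blowdown_piece = blowdown \<circ> cls"
    by (simp add: fun_eq_iff blowdown_cls)
  ultimately have "continuous_map pieces orbifold (blowdown \<circ> cls)"
    by (simp only:)
  then show ?thesis
    by (rule continuous_compose_quotient_map[OF quotient_map_cls])
qed

section \<open>The covering of the regular part\<close>

text \<open>
  On the complement of the fixed lines this is the projection to the orbifold followed by the inverse of the
  blow-down map: in a tube, a point \<open>z \<noteq> 0\<close> determines the line in the blow-up, namely the one through \<open>z\<close>.
  Tube coordinates are unique enough for the value to be independent of the choice.
\<close>

definition cover :: "real^5 \<Rightarrow> piece_pt set" where
  "cover x =
    (if \<exists>C\<in>singular_circles. \<exists>t z. norm z \<le> 1/10 \<and> orbifold_point x = orbifold_point (F C (t, z))
     then SOME y. \<exists>C\<in>singular_circles. \<exists>t z. norm z \<le> 1/10 \<and>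
       orbifold_point x = orbifold_point (F C (t, z)) \<and> y = tube_map C (t, z, z)
     else outer_map x)"

lemma cover_tube:
  assumes C: "C \<in> singular_circles" and z: "norm z \<le> 1/10" and x: "orbifold_point x = orbifold_point (F C (t, z))"
  shows "cover x = tube_map C (t, z, z)"
proof -
  let ?P = "\<lambda>y. \<exists>C\<in>singular_circles. \<exists>t z. norm z \<le> 1/10 \<and>
       orbifold_point x = orbifold_point (F C (t, z)) \<and> y = tube_map C (t, z, z)"
  have "?P (tube_map C (t, z, z))"
    using assms by blast
  then have "?P (SOME y. ?P y)"
    by (rule someI[of ?P])
  moreover have "\<exists>C\<in>singular_circles. \<exists>t z. norm z \<le> 1/10 \<and> orbifold_point x = orbifold_point (F C (t, z))"
    using assms by blast
  then have "cover x = (SOME y. ?P y)"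
    unfolding cover_def by (rule if_P)
  ultimately have "?P (cover x)"
    by (simp only:)
  then obtain C' t' z' where C': "C' \<in> singular_circles" "norm z' \<le> 1/10"
    "orbifold_point x = orbifold_point (F C' (t', z'))" "cover x = tube_map C' (t', z', z')"
    by blast
  have "C = C' \<and> t - t' \<in> \<int> \<and> (z = z' \<or> z = - z')"
    using x C'(3) by (intro tube_coordinates_unique C C' z) simp
  then have "C = C'" "t - t' \<in> \<int>" "z = z' \<or> z = - z'" "complex_line z = complex_line z'"
    by auto
  then show ?thesis
    unfolding C'(4) using tube_map_cong[of t t' z z' z z' C'] by simp
qed

lemma outer_map_cong: "orbifold_point x = orbifold_point y \<Longrightarrow> outer_map x = outer_map y"
  by (simp add: outer_map_def)

lemma cover_cong:
  assumes "orbifold_point x = orbifold_point y" shows "cover x = cover y"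
  unfolding cover_def outer_map_def assms ..

lemma cover_outside:
  assumes "x \<in> outside" shows "cover x = outer_map x"
proof (cases "\<exists>C\<in>singular_circles. \<exists>t z. norm z \<le> 1/10 \<and> orbifold_point x = orbifold_point (F C (t, z))")
  case True
  then obtain C t z where *: "C \<in> singular_circles" "norm z \<le> 1/10" "orbifold_point x = orbifold_point (F C (t, z))"
    by blast
  have "\<not> norm z < 1/10"
    using assms * unfolding outside_def open_tube_def by blast
  then have "norm z = 1/10" using *(2) by simp
  then show ?thesis
    using cover_tube[OF *] outer_map_eq_tube_map[OF *(1)] outer_map_cong[OF *(3)] by simp
next
  case False
  then show ?thesis unfolding cover_def by (rule if_not_P)
qed

lemma blowdown_cover: "blowdown (cover x) = orbifold_point x"
proof (cases "\<exists>C\<in>singular_circles. \<exists>t z. norm z \<le> 1/10 \<and> orbifold_point x = orbifold_point (F C (t, z))")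
  case True
  then obtain C t z where *: "C \<in> singular_circles" "norm z \<le> 1/10" "orbifold_point x = orbifold_point (F C (t, z))"
    by blast
  then show ?thesis
    using cover_tube[OF *] blowdown_tube_map by simp
next
  case False
  then have "cover x = outer_map x" unfolding cover_def by (rule if_not_P)
  then show ?thesis by (simp add: blowdown_outer_map)
qed

lemma cover_eq_iff: "cover x = cover y \<longleftrightarrow> deck_equiv x y"
  using blowdown_cover cover_cong orbifold_point_eq_iff by metis

lemma cover_deck: "g \<in> deck_group \<Longrightarrow> cover (g x) = cover x"
  using cover_eq_iff deck_equiv_sym unfolding deck_equiv_def by metis

lemma fixed_lines_not_outside: "x \<in> outside \<Longrightarrow> x \<notin> fixed_lines"
proof
  assume "x \<in> outside" "x \<in> fixed_lines"
  then obtain C g t where "C \<in> singular_circles" "g \<in> deck_group" "x = g (F C (t, 0))"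
    using fixed_lines_covered by blast
  then have "orbifold_point x = orbifold_point (F C (t, 0))"
    using orbifold_point_eq_iff deck_equiv_sym unfolding deck_equiv_def by metis
  then have "orbifold_point x \<in> open_tube (F C)"
    unfolding open_tube_def by force
  then show False
    using \<open>x \<in> outside\<close> \<open>C \<in> singular_circles\<close> unfolding outside_def by blast
qed

lemma tube_on_fixed_lines:
  assumes "C \<in> singular_circles" "norm z \<le> 1/10"
  shows "F C (t, z) \<in> fixed_lines \<longleftrightarrow> z = 0"
proof -
  obtain j where "tube_chart j (F C)" using chart[OF assms(1)] by blast
  then show ?thesis
    by (rule tube_chart_on_fixed_lines) (use assms(2) in simp)
qed

lemma orbifold_point_fixed_lines:
  assumes "orbifold_point x = orbifold_point y" shows "x \<in> fixed_lines \<longleftrightarrow> y \<in> fixed_lines"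
  using assms orbifold_point_in_singular_set by metis

text \<open>
  The blow-down map is injective over the regular part: there \<open>z \<noteq> 0\<close> determines the line in the blow-up, and
  the two points with the same image on a boundary sphere are glued.
\<close>

lemma cover_eq_if_blowdown:
  assumes x: "x \<in> topspace X" "blowdown x = orbifold_point v" and v: "v \<notin> fixed_lines"
  shows "x = cover v"
  using x(1)
proof (cases rule: resolution_cases)
  case (outer w)
  then have "orbifold_point w = orbifold_point v"
    using x(2) by (simp add: blowdown_outer_map)
  then show ?thesis
    using outer cover_outside cover_cong by metis
next
  case (tube C t z w)
  have zw: "norm z \<le> 1/10" "z \<in> complex_line w"
    using tube(2) by (auto simp: blowup_params_def)
  have *: "orbifold_point v = orbifold_point (F C (t, z))"
    using x(2) tube blowdown_tube_map by simp
  have "z \<noteq> 0"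
    using v orbifold_point_fixed_lines[OF *] tube_on_fixed_lines[OF tube(1) zw(1)] by simp
  then have "complex_line w = complex_line z"
    using complex_line_of_member zw(2) by simp
  then have "x = tube_map C (t, z, z)"
    unfolding tube(3) by (intro tube_map_cong) auto
  then show ?thesis
    using cover_tube[OF tube(1) zw(1) *] by simp
qed

lemma resolution_point_cases:
  assumes "x \<in> topspace X"
  obtains (regular) v where "v \<notin> fixed_lines" "x = cover v"
    | (exceptional) C t w where "C \<in> singular_circles" "w \<noteq> 0" "x = tube_map C (t, 0, w)"
  using assms
proof (cases rule: resolution_cases)
  case (outer w)
  then show ?thesis
    using regular[of w] fixed_lines_not_outside cover_outside by simp
next
  case (tube C t z w)
  show ?thesis
  proof (cases "z = 0")
    case True
    then show ?thesis using tube exceptional[of C w t] by (auto simp: blowup_params_def)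
  next
    case False
    have z: "norm z \<le> 1/10" using tube(2) by (auto simp: blowup_params_def)
    have v: "F C (t, z) \<notin> fixed_lines"
      using tube_on_fixed_lines[OF tube(1) z] False by simp
    have "x = cover (F C (t, z))"
      by (rule cover_eq_if_blowdown[OF assms _ v]) (simp add: tube blowdown_tube_map)
    with v show ?thesis by (rule regular)
  qed
qed

text \<open>
  On a small ball that meets a tube, the tube is unique, up to the group of lifts, and its coordinates are
  isometric.  There the map is pasted, along the sphere \<open>|z| = 1/10\<close>, from the one defined by these coordinates
  and the one on the complement of the tubes.
\<close>

lemma continuous_map_cover: "continuous_map (top_of_set (- fixed_lines)) X cover"
proof (rule pasting_lemma[where I = "- fixed_lines" and T = "\<lambda>w. - fixed_lines \<inter> ball w (1/50)" and f = "\<lambda>_. cover"])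
  show "openin (top_of_set (- fixed_lines)) (- fixed_lines \<inter> ball w (1/50))" for w
    by (intro openin_open_Int) simp
  show "\<exists>j. j \<in> - fixed_lines \<and> x \<in> - fixed_lines \<inter> ball j (1/50) \<and> cover x = cover x"
    if "x \<in> topspace (top_of_set (- fixed_lines))" for x
    using that by (intro exI[of _ x]) simp
next
  fix w0 :: "real^5"
  let ?N = "- fixed_lines \<inter> ball w0 (1/50)"
  have "continuous_map (top_of_set ?N) X cover"
  proof (cases "?N \<subseteq> outside")
    case True
    show ?thesis
    proof (rule continuous_map_eq)
      show "continuous_map (top_of_set ?N) X outer_map"
        using continuous_map_from_subtopology_mono[OF continuous_map_outer_map True] .
    qed (use True cover_outside in auto)
  next
    case False
    then obtain y0 where y0: "y0 \<in> ?N" "y0 \<notin> outside" by blast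
    then obtain C where C: "C \<in> singular_circles" "orbifold_point y0 \<in> open_tube (F C)"
      unfolding outside_def by blast
    then obtain t0 z0 where z0: "norm z0 < 1/10" "orbifold_point y0 = orbifold_point (F C (t0, z0))"
      unfolding open_tube_def by blast
    then obtain g where g: "g \<in> deck_group" "y0 = g (F C (t0, z0))"
      using orbifold_point_eq_iff deck_equiv_sym unfolding deck_equiv_def by metis
    obtain j where j: "tube_chart j (F C)" using chart[OF C(1)] by blast
    obtain h where h: "h \<in> deck_group" "\<And>x. h (g x) = x" "\<And>x. g (h x) = x"
      using deck_group_inverse[OF g(1)] by metis
    define \<phi> where "\<phi> = (\<lambda>y. inv_into UNIV (F C) (h y))"
    have F\<phi>: "F C (\<phi> y) = h y" for y
      unfolding \<phi>_def by (rule surj_f_inv_f[OF tube_chart_surj[OF j]])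
    have \<phi>: "g (F C (\<phi> y)) = y" for y
      by (simp add: F\<phi> h)
    have "dist (\<phi> x) (\<phi> y) = dist x y" for x y
      using tube_chart_dist[OF j, of "\<phi> x" "\<phi> y"] deck_group_dist[OF h(1), of x y] by (simp add: F\<phi>)
    then have \<phi>c: "continuous_on S \<phi>" for S
      unfolding continuous_on_iff by auto
    have op\<phi>: "orbifold_point y = orbifold_point (F C (\<phi> y))" for y
      using \<phi>[of y] g(1) deck_equiv_sym unfolding orbifold_point_eq_iff deck_equiv_def by metis
    have other: "norm (snd (\<phi> y)) = norm z'"
      if y: "y \<in> ?N" and C': "C' \<in> singular_circles" "norm z' \<le> 1/10" "orbifold_point y = orbifold_point (F C' (t', z'))"
      for y C' t' z'
    proof -
      obtain g' where g': "g' \<in> deck_group" "y = g' (F C' (t', z'))"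
        using C'(3) orbifold_point_eq_iff deck_equiv_sym unfolding deck_equiv_def by metis
      have "dist y0 y < 1/20"
        using y y0(1) dist_triangle[of y0 y w0] by (simp add: dist_commute)
      then have near: "dist (g (F C (t0, z0))) (g' (F C' (t', z'))) < 1/20"
        unfolding g(2)[symmetric] g'(2)[symmetric] .
      have "norm z0 \<le> 1/10" using z0(1) by simp
      from tubes_far_apart[OF C(1) C'(1) g(1) g'(1) this C'(2) near]
      obtain s where "y = g (F C (s, z')) \<or> y = g (F C (s, - z'))"
        unfolding g'(2)[symmetric] by blast
      then have "F C (\<phi> y) = F C (s, z') \<or> F C (\<phi> y) = F C (s, - z')"
        unfolding F\<phi> using h(2) by auto
      then have "\<phi> y = (s, z') \<or> \<phi> y = (s, - z')"
        using tube_chart_inj[OF j] by blast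
      then show ?thesis by auto
    qed
    have out: "y \<in> outside" if y: "y \<in> ?N" "1/10 \<le> norm (snd (\<phi> y))" for y
    proof (rule ccontr)
      assume "y \<notin> outside"
      then obtain C' t' z' where *: "C' \<in> singular_circles" "norm z' < 1/10" "orbifold_point y = orbifold_point (F C' (t', z'))"
        unfolding outside_def open_tube_def by blast
      then have "norm (snd (\<phi> y)) = norm z'"
        by (intro other[OF y(1), of C' z' t']) simp_all
      with *(2) y(2) show False by simp
    qed
    define f where "f = (\<lambda>y. tube_map C (fst (\<phi> y), snd (\<phi> y), snd (\<phi> y)))"
    have inner: "cover y = f y" if "norm (snd (\<phi> y)) \<le> 1/10" for y
      unfolding f_def by (rule cover_tube[OF C(1) that]) (simp add: op\<phi>[of y])
    have "continuous_map (top_of_set ?N) X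
        (\<lambda>y. if norm (snd (\<phi> y)) \<le> 1/10 then f y else outer_map y)"
    proof (rule continuous_map_cases_le)
      let ?A = "{y \<in> topspace (top_of_set ?N). norm (snd (\<phi> y)) \<le> 1/10}"
      have "continuous_map (top_of_set ?A) (top_of_set (UNIV \<times> blowup_params)) (\<lambda>y. (fst (\<phi> y), snd (\<phi> y), snd (\<phi> y)))"
      proof -
        have "snd (\<phi> y) \<noteq> 0" if "y \<in> ?N" for y
        proof
          assume "snd (\<phi> y) = 0"
          then have "F C (\<phi> y) \<in> fixed_lines"
            using tube_on_fixed_lines[OF C(1), of 0 "fst (\<phi> y)"] by (metis norm_zero prod.collapse zero_le_divide_1_iff zero_le_numeral)
          then show False
            using orbifold_point_fixed_lines[OF op\<phi>[of y]] that by simp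
        qed
        then have "(\<lambda>y. (fst (\<phi> y), snd (\<phi> y), snd (\<phi> y))) ` ?A \<subseteq> UNIV \<times> blowup_params"
          by (auto simp: blowup_params_def)
        then show ?thesis
          by (auto intro!: continuous_intros \<phi>c simp: image_subset_iff_funcset)
      qed
      from continuous_map_compose[OF this continuous_map_tube_map[OF C(1)]]
      have "continuous_map (top_of_set ?A) X f"
        by (simp only: f_def o_def)
      moreover have "?N \<inter> ?A = ?A" by auto
      ultimately show "continuous_map (subtopology (top_of_set ?N) ?A) X f"
        by (simp only: subtopology_subtopology)
      let ?B = "{y \<in> topspace (top_of_set ?N). 1/10 \<le> norm (snd (\<phi> y))}"
      have "?B \<subseteq> outside" using out by auto
      then have "continuous_map (top_of_set ?B) X outer_map"
        by (rule continuous_map_from_subtopology_mono[OF continuous_map_outer_map])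
      moreover have "?N \<inter> ?B = ?B" by auto
      ultimately show "continuous_map (subtopology (top_of_set ?N) ?B) X outer_map"
        by (simp only: subtopology_subtopology)
      show "f y = outer_map y" if "y \<in> topspace (top_of_set ?N)" "norm (snd (\<phi> y)) = 1/10" for y
        using that inner[of y] cover_outside[OF out[of y]] by simp
    qed (auto intro!: continuous_intros \<phi>c)
    then show ?thesis
    proof (rule continuous_map_eq)
      fix y assume "y \<in> topspace (top_of_set ?N)"
      then show "(if norm (snd (\<phi> y)) \<le> 1/10 then f y else outer_map y) = cover y"
        using inner[of y] cover_outside[OF out[of y]] by simp
    qed
  qed
  then show "continuous_map (subtopology (top_of_set (- fixed_lines)) ?N) X cover"
    by (simp add: subtopology_subtopology inf.absorb2 Int_assoc[symmetric])
qed (rule refl)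

section \<open>Liftable neighbourhoods\<close>

text \<open>
  The group of lifts acts transitively on the fibres, so it is enough to lift some path between the two points,
  without prescribing where it starts.
\<close>

lemma liftable_nbhdI:
  assumes "openin X U"
    and "\<And>p. pathin X p \<Longrightarrow> p ` {0..1} \<subseteq> U \<Longrightarrow> p 0 = p 1 \<Longrightarrow> path_homotopic X p (\<lambda>t. p 0)"
    and lift: "\<And>a b. a \<in> cover ` (- fixed_lines) \<inter> U \<Longrightarrow> b \<in> cover ` (- fixed_lines) \<inter> U \<Longrightarrow>
      \<exists>q. path q \<and> path_image q \<subseteq> - fixed_lines \<and> cover (q 0) = a \<and> cover (q 1) = b \<and>
        cover ` path_image q \<subseteq> U"
  shows "liftable_nbhd (- fixed_lines) X cover U"
proof -
  have "\<exists>q. path q \<and> path_image q \<subseteq> - fixed_lines \<and> q 0 = w \<and> cover (q 1) = b \<and> cover ` path_image q \<subseteq> U"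
    if w: "w \<in> - fixed_lines" and b: "b \<in> cover ` (- fixed_lines) \<inter> U" and wU: "cover w \<in> U" for w b
  proof -
    have "cover w \<in> cover ` (- fixed_lines) \<inter> U"
      using w wU by simp
    then obtain q where q: "path q" "path_image q \<subseteq> - fixed_lines" "cover (q 0) = cover w" "cover (q 1) = b"
        "cover ` path_image q \<subseteq> U"
      using lift[of "cover w" b] b by blast
    obtain g where g: "g \<in> deck_group" "w = g (q 0)"
      using q(3) unfolding cover_eq_iff deck_equiv_def by blast
    have im: "path_image (g \<circ> q) = g ` path_image q"
      by (simp add: path_image_def image_comp)
    show ?thesis
    proof (intro exI[of _ "g \<circ> q"] conjI)
      show "path (g \<circ> q)"
        by (rule path_continuous_image[OF q(1) continuous_on_deck_group[OF g(1)]])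
      show "path_image (g \<circ> q) \<subseteq> - fixed_lines"
        using q(2) deck_fixed_lines[OF g(1)] unfolding im by auto
      show "cover ` path_image (g \<circ> q) \<subseteq> U"
        using q(5) cover_deck[OF g(1)] unfolding im by auto
    qed (use g q cover_deck[OF g(1)] in auto)
  qed
  then show ?thesis
    using assms(1,2) unfolding liftable_nbhd_def by simp
qed

lemma cover_in_resolution: "v \<notin> fixed_lines \<Longrightarrow> cover v \<in> topspace X"
  using continuous_map_image_subset_topspace[OF continuous_map_cover] by auto

text \<open>
  A small ball is mapped injectively to the orbifold, hence homeomorphically onto an open set, whose
  preimage under the blow-down map is the neighbourhood.  Paths in it are therefore images of paths in the
  ball.
\<close>

lemma regular_nbhd:
  assumes v: "v \<notin> fixed_lines"
  shows "\<exists>U. cover v \<in> U \<and> liftable_nbhd (- fixed_lines) X cover U"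
proof -
  have "open (- fixed_lines)"
    using closed_fixed_lines by (rule open_Compl)
  then obtain e where e: "e > 0" "ball v e \<subseteq> - fixed_lines"
    using v open_contains_ball by (metis ComplI)
  \<comment> \<open>Points of a ball of radius \<open>1/8\<close> are less than \<open>1/2\<close> apart, and the middle of two of them is again in the ball.\<close>
  define B where "B = ball v (min e (1/8))"
  have B: "open B" "convex B" "v \<in> B" "B \<subseteq> - fixed_lines"
    using e by (auto simp: B_def)
  have inj: "x = y" if xy: "x \<in> B" "y \<in> B" "orbifold_point x = orbifold_point y" for x y
  proof -
    obtain a b c n where y: "y = deck a b c n x"
      using xy(3) unfolding orbifold_point_eq_iff deck_equiv_def deck_group_def by blast
    have "dist y x < 1/4"
      using xy dist_triangle2[of y x v] by (simp add: B_def dist_commute)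
    then have small: "\<bar>deck a b c n x $ i - x $ i\<bar> < 1/2" for i
      using dist_component_le[of y i x] unfolding y by linarith
    have "(1/2) *\<^sub>R x + (1/2) *\<^sub>R y \<in> B"
      using convexD[OF B(2) xy(1,2), of "1/2" "1/2"] by simp
    then have "(1/2) *\<^sub>R (x + deck a b c n x) \<notin> fixed_lines"
      using B(4) unfolding y by (auto simp: scaleR_add_right)
    then show ?thesis
      using deck_small_move[OF small] y by metis
  qed
  let ?V = "orbifold_point ` B"
  define U where "U = {x \<in> topspace X. blowdown x \<in> ?V}"
  have "openin orbifold ?V"
    using open_map_orbifold_point B(1) unfolding open_map_def by simp
  then have U: "openin X U"
    unfolding U_def by (rule openin_continuous_map_preimage[OF continuous_map_blowdown])
  have inU: "cover x \<in> U" if "x \<in> B" for x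
    using that B(4) cover_in_resolution unfolding U_def by (auto simp: blowdown_cover)
  have U_lift: "\<exists>x\<in>B. y = cover x" if y: "y \<in> U" for y
  proof -
    obtain x where x: "x \<in> B" "blowdown y = orbifold_point x" "y \<in> topspace X"
      using y unfolding U_def by blast
    have "y = cover x"
      by (rule cover_eq_if_blowdown[OF x(3,2)]) (use x(1) B(4) in blast)
    with x(1) show ?thesis by blast
  qed
  have "homeomorphic_map (top_of_set B) (subtopology orbifold ?V) orbifold_point"
  proof (rule bijective_open_imp_homeomorphic_map)
    show "continuous_map (top_of_set B) (subtopology orbifold ?V) orbifold_point"
      using continuous_map_from_subtopology[OF continuous_map_orbifold_point]
      by (simp add: continuous_map_in_subtopology)
    show "open_map (top_of_set B) (subtopology orbifold ?V) orbifold_point"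
      unfolding open_map_def
    proof (intro allI impI)
      fix O' assume "openin (top_of_set B) O'"
      then have "open O'" "O' \<subseteq> B"
        using B(1) by (simp_all add: openin_open_eq)
      then have "openin orbifold (orbifold_point ` O')" "orbifold_point ` O' \<subseteq> ?V"
        using open_map_orbifold_point unfolding open_map_def by auto
      then show "openin (subtopology orbifold ?V) (orbifold_point ` O')"
        by (rule subset_openin_subtopology)
    qed
    show "orbifold_point ` topspace (top_of_set B) = topspace (subtopology orbifold ?V)"
      by (auto simp: topspace_orbifold)
    show "inj_on orbifold_point (topspace (top_of_set B))"
      using inj by (simp add: inj_on_def)
  qed
  then obtain \<psi> where \<psi>: "continuous_map (subtopology orbifold ?V) (top_of_set B) \<psi>"
      "\<And>y. y \<in> topspace (subtopology orbifold ?V) \<Longrightarrow> orbifold_point (\<psi> y) = y"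
    unfolding homeomorphic_map_maps homeomorphic_maps_def by blast
  have "liftable_nbhd (- fixed_lines) X cover U"
  proof (rule liftable_nbhdI[OF U])
    fix p assume p: "pathin X p" "p ` {0..1} \<subseteq> U" "p 0 = p 1"
    define q where "q = \<psi> \<circ> (blowdown \<circ> p)"
    have pU: "p t \<in> topspace X" "blowdown (p t) \<in> ?V" if "t \<in> {0..1}" for t
    proof -
      have "p t \<in> U" using p(2) that by blast
      then show "p t \<in> topspace X" "blowdown (p t) \<in> ?V"
        unfolding U_def by simp_all
    qed
    have bp: "blowdown (p t) \<in> topspace (subtopology orbifold ?V)" if "t \<in> {0..1}" for t
      using pU(2)[OF that] by (auto simp: topspace_orbifold)
    have "continuous_map (top_of_set {0..1}) (subtopology orbifold ?V) (blowdown \<circ> p)"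
      unfolding continuous_map_in_subtopology
    proof
      show "continuous_map (top_of_set {0..1}) orbifold (blowdown \<circ> p)"
        using p(1) unfolding pathin_def by (rule continuous_map_compose[OF _ continuous_map_blowdown])
      show "(blowdown \<circ> p) \<in> topspace (top_of_set {0..1}) \<rightarrow> ?V"
        using pU(2) by simp
    qed
    then have "continuous_map (top_of_set {0..1}) (top_of_set B) q"
      unfolding q_def by (rule continuous_map_compose[OF _ \<psi>(1)])
    then have q: "path q" "path_image q \<subseteq> B"
      by (auto simp: path_def path_image_def)
    have lq: "cover (q t) = p t" if t: "t \<in> {0..1}" for t
    proof (rule cover_eq_if_blowdown[symmetric])
      show "p t \<in> topspace X"
        using pU(1) t .
      show "blowdown (p t) = orbifold_point (q t)"
        using \<psi>(2)[OF bp[OF t]] by (simp add: q_def)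
      show "q t \<notin> fixed_lines"
        using q(2) t B(4) unfolding path_image_def by blast
    qed
    have "path_homotopic X (cover \<circ> q) (cover \<circ> (\<lambda>t. q 0))"
    proof (rule path_homotopic_simply_connected[OF convex_imp_simply_connected[OF B(2)]])
      show "continuous_map (top_of_set B) X cover"
        by (rule continuous_map_from_subtopology_mono[OF continuous_map_cover B(4)])
      show "path (\<lambda>t. q 0)" by (simp add: path_def)
      show "path_image (\<lambda>t. q 0) \<subseteq> B"
        using q(2) by (auto simp: path_image_def)
      show "q 1 = q 0" using p(3) by (simp add: q_def)
    qed (use q in auto)
    moreover have "cover \<circ> (\<lambda>t::real. q 0) = (\<lambda>t. p 0)"
      using lq[of 0] by (simp add: fun_eq_iff)
    ultimately have "path_homotopic X (cover \<circ> q) (\<lambda>t. p 0)"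
      by (simp only:)
    moreover have "path_homotopic X p (cover \<circ> q)"
      by (rule path_homotopic_eq[OF p(1)]) (simp add: lq)
    ultimately show "path_homotopic X p (\<lambda>t. p 0)"
      by (rule path_homotopic_trans[rotated])
  next
    fix a b assume "a \<in> cover ` (- fixed_lines) \<inter> U" "b \<in> cover ` (- fixed_lines) \<inter> U"
    then obtain x y where xy: "x \<in> B" "a = cover x" "y \<in> B" "b = cover y"
      using U_lift by blast
    have seg: "path_image (linepath x y) \<subseteq> B"
      using B(2) xy by (simp add: closed_segment_subset)
    show "\<exists>q. path q \<and> path_image q \<subseteq> - fixed_lines \<and> cover (q 0) = a \<and> cover (q 1) = b \<and>
        cover ` path_image q \<subseteq> U"
    proof (intro exI[of _ "linepath x y"] conjI)
      show "path_image (linepath x y) \<subseteq> - fixed_lines" using seg B(4) by blast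
      show "cover ` path_image (linepath x y) \<subseteq> U" using seg inU by blast
      show "cover (linepath x y 0) = a" "cover (linepath x y 1) = b"
        by (simp_all add: xy linepath_def)
    qed simp
  qed
  then show ?thesis
    using inU[OF B(3)] by blast
qed

lemma tube_map_eq_interior:
  assumes "tube_map C x = tube_map C y" "norm (fst (snd x)) < 1/10"
  shows "tube_param x = tube_param y"
proof -
  obtain t z w where x: "x = (t, z, w)" by (cases x)
  have "Inr (C, tube_param y) \<in> cls (Inr (C, tube_param x))"
    using assms(1) self_in_cls unfolding tube_map_def by metis
  then have "equivclp (glue F) (Inr (C, tube_param (t, z, w))) (Inr (C, tube_param y))"
    by (simp add: cls_def x)
  from equivclp_glue_interior[OF _ this] show ?thesis
    using assms(2) by (simp add: x)
qed

lemma tube_map_exceptional_contraction_cong: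
  assumes x: "x \<in> exceptional_params k t0" and y: "y \<in> exceptional_params k t0"
    and eq: "tube_map C x = tube_map C y"
  shows "tube_map C (exceptional_contraction k t0 (s, x)) = tube_map C (exceptional_contraction k t0 (s, y))"
proof -
  obtain t z w t' z' w' where xy: "x = (t, z, w)" "y = (t', z', w')" by (cases x; cases y)
  have p: "\<bar>t - t0\<bar> < 1/4" "\<bar>t' - t0\<bar> < 1/4" "norm z < 1/10" "w \<noteq> 0" "w' \<noteq> 0"
    using x y by (auto simp: xy exceptional_params_def blowup_params_def)
  have "tube_param x = tube_param y"
    using eq by (rule tube_map_eq_interior) (use p xy in simp)
  then have tp: "t - t' \<in> \<int>" "complex_line w = complex_line w'" "z = z' \<or> z = - z'"
    by (auto simp: xy tube_param_def circle_class_eq_iff Y_class_eq_iff)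
  have "t - t' = 0"
    using tp(1) by (rule Ints_eq_0) (use p in linarith)
  then have tt: "t = t'" by simp
  obtain c where c: "c \<noteq> 0" "w' = c *s w"
    using complex_line_eq_iff[OF p(4,5)] tp(2) by blast
  have zz: "(1 - s) *\<^sub>R shrink_coord k s z = (1 - s) *\<^sub>R shrink_coord k s z' \<or>
      (1 - s) *\<^sub>R shrink_coord k s z = - ((1 - s) *\<^sub>R shrink_coord k s z')"
    using tp(3) by (auto simp: shrink_coord_uminus)
  have ll: "complex_line (shrink_coord k s w) = complex_line (shrink_coord k s w')"
    unfolding c(2) shrink_coord_scale complex_line_scale[OF c(1)] ..
  show ?thesis
    unfolding xy exceptional_contraction_def prod.case tt by (rule tube_map_cong[OF _ zz ll]) simp
qed

lemma exceptional_contractible: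
  assumes C: "C \<in> singular_circles"
  shows "contractible_space (subtopology X (tube_map C ` exceptional_params k t0))"
proof -
  let ?S = "exceptional_params k t0" and ?I = "top_of_set {0..1::real}"
  let ?U = "tube_map C ` ?S"
  have sub: "?S \<subseteq> UNIV \<times> blowup_params"
    using openin_subset[OF openin_exceptional_params] by simp
  have cont: "continuous_map (top_of_set ?S) X (tube_map C)"
    by (rule continuous_map_from_subtopology_mono[OF continuous_map_tube_map[OF C] sub])
  have Utop: "?U \<subseteq> topspace X"
    using continuous_map_image_subset_topspace[OF cont] by simp
  have quot: "quotient_map (top_of_set ?S) (subtopology X ?U) (tube_map C)"
  proof (rule continuous_open_imp_quotient_map)
    show "continuous_map (top_of_set ?S) (subtopology X ?U) (tube_map C)"
      using cont by (simp add: continuous_map_in_subtopology)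
    show "open_map (top_of_set ?S) (subtopology X ?U) (tube_map C)"
      unfolding open_map_def
    proof (intro allI impI)
      fix O' assume O': "openin (top_of_set ?S) O'"
      then have "openin (top_of_set (UNIV \<times> blowup_params)) O'"
        using openin_exceptional_params openin_trans by blast
      then have "openin X (tube_map C ` O')"
        by (rule open_tube_map_image[OF C]) (use openin_subset[OF O'] in \<open>auto simp: exceptional_params_def\<close>)
      moreover have "tube_map C ` O' \<subseteq> ?U"
        using openin_subset[OF O'] by auto
      ultimately show "openin (subtopology X ?U) (tube_map C ` O')"
        by (rule subset_openin_subtopology)
    qed
    show "tube_map C ` topspace (top_of_set ?S) = topspace (subtopology X ?U)"
      using Utop by auto
  qed
  define \<sigma> where "\<sigma> u = (SOME x. x \<in> ?S \<and> tube_map C x = u)" for u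
  have \<sigma>: "\<sigma> u \<in> ?S \<and> tube_map C (\<sigma> u) = u" if u: "u \<in> ?U" for u
  proof -
    obtain x where "x \<in> ?S \<and> tube_map C x = u" using u by blast
    then show ?thesis unfolding \<sigma>_def by (rule someI)
  qed
  \<comment> \<open>the homotopy induced on the patch, independent of the choice of preimages \<open>\<sigma>\<close>\<close>
  define K where "K = (\<lambda>(s, u). tube_map C (exceptional_contraction k t0 (s, \<sigma> u)))"
  have K: "K (s, tube_map C x) = tube_map C (exceptional_contraction k t0 (s, x))" if x: "x \<in> ?S" for s x
  proof -
    have "tube_map C x \<in> ?U" using x by blast
    then have "\<sigma> (tube_map C x) \<in> ?S" "tube_map C (\<sigma> (tube_map C x)) = tube_map C x"
      using \<sigma> by blast+
    then show ?thesis
      unfolding K_def using tube_map_exceptional_contraction_cong[OF _ x] by simp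
  qed
  have q: "quotient_map (prod_topology ?I (top_of_set ?S)) (prod_topology ?I (subtopology X ?U)) (\<lambda>(s, x). (s, tube_map C x))"
  proof (rule quotient_map_prod_right[OF _ _ quot])
    show "locally_compact_space ?I"
      by (intro compact_imp_locally_compact_space) (simp add: compact_space_subtopology)
    show "Hausdorff_space ?I \<or> regular_space ?I"
      by (simp add: Hausdorff_space_subtopology)
  qed
  have "continuous_map (prod_topology ?I (top_of_set ?S)) (subtopology X ?U) (tube_map C \<circ> exceptional_contraction k t0)"
    by (rule continuous_map_compose[OF continuous_exceptional_contraction quotient_imp_continuous_map[OF quot]])
  then have "continuous_map (prod_topology ?I (top_of_set ?S)) (subtopology X ?U) (K \<circ> (\<lambda>(s, x). (s, tube_map C x)))"
    by (rule continuous_map_eq) (auto simp: K)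
  then have Kc: "continuous_map (prod_topology ?I (subtopology X ?U)) (subtopology X ?U) K"
    by (rule continuous_compose_quotient_map[OF q])
  define a where "a = tube_map C (t0, 0, axis k 1)"
  have K0: "K (0, u) = u" if "u \<in> ?U" for u
  proof -
    obtain x where x: "x \<in> ?S" "u = tube_map C x" using \<open>u \<in> ?U\<close> by blast
    obtain t z w where xe: "x = (t, z, w)" by (cases x)
    have "exceptional_contraction k t0 (0, x) = x"
      by (simp add: xe exceptional_contraction_def shrink_coord_0)
    then show ?thesis using K[OF x(1), of 0] x(2) by simp
  qed
  have K1: "K (1, u) = a" if "u \<in> ?U" for u
  proof -
    obtain x where x: "x \<in> ?S" "u = tube_map C x" using \<open>u \<in> ?U\<close> by blast
    obtain t z w where xe: "x = (t, z, w)" by (cases x)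
    have "w $ k \<noteq> 0" using x(1) by (auto simp: xe exceptional_params_def)
    then have "complex_line (shrink_coord k 1 w) = complex_line (axis k 1)"
      unfolding shrink_coord_1 by (rule complex_line_scale)
    then have "tube_map C (exceptional_contraction k t0 (1, x)) = a"
      unfolding a_def xe exceptional_contraction_def prod.case
      by (rule tube_map_cong[rotated 2]) simp_all
    then show ?thesis using K[OF x(1), of 1] x(2) by simp
  qed
  have "homotopic_with (\<lambda>x. True) (subtopology X ?U) (subtopology X ?U) id (\<lambda>x. a)"
  proof (subst homotopic_with)
    show "\<exists>h. continuous_map (prod_topology ?I (subtopology X ?U)) (subtopology X ?U) h \<and>
        (\<forall>x\<in>topspace (subtopology X ?U). h (0, x) = id x) \<and>
        (\<forall>x\<in>topspace (subtopology X ?U). h (1, x) = a) \<and> (\<forall>t\<in>{0..1}. True)"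
      using Kc K0 K1 by (intro exI[of _ K]) auto
  qed auto
  then show ?thesis
    unfolding contractible_space_def by blast
qed

lemma exceptional_loops_null:
  assumes C: "C \<in> singular_circles" and p: "pathin X p" "p ` {0..1} \<subseteq> tube_map C ` exceptional_params k t0" "p 0 = p 1"
  shows "path_homotopic X p (\<lambda>t. p 0)"
  by (rule null_homotopic_if_contractible[OF exceptional_contractible[OF C] p])

lemma tube_map_eq_cover:
  assumes C: "C \<in> singular_circles" and z: "z \<noteq> 0" "norm z \<le> 1/10" "z \<in> complex_line w"
  shows "tube_map C (t, z, w) = cover (F C (t, z))" "F C (t, z) \<notin> fixed_lines"
proof -
  have "complex_line w = complex_line z"
    using complex_line_of_member[OF z(3,1)] .
  then have "tube_map C (t, z, w) = tube_map C (t, z, z)"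
    by (intro tube_map_cong) auto
  then show "tube_map C (t, z, w) = cover (F C (t, z))"
    using cover_tube[OF C z(2) refl] by simp
  show "F C (t, z) \<notin> fixed_lines"
    using tube_on_fixed_lines[OF C z(2)] z(1) by simp
qed

text \<open>
  The regular points of the patch lift to points \<open>(t, z)\<close> with \<open>z\<^sub>k \<noteq> 0\<close>, and two of them are joined by a
  straight segment once the sign of one of them is chosen well.
\<close>

lemma exceptional_nbhd:
  assumes C: "C \<in> singular_circles"
  shows "liftable_nbhd (- fixed_lines) X cover (tube_map C ` exceptional_params k t0)"
proof (rule liftable_nbhdI)
  let ?S = "exceptional_params k t0"
  show "openin X (tube_map C ` ?S)"
    by (rule open_tube_map_image[OF C openin_exceptional_params]) (simp add: exceptional_params_def)
  show "path_homotopic X p (\<lambda>t. p 0)"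
    if "pathin X p" "p ` {0..1} \<subseteq> tube_map C ` ?S" "p 0 = p 1" for p
    by (rule exceptional_loops_null[OF C that])
  have rep: "\<exists>t z. \<bar>t - t0\<bar> < 1/4 \<and> norm z < 1/10 \<and> z $ k \<noteq> 0 \<and> a = cover (F C (t, z))"
    if a: "a \<in> cover ` (- fixed_lines) \<inter> tube_map C ` ?S" for a
  proof -
    obtain v where v: "v \<notin> fixed_lines" "a = cover v" using a by blast
    obtain x where x: "x \<in> ?S" "a = tube_map C x" using a by blast
    obtain t z w where xe: "x = (t, z, w)" by (cases x)
    have p: "\<bar>t - t0\<bar> < 1/4" "norm z < 1/10" "w $ k \<noteq> 0" "z \<in> complex_line w"
      using x(1) by (auto simp: xe exceptional_params_def blowup_params_def)
    have "orbifold_point v = orbifold_point (F C (t, z))"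
      using blowdown_cover[of v] blowdown_tube_map[OF C, of t z w] v(2) x(2) xe by simp
    then have "F C (t, z) \<notin> fixed_lines"
      using v(1) orbifold_point_fixed_lines by blast
    then have z: "z \<noteq> 0"
      using tube_on_fixed_lines[OF C, of z t] p(2) by simp
    obtain c where c: "z = c *s w" using p(4) by (auto simp: complex_line_iff)
    then have "z $ k \<noteq> 0" using z p(3) by auto
    moreover have "a = cover (F C (t, z))"
      unfolding x(2) xe by (rule tube_map_eq_cover[OF C z _ p(4)]) (use p(2) in simp)
    ultimately show ?thesis using p by blast
  qed
  fix a b assume "a \<in> cover ` (- fixed_lines) \<inter> tube_map C ` ?S" "b \<in> cover ` (- fixed_lines) \<inter> tube_map C ` ?S"
  then obtain t z t' z' where a: "\<bar>t - t0\<bar> < 1/4" "norm z < 1/10" "z $ k \<noteq> 0" "a = cover (F C (t, z))"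
    and b: "\<bar>t' - t0\<bar> < 1/4" "norm z' < 1/10" "z' $ k \<noteq> 0" "b = cover (F C (t', z'))"
    using rep[of a] rep[of b] by blast
  obtain z'' where z'': "z'' = z' \<or> z'' = - z'"
    and avoid: "\<And>s. s \<in> {0..1} \<Longrightarrow> of_real (1 - s) * z $ k + of_real s * z'' $ k \<noteq> 0"
    using segment_avoids_zero[OF a(3) b(3)]
  proof
    assume "\<forall>s\<in>{0..1}. of_real (1 - s) * z $ k + of_real s * z' $ k \<noteq> 0"
    then show thesis using that[of z'] by blast
  next
    assume "\<forall>s\<in>{0..1}. of_real (1 - s) * z $ k - of_real s * z' $ k \<noteq> 0"
    then show thesis using that[of "- z'"] by simp
  qed
  have nz'': "norm z'' < 1/10" using z'' b(2) by auto
  have b': "b = cover (F C (t', z''))"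
    unfolding b(4) by (rule cover_cong[OF orbifold_point_tube_cong[OF C]]) (use z'' in auto)
  define l where "l = linepath (t, z) (t', z'')"
  have l: "fst (l s) \<in> ball t0 (1/4)" "norm (snd (l s)) < 1/10" "snd (l s) $ k \<noteq> 0" if s: "s \<in> {0..1}" for s
  proof -
    have ls: "l s = ((1 - s) *\<^sub>R t + s *\<^sub>R t', (1 - s) *\<^sub>R z + s *\<^sub>R z'')"
      by (simp add: l_def linepath_def)
    have "t \<in> ball t0 (1/4)" "t' \<in> ball t0 (1/4)"
      using a(1) b(1) by (auto simp: dist_real_def abs_minus_commute)
    then show "fst (l s) \<in> ball t0 (1/4)"
      unfolding ls fst_conv using s by (intro convexD[OF convex_ball]) auto
    have "(1 - s) *\<^sub>R z + s *\<^sub>R z'' \<in> ball 0 (1/10)"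
      using s a(2) nz'' by (intro convexD[OF convex_ball]) auto
    then show "norm (snd (l s)) < 1/10"
      unfolding ls by simp
    show "snd (l s) $ k \<noteq> 0"
      using avoid[OF s]
      by (simp only: ls snd_conv vector_add_component vector_smult_component scaleR_eq_smult not_False_eq_True)
  qed
  obtain j where j: "tube_chart j (F C)" using chart[OF C] by blast
  have pt: "F C (l s) \<notin> fixed_lines \<and> cover (F C (l s)) \<in> tube_map C ` ?S" if s: "s \<in> {0..1}" for s
  proof -
    obtain u y where uy: "l s = (u, y)" by (cases "l s")
    have p: "\<bar>u - t0\<bar> < 1/4" "norm y < 1/10" "y $ k \<noteq> 0"
      using l[OF s] unfolding uy by (auto simp: dist_real_def abs_minus_commute)
    then have y0: "y \<noteq> 0" by auto
    have "tube_map C (u, y, y) = cover (F C (u, y))" "F C (u, y) \<notin> fixed_lines"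
      using tube_map_eq_cover[OF C y0, of y u] p(2) by auto
    moreover have "(u, y, y) \<in> ?S"
      using p y0 by (simp add: exceptional_params_def blowup_params_def)
    ultimately show ?thesis unfolding uy by (metis imageI)
  qed
  show "\<exists>q. path q \<and> path_image q \<subseteq> - fixed_lines \<and> cover (q 0) = a \<and> cover (q 1) = b \<and>
        cover ` path_image q \<subseteq> tube_map C ` ?S"
  proof (intro exI[of _ "F C \<circ> l"] conjI)
    show "path (F C \<circ> l)"
      unfolding l_def by (intro path_continuous_image tube_chart_continuous[OF j]) simp
    show "path_image (F C \<circ> l) \<subseteq> - fixed_lines" "cover ` path_image (F C \<circ> l) \<subseteq> tube_map C ` ?S"
      unfolding path_image_def using pt by auto
    show "cover ((F C \<circ> l) 0) = a" "cover ((F C \<circ> l) 1) = b"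
      by (simp_all add: l_def linepath_def a(4) b')
  qed
qed

lemma liftable_nbhds:
  assumes "x \<in> topspace X"
  shows "\<exists>U. x \<in> U \<and> liftable_nbhd (- fixed_lines) X cover U"
  using assms
proof (cases rule: resolution_point_cases)
  case (regular v)
  then show ?thesis using regular_nbhd by simp
next
  case (exceptional C t w)
  then obtain k where "w $ k \<noteq> 0"
    by (auto simp: vec_eq_iff)
  then have "(t, 0, w) \<in> exceptional_params k t"
    using exceptional by (simp add: exceptional_params_def blowup_params_def)
  then have "x \<in> tube_map C ` exceptional_params k t"
    unfolding exceptional(3) by blast
  then show ?thesis
    using exceptional_nbhd[OF exceptional(1)] by blast
qed

text \<open>
  An exceptional point is left along the fibre of the blow-up through it.
\<close>

lemma regular_points_dense:
  assumes N: "openin X N" "x \<in> N"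
  shows "\<exists>d. pathin X d \<and> d ` {0..1} \<subseteq> N \<and> d 0 = x \<and> d 1 \<in> cover ` (- fixed_lines)"
proof -
  have x: "x \<in> topspace X"
    using N openin_subset by blast
  then show ?thesis
  proof (cases rule: resolution_point_cases)
    case (regular v)
    then show ?thesis
      using x N(2) by (intro exI[of _ "\<lambda>t. x"]) auto
  next
    case (exceptional C t w)
    define z where "z = (1 / (10 * norm w)) *\<^sub>R w"
    have z: "z \<noteq> 0" "norm z \<le> 1/10"
      using exceptional(2) by (simp_all add: z_def)
    have zw: "r *\<^sub>R z \<in> complex_line w" for r
      unfolding complex_line_iff z_def scaleR_eq_smult vector_smult_assoc by blast
    define e where "e = (\<lambda>r. (t, r *\<^sub>R z, w))"
    have e_in: "e r \<in> UNIV \<times> blowup_params" if "r \<in> {0..1}" for r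
    proof -
      have "norm (r *\<^sub>R z) \<le> 1/10"
        using that z(2) mult_left_mono[of r 1 "norm z"] by (simp add: mult.commute)
      then show ?thesis
        using zw exceptional(2) by (simp add: e_def blowup_params_def del: norm_scaleR)
    qed
    have c: "continuous_map (top_of_set {0..1}) X (tube_map C \<circ> e)"
    proof (rule continuous_map_compose[OF _ continuous_map_tube_map[OF exceptional(1)]])
      have "continuous_on {0..1} e"
        unfolding e_def by (intro continuous_intros)
      then show "continuous_map (top_of_set {0..1}) (top_of_set (UNIV \<times> blowup_params)) e"
        using e_in by auto
    qed
    have e0: "(tube_map C \<circ> e) 0 = x"
      by (simp add: e_def exceptional(3))
    let ?T = "{r \<in> topspace (top_of_set {0..1}). (tube_map C \<circ> e) r \<in> N}"
    have "openin (top_of_set {0..1}) ?T"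
      by (rule openin_continuous_map_preimage[OF c N(1)])
    moreover have "0 \<in> ?T"
      using e0 N(2) by simp
    ultimately obtain \<delta> where \<delta>: "\<delta> > 0" "\<forall>r\<in>{0..1}. dist r 0 < \<delta> \<longrightarrow> r \<in> ?T"
      unfolding openin_euclidean_subtopology_iff by blast
    define m where "m = min 1 (\<delta> / 2)"
    have m: "0 < m" "m \<le> 1" "m < \<delta>"
      using \<delta>(1) by (auto simp: m_def min_def)
    have mr: "m * r \<in> {0..1}" "dist (m * r) 0 < \<delta>" if "r \<in> {0..1}" for r
    proof -
      have "0 \<le> m * r"
        using that m by simp
      moreover have "m * r \<le> m * 1"
        by (rule mult_left_mono) (use that m in auto)
      then have "m * r \<le> m" by (simp only: mult_1_right)
      ultimately show "m * r \<in> {0..1}" "dist (m * r) 0 < \<delta>"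
        using m unfolding atLeastAtMost_iff dist_real_def by linarith+
    qed
    show ?thesis
    proof (intro exI[of _ "(tube_map C \<circ> e) \<circ> (\<lambda>r. m * r)"] conjI)
      show "pathin X ((tube_map C \<circ> e) \<circ> (\<lambda>r. m * r))"
        using c mr(1) by (intro pathin_reparam) (auto simp: pathin_def intro!: continuous_intros)
      show "((tube_map C \<circ> e) \<circ> (\<lambda>r. m * r)) ` {0..1} \<subseteq> N"
        using \<delta>(2) mr by auto
      show "((tube_map C \<circ> e) \<circ> (\<lambda>r. m * r)) 0 = x"
        using e0 by simp
      have "m * norm z \<le> 1 * norm z"
        by (rule mult_right_mono) (use m in auto)
      moreover have "norm (m *\<^sub>R z) = m * norm z"
        using m by simp
      ultimately have "norm (m *\<^sub>R z) \<le> 1/10"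
        using z(2) by linarith
      moreover have "m *\<^sub>R z \<noteq> 0"
        using m z(1) by simp
      ultimately have "tube_map C (t, m *\<^sub>R z, w) = cover (F C (t, m *\<^sub>R z))" "F C (t, m *\<^sub>R z) \<notin> fixed_lines"
        using tube_map_eq_cover[OF exceptional(1) _ _ zw] by blast+
      then show "((tube_map C \<circ> e) \<circ> (\<lambda>r. m * r)) 1 \<in> cover ` (- fixed_lines)"
        by (simp add: e_def)
    qed
  qed
qed

section \<open>Monodromy\<close>

text \<open>
  The relation that the triviality of the monodromy asserts on fibres; it is transitive, so it
  can be checked on generators.
\<close>

definition trivially_connected :: "real^5 \<Rightarrow> real^5 \<Rightarrow> bool" where
  "trivially_connected x y \<longleftrightarrow> (\<exists>q. path q \<and> path_image q \<subseteq> - fixed_lines \<and> q 0 = x \<and> q 1 = y \<and>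
     path_homotopic X (cover \<circ> q) (\<lambda>t. cover x))"

lemma pathin_cover:
  assumes "path q" "path_image q \<subseteq> - fixed_lines" shows "pathin X (cover \<circ> q)"
  using assms unfolding pathin_def path_def path_image_def
  by (intro continuous_map_compose[OF _ continuous_map_cover]) auto

lemma trivially_connected_refl:
  assumes "x \<notin> fixed_lines" shows "trivially_connected x x"
  unfolding trivially_connected_def
proof (intro exI[of _ "\<lambda>t. x"] conjI)
  show "path (\<lambda>t. x)" by (simp add: path_def)
  show "path_image (\<lambda>t. x) \<subseteq> - fixed_lines" using assms by (auto simp: path_image_def)
  show "path_homotopic X (cover \<circ> (\<lambda>t. x)) (\<lambda>t. cover x)"
    using cover_in_resolution[OF assms] by (simp add: o_def path_homotopic_refl)
qed auto

lemma trivially_connected_trans: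
  assumes "trivially_connected x y" "trivially_connected y z" shows "trivially_connected x z"
proof -
  obtain q where q: "path q" "path_image q \<subseteq> - fixed_lines" "q 0 = x" "q 1 = y"
    "path_homotopic X (cover \<circ> q) (\<lambda>t. cover x)"
    using assms(1) unfolding trivially_connected_def by blast
  obtain r where r: "path r" "path_image r \<subseteq> - fixed_lines" "r 0 = y" "r 1 = z"
    "path_homotopic X (cover \<circ> r) (\<lambda>t. cover y)"
    using assms(2) unfolding trivially_connected_def by blast
  have yx: "cover y = cover x"
    using conjunct2[OF path_homotopic_imp_ends[OF q(5)]] unfolding o_def q(4) by simp
  have top: "cover x \<in> topspace X"
    using path_homotopic_imp_pathin[OF q(5)] by simp
  have "path_homotopic X ((cover \<circ> q) \<oplus>\<^sub>p (cover \<circ> r)) ((\<lambda>t. cover x) \<oplus>\<^sub>p (\<lambda>t. cover x))"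
    using q(5) r(5) unfolding yx by (rule path_homotopic_join) (simp add: q(4) r(3))
  also have "path_homotopic X \<dots> (\<lambda>t. cover x)"
    using top by (intro path_homotopic_join_const) simp_all
  finally have *: "path_homotopic X (cover \<circ> (q +++ r)) (\<lambda>t. cover x)"
    by (simp add: joinpaths_def join_path_def o_def if_distrib[of cover] cong: if_cong)
  show ?thesis
    unfolding trivially_connected_def
  proof (intro exI[of _ "q +++ r"] conjI)
    show "path (q +++ r)" "path_image (q +++ r) \<subseteq> - fixed_lines"
      using q r by (simp_all add: pathstart_def pathfinish_def path_image_join)
    show "(q +++ r) 0 = x" "(q +++ r) 1 = z"
      using q r by (simp_all add: joinpaths_def)
  qed (rule *)
qed

text \<open>
  Go from \<open>x\<close> to a point \<open>(t, z)\<close> close to the axis of the half-turn, along the half circle from \<open>(t, z)\<close> to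
  \<open>(t, -z)\<close> inside one complex line, and back along the image of the first path under the half-turn.  The first
  and the last part have opposite images in \<open>X\<close>, and the image of the half circle is a loop in a contractible
  patch of the resolution.
\<close>

lemma half_turn_step_trivial:
  assumes x: "x \<notin> fixed_lines" and step: "half_turn_step x y"
  shows "trivially_connected x y"
proof -
  obtain j u where j: "j \<in> line_axes" "u \<in> singular_lines j" and y: "y = half_turn j u x"
    using step unfolding half_turn_step_def by blast
  have ht: "half_turn j u \<in> deck_group"
    using half_turn_in_deck_group[OF j(2,1)] .
  obtain C g t where C: "C \<in> singular_circles" and g: "g \<in> deck_group" and u: "u = g (F C (t, 0))"
    using fixed_lines_covered[OF fixed_linesI[OF j]] by blast
  obtain j' where j': "tube_chart j' (F C)" using chart[OF C] by blast
  have "u \<in> singular_lines j'"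
    unfolding u by (rule deck_singular_lines[OF g tube_chart_line[OF j']])
  then have jj: "j' = j"
    using singular_lines_separated[OF j(2) _ j(1) tube_chart_axis[OF j'], of u] by simp
  define z :: "complex^2" where "z = axis 1 (1/20)"
  \<comment> \<open>The half circle from \<open>z\<close> to \<open>- z\<close> in the complex line through \<open>z\<close>.\<close>
  define rot where "rot s = cis (pi * s) *s z" for s :: real
  have z_nz: "z $ 1 \<noteq> 0" by (simp add: z_def)
  have nrot: "norm (rot s) = 1/20" "rot s $ 1 \<noteq> 0" for s
  proof -
    have "rot s = axis 1 (cis (pi * s) * (1/20))"
      by (simp add: rot_def z_def vec_eq_iff axis_def)
    then show "norm (rot s) = 1/20"
      by (simp add: norm_axis_eq norm_mult)
    show "rot s $ 1 \<noteq> 0" by (simp add: rot_def z_nz)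
  qed
  have rot_ends: "rot 0 = z" "rot 1 = - z"
    by (simp_all add: rot_def)
  define a where "a s = g (F C (t, rot s))" for s
  have la: "cover (a s) \<in> tube_map C ` exceptional_params 1 t" "a s \<notin> fixed_lines" for s
  proof -
    have nz: "rot s \<noteq> 0" using nrot[of s] by auto
    have "tube_map C (t, rot s, rot s) = cover (F C (t, rot s))" "F C (t, rot s) \<notin> fixed_lines"
      using tube_map_eq_cover[OF C nz, of "rot s" t] nrot[of s] by auto
    moreover have "(t, rot s, rot s) \<in> exceptional_params 1 t"
      using nrot[of s] nz by (simp add: exceptional_params_def blowup_params_def)
    ultimately show "cover (a s) \<in> tube_map C ` exceptional_params 1 t" "a s \<notin> fixed_lines"
      unfolding a_def cover_deck[OF g] deck_fixed_lines[OF g] by (metis imageI, simp)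
  qed
  have "continuous_on {0..1} rot"
    unfolding rot_def vector_scalar_mult_def by (intro continuous_intros)
  then have "continuous_on {0..1} (\<lambda>s. F C (t, rot s))"
    by (intro continuous_on_compose2[OF tube_chart_continuous[OF j', of UNIV]] continuous_intros) auto
  then have pa: "path a"
    unfolding path_def a_def by (rule continuous_on_compose2[OF continuous_on_deck_group[OF g, of UNIV]]) simp
  have ia: "path_image a \<subseteq> - fixed_lines"
    using la(2) by (auto simp: path_image_def)
  have a1: "a 1 = half_turn j u (a 0)"
    unfolding a_def rot_ends u deck_group_half_turn[OF g] tube_chart_half_turn[OF j', unfolded jj] ..
  have "cover (a 0) = cover (a 1)"
    unfolding a1 cover_deck[OF ht] ..
  then have na: "path_homotopic X (cover \<circ> a) (\<lambda>s. cover (a 0))"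
    using exceptional_loops_null[OF C pathin_cover[OF pa ia], of 1 t] la(1) by auto
  obtain c where c: "path c" "path_image c \<subseteq> - fixed_lines" "c 0 = x" "c 1 = a 0"
  proof -
    have "path_connected (- fixed_lines)"
      by (rule simply_connected_imp_path_connected[OF simply_connected_Compl_fixed_lines])
    moreover have "x \<in> - fixed_lines" "a 0 \<in> - fixed_lines" using x la(2) by auto
    ultimately show thesis
      using that unfolding path_connected_def pathstart_def pathfinish_def by blast
  qed
  define d where "d = half_turn j u \<circ> reversepath c"
  have d: "path d" "path_image d \<subseteq> - fixed_lines" "d 0 = a 1" "d 1 = y"
  proof -
    show "path d"
      unfolding d_def using c(1) by (intro path_continuous_image continuous_on_deck_group[OF ht]) simp
    have "path_image d = half_turn j u ` path_image c"
      unfolding d_def by (simp add: path_image_compose)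
    then show "path_image d \<subseteq> - fixed_lines"
      using c(2) deck_fixed_lines[OF ht] by auto
    show "d 0 = a 1" "d 1 = y"
      by (simp_all add: d_def reversepath_def c a1 y)
  qed
  have ld: "cover \<circ> d = reverse_path (cover \<circ> c)"
    by (auto simp: d_def reversepath_def reverse_path_def cover_deck[OF ht] fun_eq_iff)
  let ?c = "cover \<circ> c"
  have pc: "pathin X ?c" using pathin_cover[OF c(1,2)] .
  have "path_homotopic X (?c \<oplus>\<^sub>p ((cover \<circ> a) \<oplus>\<^sub>p reverse_path ?c)) (?c \<oplus>\<^sub>p ((\<lambda>s. cover (a 0)) \<oplus>\<^sub>p reverse_path ?c))"
    using \<open>cover (a 0) = cover (a 1)\<close> c(4)
    by (intro path_homotopic_join path_homotopic_refl pc na pathin_reverse) auto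
  also have "path_homotopic X \<dots> (?c \<oplus>\<^sub>p reverse_path ?c)"
    using c(4) by (intro path_homotopic_join path_homotopic_refl pc path_homotopic_const_join pathin_reverse) auto
  also have "path_homotopic X \<dots> (\<lambda>t. cover x)"
    using path_homotopic_join_reverse[OF pc] c(3) by simp
  finally have null: "path_homotopic X (?c \<oplus>\<^sub>p ((cover \<circ> a) \<oplus>\<^sub>p (cover \<circ> d))) (\<lambda>t. cover x)"
    unfolding ld .
  have e: "cover \<circ> (c +++ (a +++ d)) = ?c \<oplus>\<^sub>p ((cover \<circ> a) \<oplus>\<^sub>p (cover \<circ> d))"
    by (auto simp: joinpaths_def join_path_def fun_eq_iff)
  show ?thesis
    unfolding trivially_connected_def
  proof (intro exI[of _ "c +++ (a +++ d)"] conjI)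
    have ad: "pathfinish a = pathstart d" "pathfinish c = pathstart (a +++ d)"
      using c d by (simp_all add: pathstart_def pathfinish_def joinpaths_def)
    show "path (c +++ (a +++ d))"
      using c(1) pa d(1) ad by (intro path_join_imp)
    show "path_image (c +++ (a +++ d)) \<subseteq> - fixed_lines"
      using c(2) ia d(2) by (intro subset_path_image_join)
    show "(c +++ (a +++ d)) 0 = x" "(c +++ (a +++ d)) 1 = y"
      using c d by (simp_all add: joinpaths_def)
  qed (use null e in simp)
qed

lemma deck_equiv_imp_trivially_connected:
  assumes x: "x \<notin> fixed_lines" and xy: "deck_equiv x y"
  shows "trivially_connected x y"
proof -
  have "half_turn_step\<^sup>*\<^sup>* x y"
    using xy by (rule deck_equiv_imp_half_turns)
  then have "y \<notin> fixed_lines \<and> trivially_connected x y"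
  proof induction
    case base
    then show ?case using x trivially_connected_refl by simp
  next
    case (step y z)
    then have yz: "trivially_connected y z"
      by (intro half_turn_step_trivial) simp_all
    then have "z \<notin> fixed_lines"
      unfolding trivially_connected_def path_image_def by (metis ComplD atLeastAtMost_iff imageI order_refl subsetD zero_le_one)
    with step yz show ?case using trivially_connected_trans by blast
  qed
  then show ?thesis ..
qed

theorem simply_connected_resolution: "simply_connected_space (resolution F)"
proof (rule simply_connected_space_if_paths_lift[OF continuous_map_cover liftable_nbhds regular_points_dense
      simply_connected_Compl_fixed_lines])
  fix w w' assume "w \<in> - fixed_lines" "w' \<in> - fixed_lines" "cover w = cover w'"
  then have "trivially_connected w w'"
    by (intro deck_equiv_imp_trivially_connected) (simp_all add: cover_eq_iff)
  then show "\<exists>q. path q \<and> path_image q \<subseteq> - fixed_lines \<and> q 0 = w \<and> q 1 = w' \<and>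
      path_homotopic X (cover \<circ> q) (\<lambda>t. cover w)"
    unfolding trivially_connected_def .
qed

end

theorem proposition3p3:
  fixes F :: "orbifold_pt set \<Rightarrow> coords"
  assumes "\<And>C. C \<in> singular_circles \<Longrightarrow> tube_coordinates C (F C)"
  shows "simply_connected_space (resolution F)"
proof -
  interpret tube_system F
    by unfold_locales (rule assms)
  show ?thesis
    by (rule simply_connected_resolution)
qed

end
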